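(* Let $Q\subset\mathbf{C}^4$ (coordinates $(z_1,z_2,\zeta,w=u+iv)$) be the hypersurface $v=2\mathrm{Re}(z_1\bar\zeta+z_2\bar\zeta^2)$. Identify a germ at $0$ of a vector field $X=2\mathrm{Re}\big(f\partial_{z_1}+g\partial_{z_2}+h\partial_\zeta+e\partial_w\big)$ ($f,g,h,e$ holomorphic near $0$) with the tuple $(f,g,h,e)$, and let $\mathrm{aut}\,Q$ be the real Lie algebra of such germs tangent to $Q$. (a) $\mathrm{aut}\,Q=g_{-3}\oplus g_{-2}\oplus g_{-1}\oplus g_0\oplus g_1$, where $g_{-3}=\{(0,0,0,d):d\in\mathbf{R}\}$; $g_{-2}=\{(a,0,0,2i\bar a\zeta):a\in\mathbf{C}\}$; $g_{-1}=\{(-2\bar c z_2+ik\zeta,\ b,\ c,\ 2i\bar c z_1+2i\bar b\zeta^2):b,c\in\mathbf{C},k\in\mathbf{R}\}$; $g_0=\{(Mz_1+m\zeta^2,\ (2M-3l)z_2-\bar m\zeta,\ (3l-\bar M)\zeta,\ 3lw):M,m\in\mathbf{C},l\in\mathbf{R}\}$; $g_1=\{(2i\bar N z_1\zeta+Nw,\ 2i\bar N z_2\zeta-iNz_1+in\zeta^2,\ i\bar N\zeta^2,\ 2i\bar N\zeta w):N\in\mathbf{C},n\in\mathbf{R}\}$; and $\dim\mathrm{aut}\,Q=16$. (b) The stabilizer $\mathrm{aut}_0\,Q$ of the origin (fields vanishing at $0$) equals $g''_{-1}\oplus g_0\oplus g_1$, where $g''_{-1}=\{(ik\zeta,0,0,0):k\in\mathbf{R}\}$;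 its dimension is $9$. (c) If $\Gamma_0$ is a germ at $0$ of a real-analytic hypersurface of the form $v=2\mathrm{Re}(z_1\bar\zeta+z_2\bar\zeta^2)+O(4)$, where $O(4)$ denotes terms of weight at least $4$ with respect to the weights $[z_1]=2$, $[z_2]=[\zeta]=1$, $[w]=[u]=3$, then $\dim\mathrm{aut}\,\Gamma_0\le 16$ and $\dim\mathrm{aut}_0\,\Gamma_0\le 9$.
   Context: $\mathrm{aut}\,\Gamma_0$ denotes the Lie algebra of germs at $0$ of real-analytic vector fields of the form $2\mathrm{Re}(f\partial_{z_1}+g\partial_{z_2}+h\partial_\zeta+e\partial_w)$ with holomorphic coefficients, tangent to $\Gamma_0$; $\mathrm{aut}_0\,\Gamma_0$ is its subalgebra of fields vanishing at $0$. *)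

theory Defs
  imports "HOL-Analysis.Analysis"
begin

text \<open>Points of C^4 with coordinates (z1, z2, zeta, w).  A germ of a vector field
  2 Re(f d/dz1 + g d/dz2 + h d/dzeta + e d/dw) is identified with the tuple
  (f,g,h,e), i.e. with a map C^4 -> C^4; as a real vector field on C^4 = R^8 its
  value at p is exactly the vector (f p, g p, h p, e p).\<close>

type_synonym c4 = "complex \<times> complex \<times> complex \<times> complex"
type_synonym c3r = "complex \<times> complex \<times> complex \<times> real"
type_synonym mi7 = "nat \<times> nat \<times> nat \<times> nat \<times> nat \<times> nat \<times> nat"
type_synonym vf = "c4 \<Rightarrow> c4"

definition cmul4 :: "complex \<Rightarrow> c4 \<Rightarrow> c4" where
  "cmul4 c = (\<lambda>(a, b, d, e). (c * a, c * b, c * d, c * e))"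

definition holo4_on :: "c4 set \<Rightarrow> vf \<Rightarrow> bool" where
  "holo4_on S X \<longleftrightarrow>
     (\<forall>p\<in>S. \<exists>D. (X has_derivative D) (at p) \<and> (\<forall>c v. D (cmul4 c v) = cmul4 c (D v)))"

definition hyp_rho :: "(c3r \<Rightarrow> real) \<Rightarrow> c4 \<Rightarrow> real" where
  "hyp_rho F = (\<lambda>(z1, z2, \<zeta>, w). Im w - F (z1, z2, \<zeta>, Re w))"

definition aut_hyp :: "(c3r \<Rightarrow> real) \<Rightarrow> vf set" where
  "aut_hyp F = {X. \<exists>r>0. holo4_on (ball 0 r) X \<and>
      (\<forall>p\<in>ball 0 r. hyp_rho F p = 0 \<longrightarrow>
         (\<forall>D. (hyp_rho F has_derivative D) (at p) \<longrightarrow> D (X p) = 0))}"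

definition aut0_hyp :: "(c3r \<Rightarrow> real) \<Rightarrow> vf set" where
  "aut0_hyp F = {X \<in> aut_hyp F. X 0 = 0}"

definition Qmodel :: "c3r \<Rightarrow> real" where
  "Qmodel = (\<lambda>(z1, z2, \<zeta>, u). 2 * Re (z1 * cnj \<zeta> + z2 * cnj \<zeta> ^ 2))"

definition germ_eq :: "vf \<Rightarrow> vf \<Rightarrow> bool" where
  "germ_eq X Y \<longleftrightarrow> (\<exists>r>0. \<forall>p\<in>ball 0 r. X p = Y p)"

definition lincomb :: "real list \<Rightarrow> vf list \<Rightarrow> vf" where
  "lincomb cs Xs = (\<lambda>p. \<Sum>i<length Xs. (cs ! i) *\<^sub>R (Xs ! i) p)"

definition germ_indep :: "vf list \<Rightarrow> bool" where
  "germ_indep Xs \<longleftrightarrow> (\<forall>cs. length cs = length Xs \<longrightarrow>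
      germ_eq (lincomb cs Xs) (\<lambda>_. 0) \<longrightarrow> (\<forall>i<length cs. cs ! i = 0))"

definition germ_dim_le :: "vf set \<Rightarrow> nat \<Rightarrow> bool" where
  "germ_dim_le S n \<longleftrightarrow> (\<forall>Xs. set Xs \<subseteq> S \<longrightarrow> germ_indep Xs \<longrightarrow> length Xs \<le> n)"

definition germ_dim :: "vf set \<Rightarrow> nat \<Rightarrow> bool" where
  "germ_dim S n \<longleftrightarrow> germ_dim_le S n \<and> (\<exists>Xs. set Xs \<subseteq> S \<and> germ_indep Xs \<and> length Xs = n)"

definition germ_direct_sum :: "vf set \<Rightarrow> vf set list \<Rightarrow> bool" where
  "germ_direct_sum S gs \<longleftrightarrow>
     (\<forall>X. X \<in> S \<longleftrightarrow> (\<exists>Ys. length Ys = length gs \<and> (\<forall>i<length gs. Ys ! i \<in> gs ! i) \<and>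
                          germ_eq X (\<lambda>p. \<Sum>i<length Ys. (Ys ! i) p))) \<and>
     (\<forall>Ys. length Ys = length gs \<longrightarrow> (\<forall>i<length gs. Ys ! i \<in> gs ! i) \<longrightarrow>
          germ_eq (\<lambda>p. \<Sum>i<length Ys. (Ys ! i) p) (\<lambda>_. 0) \<longrightarrow>
          (\<forall>i<length Ys. germ_eq (Ys ! i) (\<lambda>_. 0)))"

definition g_m3 :: "vf set" where
  "g_m3 = {(\<lambda>(z1, z2, \<zeta>, w). (0, 0, 0, complex_of_real d)) | d. True}"

definition g_m2 :: "vf set" where
  "g_m2 = {(\<lambda>(z1, z2, \<zeta>, w). (a, 0, 0, 2 * \<i> * cnj a * \<zeta>)) | a. True}"

definition g_m1 :: "vf set" where
  "g_m1 = {(\<lambda>(z1, z2, \<zeta>, w). (- 2 * cnj c * z2 + \<i> * complex_of_real k * \<zeta>, b, c,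
              2 * \<i> * cnj c * z1 + 2 * \<i> * cnj b * \<zeta> ^ 2)) | b c k. True}"

definition g_m1'' :: "vf set" where
  "g_m1'' = {(\<lambda>(z1, z2, \<zeta>, w). (\<i> * complex_of_real k * \<zeta>, 0, 0, 0)) | k. True}"

definition g_0 :: "vf set" where
  "g_0 = {(\<lambda>(z1, z2, \<zeta>, w). (M * z1 + m * \<zeta> ^ 2,
              (2 * M - 3 * complex_of_real l) * z2 - cnj m * \<zeta>,
              (3 * complex_of_real l - cnj M) * \<zeta>,
              3 * complex_of_real l * w)) | M m l. True}"

definition g_1 :: "vf set" where
  "g_1 = {(\<lambda>(z1, z2, \<zeta>, w). (2 * \<i> * cnj N * z1 * \<zeta> + N * w,
              2 * \<i> * cnj N * z2 * \<zeta> - \<i> * N * z1 + \<i> * complex_of_real n * \<zeta> ^ 2,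
              \<i> * cnj N * \<zeta> ^ 2,
              2 * \<i> * cnj N * \<zeta> * w)) | N n. True}"

definition mon7 :: "mi7 \<Rightarrow> c3r \<Rightarrow> real" where
  "mon7 = (\<lambda>(a0, a1, a2, a3, a4, a5, a6) (z1, z2, \<zeta>, u).
     Re z1 ^ a0 * Im z1 ^ a1 * Re z2 ^ a2 * Im z2 ^ a3 * Re \<zeta> ^ a4 * Im \<zeta> ^ a5 * u ^ a6)"

definition weight7 :: "mi7 \<Rightarrow> nat" where
  "weight7 = (\<lambda>(a0, a1, a2, a3, a4, a5, a6). 2 * (a0 + a1) + a2 + a3 + a4 + a5 + 3 * a6)"

text \<open>F - Qmodel is, near 0, the sum of a convergent real power series all of whose
  monomials have weight at least 4.  (In particular F is real-analytic near 0.)\<close>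
definition Gamma0_form :: "(c3r \<Rightarrow> real) \<Rightarrow> bool" where
  "Gamma0_form F \<longleftrightarrow> (\<exists>r>0. \<exists>c :: mi7 \<Rightarrow> real. (\<forall>\<alpha>. weight7 \<alpha> < 4 \<longrightarrow> c \<alpha> = 0) \<and>
      (\<forall>q\<in>ball 0 r. ((\<lambda>\<alpha>. c \<alpha> * mon7 \<alpha> q) has_sum (F q - Qmodel q)) UNIV))"

end

theory Submission
  imports Defs "HOL-Complex_Analysis.Complex_Analysis"
begin

text \<open>
  Let \<open>X\<close> be tangent to \<open>v = 2Re(z1 cnj \<zeta> + z2 cnj \<zeta>^2) + O(4)\<close>. Under the dilations
  \<open>(z1, z2, \<zeta>, w) \<mapsto> (t^2 z1, t z2, t \<zeta>, t^3 w)\<close>, \<open>t \<rightarrow> 0\<close>, the hypersurface tends to \<open>Q\<close> and the rescaled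
  field to its lowest nonzero weighted component, a polynomial field tangent to \<open>Q\<close>. A polynomial field
  tangent to \<open>Q\<close> is determined by sixteen real Taylor coefficients: complexifying the tangency
  equation, one may treat \<open>cnj z1, cnj z2, cnj \<zeta>\<close> as independent variables, and evaluating and
  differentiating at \<open>0\<close> in them leaves functional equations in \<open>w\<close> alone that are solved by hand.
  Each of these coefficients lives in a single weight. Hence, if all sixteen vanish for \<open>X\<close>, every weighted
  component of \<open>X\<close> vanishes in turn, so \<open>X = 0\<close>. The real-linear map sending \<open>X\<close> to its sixteen
  coefficients is therefore injective, which bounds the dimensions; for fields vanishing at \<open>0\<close>
  seven of the coefficients are zero. For \<open>Q\<close> itself all values of the coefficients are attained
  by the listed fields.
\<close>

section \<open>The polarized tangency equations\<close>

text \<open>Polarization is applied to weighted parts only, never to \<open>X\<close> itself: they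
  are polynomials, so a tangency known near 0 on \<open>Q\<close> continues to all complex
  arguments, and the functional equations may be tested at any convenient numbers. A part of weight
  \<open>K - 3\<close> has components of weights \<open>K - 1\<close>, \<open>K - 2\<close>,
  \<open>K - 2\<close>, \<open>K\<close>, because the partial derivatives in z1, z2, \<zeta>, w have
  weights -2, -1, -1, -3; the shift by 3 makes the numbering start at 0. Two analytic obstacles
  shape the rest. Holomorphy means complex linear derivatives on \<open>c4\<close>, so convergent
  series in four variables have to be built from one-variable theory, with a remainder constant
  independent of \<open>K\<close>; this uniformity turns vanishing of all parts into vanishing of
  \<open>X\<close>. And \<open>aut_hyp\<close> constrains \<open>X\<close> only at points where
  \<open>hyp_rho F\<close> has a derivative, while \<open>Gamma0_form\<close> supplies just a
  pointwise sum: differentiability, and smallness of the dilated derivative, are extracted from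
  absolute convergence by Lipschitz estimates of the monomials.\<close>

lemma quartic_zero_coeffs:
  fixes c0 c1 c2 c3 c4 :: complex
  assumes "\<And>x. c0 + c1 * x + c2 * x^2 + c3 * x^3 + c4 * x^4 = 0"
  shows "c0 = 0 \<and> c1 = 0 \<and> c2 = 0 \<and> c3 = 0 \<and> c4 = 0"
proof -
  have "poly [:c0, c1, c2, c3, c4:] x = 0" for x
    using assms[of x] by (simp add: algebra_simps power2_eq_square power3_eq_cube power4_eq_xxxx)
  then have "[:c0, c1, c2, c3, c4:] = 0"
    using poly_all_0_iff_0 by blast
  then show ?thesis by simp
qed


text \<open>Serves for moving the conjugate variables along \<open>t\<close> times a fixed direction
  \<open>(a, b, c)\<close>. The function \<open>l\<close>, standing for \<open>g\<close>, carries
  \<open>(c * t)^2\<close> and so drops out at first order.\<close>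

lemma DERIV_polarized_rhs:
  fixes k l m F G H :: "complex \<Rightarrow> complex"
  assumes "(k has_field_derivative k') (at 0)" "(l has_field_derivative l') (at 0)"
    "(m has_field_derivative m') (at 0)" "(F has_field_derivative F') (at 0)"
    "(G has_field_derivative G') (at 0)" "(H has_field_derivative H') (at 0)"
  shows "((\<lambda>t. 2 * \<i> * (c * t * k t + (c * t)^2 * l t + (a * t + 2 * (b * t) * z) * m t
      + z * F t + z^2 * G t + (z1 + 2 * z2 * (c * t)) * H t)) has_field_derivative
    2 * \<i> * (c * k 0 + (a + 2 * b * z) * m 0 + z * F' + z^2 * G' + z1 * H' + 2 * z2 * c * H 0)) (at 0)"
  by (rule derivative_eq_intros assms | simp)+

lemma DERIV_polarized_lhs:
  fixes k :: "complex \<Rightarrow> complex"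
  assumes "(k has_field_derivative k') (at 0)"
  shows "((\<lambda>t. k t - (A - 2 * \<i> * (c * t * c0 + (c * t)^2 * c1 + a * t * h0))) has_field_derivative
    k' + 2 * \<i> * (c * c0 + a * h0)) (at 0)"
  by (rule derivative_eq_intros assms | simp)+

text \<open>The functions \<open>F, G, H, E\<close> are the conjugates of \<open>f, g, h, e\<close>, and \<open>a, b, c, s\<close> are
  the complexified conjugates of \<open>z1, z2, \<zeta>, w\<close>, now independent of them; the equation
  of \<open>Q\<close> becomes \<open>w = s + 2\<i>v\<close>.\<close>

locale polarized_tangency =
  fixes f g h e F G H E :: "complex \<Rightarrow> complex \<Rightarrow> complex \<Rightarrow> complex \<Rightarrow> complex"
  assumes tangent: "\<And>z1 z2 \<zeta> a b c s w. w = s + 2 * \<i> * (z1 * c + a * \<zeta> + z2 * c^2 + b * \<zeta>^2) \<Longrightarrow>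
      e z1 z2 \<zeta> w - E a b c s =
      2 * \<i> * (c * f z1 z2 \<zeta> w + c^2 * g z1 z2 \<zeta> w + (a + 2 * b * \<zeta>) * h z1 z2 \<zeta> w
        + \<zeta> * F a b c s + \<zeta>^2 * G a b c s + (z1 + 2 * z2 * c) * H a b c s)"
    and conj: "\<And>z1 z2 \<zeta> w. F z1 z2 \<zeta> w = cnj (f (cnj z1) (cnj z2) (cnj \<zeta>) (cnj w))"
      "\<And>z1 z2 \<zeta> w. G z1 z2 \<zeta> w = cnj (g (cnj z1) (cnj z2) (cnj \<zeta>) (cnj w))"
      "\<And>z1 z2 \<zeta> w. H z1 z2 \<zeta> w = cnj (h (cnj z1) (cnj z2) (cnj \<zeta>) (cnj w))"
      "\<And>z1 z2 \<zeta> w. E z1 z2 \<zeta> w = cnj (e (cnj z1) (cnj z2) (cnj \<zeta>) (cnj w))"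
    and diff_w: "\<And>z1 z2 \<zeta> w. f z1 z2 \<zeta> field_differentiable at w"
      "\<And>z1 z2 \<zeta> w. g z1 z2 \<zeta> field_differentiable at w"
      "\<And>z1 z2 \<zeta> w. h z1 z2 \<zeta> field_differentiable at w"
      "\<And>z1 z2 \<zeta> w. e z1 z2 \<zeta> field_differentiable at w"
      "\<And>z1 z2 \<zeta> w. F z1 z2 \<zeta> field_differentiable at w"
      "\<And>z1 z2 \<zeta> w. G z1 z2 \<zeta> field_differentiable at w"
      "\<And>z1 z2 \<zeta> w. H z1 z2 \<zeta> field_differentiable at w"
      "\<And>z1 z2 \<zeta> w. E z1 z2 \<zeta> field_differentiable at w"
    and diff_z1: "\<And>s. (\<lambda>a. F a 0 0 s) field_differentiable at 0"
      "\<And>s. (\<lambda>a. G a 0 0 s) field_differentiable at 0"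
      "\<And>s. (\<lambda>a. H a 0 0 s) field_differentiable at 0"
    and diff_z2: "\<And>s. (\<lambda>b. F 0 b 0 s) field_differentiable at 0"
      "\<And>s. (\<lambda>b. G 0 b 0 s) field_differentiable at 0"
      "\<And>s. (\<lambda>b. H 0 b 0 s) field_differentiable at 0"
    and diff_\<zeta>: "\<And>s. (\<lambda>c. F 0 0 c s) field_differentiable at 0"
      "\<And>s. (\<lambda>c. G 0 0 c s) field_differentiable at 0"
      "\<And>s. (\<lambda>c. H 0 0 c s) field_differentiable at 0"
begin

section \<open>Zeroth and first order in the conjugate variables\<close>

definition "A = E 0 0 0"
definition "\<phi> = F 0 0 0"
definition "\<gamma> = G 0 0 0"
definition "\<eta> = H 0 0 0"

text \<open>Taking \<open>a = b = c = 0\<close> gives \<open>w = s\<close> and leaves only the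
  values of \<open>F\<close>, \<open>G\<close>, \<open>H\<close>, \<open>E\<close> at the origin:
  \<open>e\<close> is known up to four functions of one variable and is free of
  \<open>z2\<close>.\<close>

lemma e_eq: "e z1 z2 \<zeta> s = A s + 2 * \<i> * (\<zeta> * \<phi> s + \<zeta>^2 * \<gamma> s + z1 * \<eta> s)"
  using tangent[of s s z1 0 0 \<zeta> z2 0] unfolding A_def \<phi>_def \<gamma>_def \<eta>_def
  by (simp add: algebra_simps)

lemma E_eq: "E a b c s = A s - 2 * \<i> * (c * f 0 0 0 s + c^2 * g 0 0 0 s + a * h 0 0 0 s)"
  using tangent[of s s 0 c a 0 0 b] e_eq[of 0 0 0 s] by (simp add: algebra_simps)

lemma A_real: "A s = cnj (A (cnj s))"
  using conj(4)[of 0 0 0 s] e_eq[of 0 0 0 "cnj s"] by (simp add: A_def)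

lemma DERIV_1:
  "(A has_field_derivative deriv A s) (at s)"
  "(\<phi> has_field_derivative deriv \<phi> s) (at s)"
  "(\<gamma> has_field_derivative deriv \<gamma> s) (at s)"
  "(\<eta> has_field_derivative deriv \<eta> s) (at s)"
  unfolding A_def \<phi>_def \<gamma>_def \<eta>_def using diff_w
  by (auto intro!: DERIV_deriv_iff_field_differentiable[THEN iffD2])

definition "e_w z1 \<zeta> s = deriv A s + 2 * \<i> * (\<zeta> * deriv \<phi> s + \<zeta>^2 * deriv \<gamma> s + z1 * deriv \<eta> s)"

lemma DERIV_e: "(e z1 z2 \<zeta> has_field_derivative e_w z1 \<zeta> s) (at s)"
proof -
  have "((\<lambda>s. A s + 2 * \<i> * (\<zeta> * \<phi> s + \<zeta>^2 * \<gamma> s + z1 * \<eta> s)) has_field_derivative e_w z1 \<zeta> s) (at s)"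
    unfolding e_w_def by (rule derivative_eq_intros DERIV_1 | simp)+
  then show ?thesis using e_eq by presburger
qed


text \<open>Derivative at \<open>t = 0\<close> of the polarized equation along the direction
  \<open>(a, b, c)\<close>, with \<open>s\<close> fixed and \<open>w\<close> moving. On the right
  each of \<open>f\<close>, \<open>g\<close>, \<open>h\<close> carries a factor \<open>t\<close>, so
  their own w-derivatives never enter, and \<open>g\<close> disappears altogether. The three
  coordinate directions yield a formula for \<open>h\<close>, a compatibility condition, and a
  formula for \<open>f\<close>.\<close>

lemma first_order:
  assumes FGH: "(\<lambda>t. F (a * t) (b * t) (c * t) s) field_differentiable at 0"
    "(\<lambda>t. G (a * t) (b * t) (c * t) s) field_differentiable at 0"
    "(\<lambda>t. H (a * t) (b * t) (c * t) s) field_differentiable at 0"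
  shows "(z1 * c + a * \<zeta> + b * \<zeta>^2) * e_w z1 \<zeta> s + c * f 0 0 0 s + a * h 0 0 0 s =
    c * f z1 z2 \<zeta> s + (a + 2 * b * \<zeta>) * h z1 z2 \<zeta> s
    + \<zeta> * deriv (\<lambda>t. F (a * t) (b * t) (c * t) s) 0
    + \<zeta>^2 * deriv (\<lambda>t. G (a * t) (b * t) (c * t) s) 0
    + z1 * deriv (\<lambda>t. H (a * t) (b * t) (c * t) s) 0 + 2 * z2 * c * \<eta> s"
proof -
  define w where "w = (\<lambda>t. s + 2 * \<i> * (z1 * (c * t) + a * t * \<zeta> + z2 * (c * t)^2 + b * t * \<zeta>^2))"
  have w0: "w 0 = s" by (simp add: w_def)
  have w': "(w has_field_derivative 2 * \<i> * (z1 * c + a * \<zeta> + b * \<zeta>^2)) (at 0)"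
    unfolding w_def by (rule derivative_eq_intros | simp)+
  have chain: "((\<lambda>t. k (w t)) has_field_derivative deriv k s * (2 * \<i> * (z1 * c + a * \<zeta> + b * \<zeta>^2))) (at 0)"
    if "k field_differentiable at s" for k
    by (rule DERIV_chain2[OF _ w']) (use that in \<open>simp add: w0 DERIV_deriv_iff_field_differentiable\<close>)
  have e_w: "deriv (e z1 z2 \<zeta>) s = e_w z1 \<zeta> s"
    by (rule DERIV_imp_deriv[OF DERIV_e])
  note L = DERIV_polarized_lhs[OF chain[OF diff_w(4)], of z1 z2 \<zeta> "A s" c "f 0 0 0 s" "g 0 0 0 s" a "h 0 0 0 s"]
  note R = DERIV_polarized_rhs[OF chain[OF diff_w(1)] chain[OF diff_w(2)] chain[OF diff_w(3)]
      FGH[folded DERIV_deriv_iff_field_differentiable],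
      of c z1 z2 \<zeta> z1 z2 \<zeta> a b \<zeta> z1 z2 \<zeta> z1 z2]
  have eq: "(\<lambda>t. e z1 z2 \<zeta> (w t) - (A s - 2 * \<i> * (c * t * f 0 0 0 s + (c * t)^2 * g 0 0 0 s + a * t * h 0 0 0 s))) =
     (\<lambda>t. 2 * \<i> * (c * t * f z1 z2 \<zeta> (w t) + (c * t)^2 * g z1 z2 \<zeta> (w t) + (a * t + 2 * (b * t) * \<zeta>) * h z1 z2 \<zeta> (w t)
      + \<zeta> * F (a * t) (b * t) (c * t) s + \<zeta>^2 * G (a * t) (b * t) (c * t) s + (z1 + 2 * z2 * (c * t)) * H (a * t) (b * t) (c * t) s))" (is "?l = ?r")
  proof
    fix t
    have "w t = s + 2 * \<i> * (z1 * (c * t) + a * t * \<zeta> + z2 * (c * t)^2 + b * t * \<zeta>^2)"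
      by (simp add: w_def)
    from tangent[OF this] show "?l t = ?r t" by (simp only: E_eq)
  qed
  from DERIV_unique[OF L[unfolded eq] R]
  have "2 * \<i> * ((z1 * c + a * \<zeta> + b * \<zeta>^2) * e_w z1 \<zeta> s + c * f 0 0 0 s + a * h 0 0 0 s) =
    2 * \<i> * (c * f z1 z2 \<zeta> s + (a + 2 * b * \<zeta>) * h z1 z2 \<zeta> s
    + \<zeta> * deriv (\<lambda>t. F (a * t) (b * t) (c * t) s) 0
    + \<zeta>^2 * deriv (\<lambda>t. G (a * t) (b * t) (c * t) s) 0
    + z1 * deriv (\<lambda>t. H (a * t) (b * t) (c * t) s) 0 + 2 * z2 * c * \<eta> s)"
    unfolding e_w w0 \<eta>_def mult_zero_right by algebra
  then show ?thesis by (subst (asm) mult_cancel_left) auto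
qed

lemma h_eq_1: "h z1 z2 \<zeta> s = \<zeta> * e_w z1 \<zeta> s + h 0 0 0 s - \<zeta> * deriv (\<lambda>a. F a 0 0 s) 0
     - \<zeta>^2 * deriv (\<lambda>a. G a 0 0 s) 0 - z1 * deriv (\<lambda>a. H a 0 0 s) 0"
  using first_order[of 1 0 0 s z1 \<zeta> z2] diff_z1 by (simp add: algebra_simps)

lemma b_deriv: "\<zeta>^2 * e_w z1 \<zeta> s = 2 * \<zeta> * h z1 z2 \<zeta> s + \<zeta> * deriv (\<lambda>b. F 0 b 0 s) 0
     + \<zeta>^2 * deriv (\<lambda>b. G 0 b 0 s) 0 + z1 * deriv (\<lambda>b. H 0 b 0 s) 0"
  using first_order[of 0 1 0 s z1 \<zeta> z2] diff_z2 by simp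

lemma f_eq_1: "f z1 z2 \<zeta> s = z1 * e_w z1 \<zeta> s + f 0 0 0 s - \<zeta> * deriv (\<lambda>c. F 0 0 c s) 0
     - \<zeta>^2 * deriv (\<lambda>c. G 0 0 c s) 0 - z1 * deriv (\<lambda>c. H 0 0 c s) 0 - 2 * z2 * \<eta> s"
  using first_order[of 0 0 1 s z1 \<zeta> z2] diff_\<zeta> by (simp add: algebra_simps)

text \<open>Inserting \<open>h_eq_1\<close> into the compatibility condition \<open>b_deriv\<close>
  gives a quartic in \<zeta> whose coefficients are affine in \<open>z1\<close>; the instances
  \<open>z1 = 0\<close> and \<open>z1 = 1\<close> separate these.\<close>

lemma b_deriv_coeffs:
  "deriv \<gamma> s = 0" "deriv \<eta> s = 0" "deriv (\<lambda>a. H a 0 0 s) 0 = 0"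
  "deriv (\<lambda>a. G a 0 0 s) 0 = \<i> * deriv \<phi> s"
proof -
  define F1 G1 H1 F2 G2 H2 where d: "F1 = deriv (\<lambda>a. F a 0 0 s) 0" "G1 = deriv (\<lambda>a. G a 0 0 s) 0"
    "H1 = deriv (\<lambda>a. H a 0 0 s) 0" "F2 = deriv (\<lambda>b. F 0 b 0 s) 0" "G2 = deriv (\<lambda>b. G 0 b 0 s) 0"
    "H2 = deriv (\<lambda>b. H 0 b 0 s) 0"
  have *: "z1 * H2 + (2 * h 0 0 0 s + F2 - 2 * z1 * H1) * \<zeta> + (deriv A s - 2 * F1 + G2 + 2 * \<i> * z1 * deriv \<eta> s) * \<zeta>^2
      + (2 * \<i> * deriv \<phi> s - 2 * G1) * \<zeta>^3 + (2 * \<i> * deriv \<gamma> s) * \<zeta>^4 = 0" for z1 \<zeta>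
    using b_deriv[of \<zeta> z1 s 0] unfolding h_eq_1[of z1 0 \<zeta> s] e_w_def d[symmetric]
    by algebra
  note c = quartic_zero_coeffs[OF *]
  show "deriv \<gamma> s = 0" using c by simp
  show "deriv (\<lambda>a. G a 0 0 s) 0 = \<i> * deriv \<phi> s" using c[of 0] unfolding d by simp
  show "deriv \<eta> s = 0" using c[of 0] c[of 1] by simp
  show "deriv (\<lambda>a. H a 0 0 s) 0 = 0" using c[of 0] c[of 1] unfolding d by simp
qed

text \<open>By \<open>h_eq_2\<close> below, the coefficient of \<zeta> in \<open>h\<close> for a
  normalized field; on \<open>g_0\<close> it would be the constant
  \<open>3 * l - cnj M\<close>.\<close>

definition "B s = deriv A s - deriv (\<lambda>a. F a 0 0 s) 0"

end

text \<open>The conditions say that the sixteen real numbers in \<open>params\<close> vanish,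
  written as values and derivatives at 0; those on \<open>F\<close> are conjugates of conditions on
  \<open>f\<close>. For \<open>e\<close> only real parts are prescribed because
  \<open>A_real\<close> already makes \<open>A\<close> real on the real axis.\<close>

locale polarized_tangency_normalized = polarized_tangency +
  assumes values_0: "f 0 0 0 0 = 0" "g 0 0 0 0 = 0" "h 0 0 0 0 = 0" "Re (e 0 0 0 0) = 0"
    and derivs_0: "Re (deriv (e 0 0 0) 0) = 0" "deriv (F 0 0 0) 0 = 0"
      "deriv (\<lambda>z. F z 0 0 0) 0 = 0" "Im (deriv (\<lambda>\<zeta>. f 0 0 \<zeta> 0) 0) = 0"
      "deriv (\<lambda>\<zeta>. g 0 0 \<zeta> 0) 0 = 0" "Im (deriv (deriv (\<lambda>\<zeta>. g 0 0 \<zeta> 0)) 0) = 0"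
begin

section \<open>The normalized system has only the zero solution\<close>

lemma \<gamma>_0: "\<gamma> s = 0"
proof -
  have "\<gamma> s = \<gamma> 0"
    using has_field_derivative_zero_constant[of UNIV \<gamma>] DERIV_1(3) by (auto simp: b_deriv_coeffs)
  then show ?thesis using values_0 conj(2)[of 0 0 0 0] by (simp add: \<gamma>_def)
qed

lemma \<eta>_0: "\<eta> s = 0"
proof -
  have "\<eta> s = \<eta> 0"
    using has_field_derivative_zero_constant[of UNIV \<eta>] DERIV_1(4) by (auto simp: b_deriv_coeffs)
  then show ?thesis using values_0 conj(3)[of 0 0 0 0] by (simp add: \<eta>_def)
qed

lemma h000: "h 0 0 0 s = 0"
  using conj(3)[of 0 0 0 "cnj s"] \<eta>_0[of "cnj s"] by (simp add: \<eta>_def)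

lemma g000: "g 0 0 0 s = 0"
  using conj(2)[of 0 0 0 "cnj s"] \<gamma>_0[of "cnj s"] by (simp add: \<gamma>_def)

lemma e_eq_2: "e z1 z2 \<zeta> s = A s + 2 * \<i> * \<zeta> * \<phi> s"
  using e_eq[of z1 z2 \<zeta> s] by (simp add: \<gamma>_0 \<eta>_0)

lemma h_eq_2: "h z1 z2 \<zeta> s = \<zeta> * B s + \<i> * \<zeta>^2 * deriv \<phi> s"
  unfolding h_eq_1[of z1 z2 \<zeta> s] b_deriv_coeffs e_w_def h000 B_def by algebra

text \<open>The point is the shape: free of \<open>z2\<close>, of degree one in \<open>z1\<close>,
  with two functions \<open>p\<close>, \<open>m\<close> of \<open>w\<close> alone that are
  determined at the end in \<open>f_g_0\<close>.\<close>

lemma f_eq_2: "\<exists>p m. \<forall>z1 z2 \<zeta> s. f z1 z2 \<zeta> s = cnj (\<phi> (cnj s))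
    + z1 * (deriv A s + 2 * \<i> * \<zeta> * deriv \<phi> s - deriv (\<lambda>c. H 0 0 c s) 0) + \<zeta> * p s + \<zeta>^2 * m s"
proof (intro exI allI)
  fix z1 z2 \<zeta> s
  have f0: "cnj (\<phi> (cnj s)) = f 0 0 0 s"
    using conj(1)[of 0 0 0 "cnj s"] by (simp add: \<phi>_def)
  show "f z1 z2 \<zeta> s = cnj (\<phi> (cnj s))
    + z1 * (deriv A s + 2 * \<i> * \<zeta> * deriv \<phi> s - deriv (\<lambda>c. H 0 0 c s) 0) + \<zeta> * (- deriv (\<lambda>c. F 0 0 c s) 0)
    + \<zeta>^2 * (- deriv (\<lambda>c. G 0 0 c s) 0)"
    unfolding f_eq_1[of z1 z2 \<zeta> s] \<eta>_0 e_w_def b_deriv_coeffs f0 by algebra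
qed

lemma F_0b0: "F 0 b 0 s = \<phi> s"
  using f_eq_2 conj(1)[of 0 b 0 s] by auto

text \<open>The full equation, beyond first order, with \<open>z1 = z2 = a = c = 0\<close> and only
  \<open>b\<close> left. Replacing \<zeta> by \<open>- \<zeta>\<close> keeps \<open>w\<close>, so
  the odd and even parts in \<zeta> hold separately: the odd one involves only \<phi>, the even one
  \<open>A\<close>, \<open>B\<close> and \<open>G\<close>.\<close>

lemma tangent_b: "A (s + 2 * \<i> * b * \<zeta>^2) - A s + 2 * \<i> * \<zeta> * (\<phi> (s + 2 * \<i> * b * \<zeta>^2) - \<phi> s)
   = 2 * \<i> * (2 * b * \<zeta>^2 * (B (s + 2 * \<i> * b * \<zeta>^2) + \<i> * \<zeta> * deriv \<phi> (s + 2 * \<i> * b * \<zeta>^2)) + \<zeta>^2 * G 0 b 0 s)"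
proof -
  define w where "w = s + 2 * \<i> * b * \<zeta>^2"
  have "e 0 0 \<zeta> w - E 0 b 0 s = 2 * \<i> * (2 * b * \<zeta> * h 0 0 \<zeta> w + \<zeta> * F 0 b 0 s + \<zeta>^2 * G 0 b 0 s)"
    by (subst tangent[of w s 0 0 0 \<zeta> 0 b]) (auto simp: w_def)
  moreover have "E 0 b 0 s = A s" by (simp add: E_eq)
  ultimately have "A w + 2 * \<i> * \<zeta> * \<phi> w - A s =
      2 * \<i> * (2 * b * \<zeta> * (\<zeta> * B w + \<i> * \<zeta>^2 * deriv \<phi> w) + \<zeta> * \<phi> s + \<zeta>^2 * G 0 b 0 s)"
    by (simp only: e_eq_2 F_0b0 h_eq_2)
  then show ?thesis unfolding w_def[symmetric] by algebra
qed

lemma tangent_b_odd: "\<phi> (s + y) - \<phi> s = y * deriv \<phi> (s + y)"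
proof -
  define b where "b = y / (2 * \<i>)"
  have b: "2 * \<i> * b = y" and ii: "\<i> * \<i> = - 1" by (simp_all add: b_def)
  have "4 * \<i> * (\<phi> (s + y) - \<phi> s) = 4 * \<i> * (y * deriv \<phi> (s + y))"
    using tangent_b[of s b 1, unfolded b, simplified] tangent_b[of s b "-1", unfolded b, simplified] b ii by algebra
  then show ?thesis by simp
qed

text \<open>The even part of \<open>tangent_b\<close> says that the left side is
  \<open>\<zeta>^2\<close> times a quantity depending only on \<open>b\<close> and \<open>s\<close>,
  namely a value of \<open>G\<close>. Comparison with \<open>\<zeta> = 1\<close> eliminates that
  value.\<close>

lemma tangent_b_even: "A (s + \<zeta>^2 * y) - A s - 2 * (\<zeta>^2 * y) * B (s + \<zeta>^2 * y) = \<zeta>^2 * (A (s + y) - A s - 2 * y * B (s + y))"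
proof -
  define b where "b = y / (2 * \<i>)"
  have b: "2 * \<i> * b = y" and ii: "\<i> * \<i> = - 1" by (simp_all add: b_def)
  have *: "A (s + y * \<zeta>^2) - A s - 2 * (y * \<zeta>^2) * B (s + y * \<zeta>^2) = 2 * \<i> * \<zeta>^2 * G 0 b 0 s" for \<zeta>
    using tangent_b[of s b \<zeta>, unfolded b] tangent_b[of s b "-\<zeta>", unfolded b, simplified] b ii by algebra
  show ?thesis using *[of \<zeta>] *[of 1] by (simp add: algebra_simps)
qed

lemma \<phi>_0: "\<phi> s = 0" "deriv \<phi> s = 0"
proof -
  \<comment> \<open>Exchanging the base points 0 and \<open>s\<close> in
    \<open>tangent_b_odd\<close> compares \<open>deriv \<phi>\<close> at both ends, so \<phi> is
    affine.\<close>
  have "s * deriv \<phi> s = s * deriv \<phi> 0"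
    using tangent_b_odd[of 0 s] tangent_b_odd[of s "-s"] by (simp add: algebra_simps)
  moreover have "deriv \<phi> 0 = 0" using derivs_0 by (simp add: \<phi>_def)
  ultimately show d: "deriv \<phi> s = 0" by (cases "s = 0") auto
  have "\<phi> s = \<phi> 0" using tangent_b_odd[of 0 s] d by simp
  then show "\<phi> s = 0" using values_0 conj(1)[of 0 0 0 0] by (simp add: \<phi>_def)
qed

text \<open>The normalization kills the real parts; the imaginary parts vanish by the reflection
  symmetry \<open>A_real\<close>.\<close>

lemma A_00: "A 0 = 0" "deriv A 0 = 0"
proof -
  have "A = e 0 0 0" using e_eq_2[of 0 0 0] by auto
  have "Im (A 0) = 0" using arg_cong[OF A_real[of 0], of Im] by simp
  then show "A 0 = 0" using values_0 \<open>A = e 0 0 0\<close> by (simp add: complex_eq_iff)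
  have "deriv A 0 = cnj (deriv A 0)"
  proof (rule DERIV_unique)
    show "(A has_field_derivative deriv A 0) (at 0)" by (rule DERIV_1)
    have "((cnj \<circ> A \<circ> cnj) has_field_derivative cnj (deriv A 0)) (at (cnj 0))"
      by (rule has_field_derivative_cnj_cnj) (simp add: DERIV_1)
    moreover have "cnj \<circ> A \<circ> cnj = A" by (rule ext) (simp flip: A_real)
    ultimately show "(A has_field_derivative cnj (deriv A 0)) (at 0)" by simp
  qed
  from arg_cong[OF this, of Im] have "Im (deriv A 0) = 0" by simp
  then show "deriv A 0 = 0" using derivs_0 \<open>A = e 0 0 0\<close> by (simp add: complex_eq_iff)
qed

lemma B_00: "B 0 = 0"
  using A_00 derivs_0 by (simp add: B_def)

lemma A_B_eq: "B s = s * B 1" "A s = 2 * B 1 * s^2"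
proof -
  define D where "D s = A (s + 1) - A s - 2 * B (s + 1)" for s
  \<comment> \<open>Every complex number is a square: with \<open>y = 1\<close> and \<zeta> a square
    root of \<open>s' - s\<close>, the even equation reaches any pair of points.\<close>
  have D: "A s' - A s = (s' - s) * (2 * B s' + D s)" for s s'
    using tangent_b_even[of s "csqrt (s' - s)" 1] by (simp add: D_def algebra_simps)
  have *: "(s' - s) * (2 * B s' + D s) = (s' - s) * (2 * B s + D s')" for s s'
    using D[of s' s] D[of s s'] by algebra
  \<comment> \<open>The left side of \<open>D\<close> is antisymmetric in \<open>s\<close> and
    \<open>s'\<close>, so the bracket is symmetric and \<open>D s - 2 * B s\<close> is
    constant.\<close>
  have sym: "2 * B s' + D s = 2 * B s + D s'" for s s' using *[of s' s] by auto
  define \<kappa> where "\<kappa> = D 0"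
  have Ds: "D s = 2 * B s + \<kappa>" for s using sym[of s 0] B_00 by (simp add: \<kappa>_def)
  have A: "A s = s * (2 * B s + \<kappa>)" for s using D[of s 0] A_00 by (simp add: \<kappa>_def)
  have lin: "s' * B s = s * B s'" for s s'
    using D[of s' s] unfolding A[of s] A[of s'] Ds by algebra
  show B: "B s = s * B 1" for s using lin[of 1 s] by simp
  have A2: "A = (\<lambda>s. s * (2 * (s * B 1) + \<kappa>))" by (rule ext) (simp only: A flip: B)
  have "(A has_field_derivative \<kappa>) (at 0)"
    unfolding A2 by (rule derivative_eq_intros | simp)+
  then have "\<kappa> = 0" using A_00 DERIV_imp_deriv by force
  then show "A s = 2 * B 1 * s^2" using A[of s] B[of s] by (simp add: power2_eq_square algebra_simps)
qed


lemma F_ab0: "F a b 0 0 = 0"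
proof -
  obtain k where k: "\<And>a b. F a b 0 0 = a * k"
    using f_eq_2 conj(1)[of _ _ 0 0] \<phi>_0 by fastforce
  have "((\<lambda>a. F a 0 0 0) has_field_derivative k) (at 0)"
    unfolding k by (rule derivative_eq_intros | simp)+
  then have "k = 0" using derivs_0 DERIV_imp_deriv by fastforce
  then show ?thesis by (simp add: k)
qed

text \<open>The quadratic candidate \<open>A s = 2 * B 1 * s^2\<close> is still alive. At
  \<open>z1 = z2 = c = s = 0\<close> and \<open>a = b = 1\<close> the equation divided by
  \<open>\<zeta>^2\<close> balances a multiple of \<open>(1 + \<zeta>) * B 1\<close> against the
  constant \<open>G 1 1 0 0\<close>; two values of \<zeta> decide.\<close>

lemma B_1: "B 1 = 0"
proof -
  have *: "2 * B 1 * (2 * \<i> * (\<zeta> + \<zeta>^2))^2 =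
      2 * \<i> * ((1 + 2 * \<zeta>) * (\<zeta> * (2 * \<i> * (\<zeta> + \<zeta>^2) * B 1)) + \<zeta>^2 * G 1 1 0 0)" for \<zeta>
  proof -
    define w where "w = 2 * \<i> * (\<zeta> + \<zeta>^2)"
    have "e 0 0 \<zeta> w - E 1 1 0 0 = 2 * \<i> * ((1 + 2 * \<zeta>) * h 0 0 \<zeta> w + \<zeta>^2 * G 1 1 0 0)"
      by (subst tangent[of w 0 0 0 1 \<zeta> 0 1]) (auto simp: w_def F_ab0)
    moreover have "E 1 1 0 0 = 0" by (simp add: E_eq A_00 h000)
    ultimately show ?thesis
      by (simp only: e_eq_2 h_eq_2 \<phi>_0 A_B_eq(2)[of w] A_B_eq(1)[of w] w_def[symmetric]) simp
  qed
  show ?thesis using *[of 1, simplified] *[of 2, simplified] i_squared by algebra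
qed

lemma e_0: "e z1 z2 \<zeta> w = 0" and h_0: "h z1 z2 \<zeta> w = 0"
  using A_B_eq[of w] by (simp_all add: e_eq_2 h_eq_2 \<phi>_0 B_1)

lemma f_eq_3: "\<exists>p m. \<forall>z1 z2 \<zeta> s. f z1 z2 \<zeta> s = \<zeta> * p s + \<zeta>^2 * m s"
proof -
  have "A = (\<lambda>_. 0)" using A_B_eq(2) B_1 by auto
  then have "deriv A s = 0" for s by simp
  moreover have "(\<lambda>c. H 0 0 c s) = (\<lambda>_. 0)" for s using conj(3) h_0 by auto
  ultimately show ?thesis using f_eq_2 by (simp add: \<phi>_0)
qed

text \<open>With \<open>e = h = 0\<close> the equation couples only \<open>f\<close> and
  \<open>g\<close>. It frees \<open>g\<close> from \<open>z1\<close> and \<open>z2\<close> and makes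
  all functions constant in \<open>w\<close>; what survives are the fields with parameters
  \<open>k\<close>, \<open>m\<close>, \<open>n\<close>, which the normalization excludes.\<close>

lemma f_g_0: "f z1 z2 \<zeta> w = 0 \<and> g z1 z2 \<zeta> w = 0"
proof -
  obtain p m where f: "\<And>z1 z2 \<zeta> s. f z1 z2 \<zeta> s = \<zeta> * p s + \<zeta>^2 * m s" using f_eq_3 by blast
  have F: "F a b c s = c * cnj (p (cnj s)) + c^2 * cnj (m (cnj s))" for a b c s
    using conj(1)[of a b c s] f by simp
  have R: "c * (\<zeta> * p w + \<zeta>^2 * m w) + c^2 * g z1 z2 \<zeta> w
      + \<zeta> * (c * cnj (p (cnj s)) + c^2 * cnj (m (cnj s))) + \<zeta>^2 * G a b c s = 0"
    if "w = s + 2 * \<i> * (z1 * c + a * \<zeta> + z2 * c^2 + b * \<zeta>^2)" for z1 z2 \<zeta> a b c s w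
  proof -
    have "E a b c s = 0" using conj(4) e_0 by simp
    moreover have "H a b c s = 0" using conj(3) h_0 by simp
    ultimately show ?thesis using tangent[OF that] by (simp add: e_0 h_0 f F)
  qed
  have step: "g z1 z2 \<zeta> w = g y1 y2 \<zeta> w" if ne: "z1 \<noteq> y1" "z2 \<noteq> y2" for z1 z2 y1 y2 \<zeta> w
  proof -
    \<comment> \<open>The nonzero root of \<open>z1 * c + z2 * c^2 = y1 * c + y2 * c^2\<close>: both
      points then share \<open>w\<close> and \<open>s\<close>, and all terms other than
      \<open>g\<close> agree.\<close>
    define c where "c = - (z1 - y1) / (z2 - y2)"
    have "c \<noteq> 0" using ne by (simp add: c_def)
    have "c * (z2 - y2) = - (z1 - y1)" using ne by (simp add: c_def)
    then have "z1 * c + z2 * c^2 = y1 * c + y2 * c^2" by algebra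
    then have "w = (w - 2 * \<i> * (z1 * c + z2 * c^2)) + 2 * \<i> * (z1 * c + 0 * \<zeta> + z2 * c^2 + 0 * \<zeta>^2)"
      "w = (w - 2 * \<i> * (z1 * c + z2 * c^2)) + 2 * \<i> * (y1 * c + 0 * \<zeta> + y2 * c^2 + 0 * \<zeta>^2)"
      by simp_all
    from R[OF this(1)] R[OF this(2)] have "c^2 * g z1 z2 \<zeta> w = c^2 * g y1 y2 \<zeta> w"
      by algebra
    then show ?thesis using \<open>c \<noteq> 0\<close> by simp
  qed
  define g0 where "g0 = g 0 0"
  have avoid: "\<exists>u. u \<noteq> 0 \<and> u \<noteq> (z::complex)" for z
    by (rule exI[of _ "if z = 1 then 2 else 1"]) auto
  have g: "g z1 z2 \<zeta> w = g0 \<zeta> w" for z1 z2 \<zeta> w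
  proof -
    \<comment> \<open>\<open>step\<close> requires both coordinates to differ, so
      \<open>(z1, z2)\<close> and \<open>(0, 0)\<close> are joined through an intermediate
      point.\<close>
    obtain u1 u2 where "u1 \<noteq> 0" "u1 \<noteq> z1" "u2 \<noteq> 0" "u2 \<noteq> z2" using avoid by metis
    then show ?thesis using step[of z1 u1 z2 u2 \<zeta> w] step[of u1 0 u2 0 \<zeta> w] by (auto simp: g0_def)
  qed
  have G: "G a b c s = cnj (g0 (cnj c) (cnj s))" for a b c s using conj(2)[of a b c s] g by simp
  \<comment> \<open>For nonzero \<zeta> the free variable \<open>b\<close> absorbs
    \<open>w - s\<close>, so \<open>w\<close> and \<open>s\<close> become independent.\<close>
  have R2: "c * (\<zeta> * p w + \<zeta>^2 * m w) + c^2 * g0 \<zeta> w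
      + \<zeta> * (c * cnj (p (cnj s)) + c^2 * cnj (m (cnj s))) + \<zeta>^2 * cnj (g0 (cnj c) (cnj s)) = 0"
    if "\<zeta> \<noteq> 0" for \<zeta> c w s
    using R[of w s 0 c 0 \<zeta> 0 "(w - s) / (2 * \<i> * \<zeta>^2)"] that by (simp add: g G)
  have sep: "c * (\<zeta> * (p w - p 0) + \<zeta>^2 * (m w - m 0)) + c^2 * (g0 \<zeta> w - g0 \<zeta> 0) = 0"
    if "\<zeta> \<noteq> 0" for \<zeta> c w
    using R2[OF that, of c w 0] R2[OF that, of c 0 0] by algebra
  have sep1: "\<zeta> * (p w - p 0) + \<zeta>^2 * (m w - m 0) = 0" and sep2: "g0 \<zeta> w = g0 \<zeta> 0"
    if "\<zeta> \<noteq> 0" for \<zeta> w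
    using sep[OF that, of 1 w] sep[OF that, of "-1" w] by simp_all algebra+
  have pm: "p w = p 0" "m w = m 0" for w using sep1[of 1 w] sep1[of "-1" w] by simp_all algebra+
  define P M where "P = p 0" and "M = m 0"
  \<comment> \<open>The coefficients obtained by solving \<open>R2\<close> with
    \<open>c = 1\<close>, \<open>w = s = 0\<close> for \<open>g0 \<zeta> 0\<close>.\<close>
  define \<alpha> q where "\<alpha> = - (P + cnj P + cnj M)" and "q = - (M + cnj (g0 1 0))"
  have g0: "g0 \<zeta> w = \<alpha> * \<zeta> + q * \<zeta>^2" for \<zeta> w
  proof (cases "\<zeta> = 0")
    case True then show ?thesis using g000 by (simp add: g0_def)
  next
    case False
    have "g0 \<zeta> w = g0 \<zeta> 0" using sep2[OF False] .
    also have "\<dots> = \<alpha> * \<zeta> + q * \<zeta>^2"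
      using R2[OF False, of 1 0 0] by (simp add: \<alpha>_def q_def P_def M_def) algebra
    finally show ?thesis .
  qed
  have d1: "((\<lambda>\<zeta>. g 0 0 \<zeta> 0) has_field_derivative (\<alpha> + 2 * q * \<zeta>)) (at \<zeta>)" for \<zeta>
    unfolding g g0 by (rule derivative_eq_intros | simp)+
  then have d1': "deriv (\<lambda>\<zeta>. g 0 0 \<zeta> 0) = (\<lambda>\<zeta>. \<alpha> + 2 * q * \<zeta>)" by (intro ext DERIV_imp_deriv)
  have "((\<lambda>\<zeta>. \<alpha> + 2 * q * \<zeta>) has_field_derivative 2 * q) (at 0)"
    by (rule derivative_eq_intros | simp)+
  then have "Im q = 0" using derivs_0(6) d1' DERIV_imp_deriv by fastforce
  have "\<alpha> = 0" using derivs_0(5) d1' by simp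
  have "((\<lambda>\<zeta>. f 0 0 \<zeta> 0) has_field_derivative P) (at 0)"
    unfolding f P_def by (rule derivative_eq_intros | simp)+
  then have "Im P = 0" using derivs_0(4) DERIV_imp_deriv by fastforce
  have R3: "c * (\<zeta> * P + \<zeta>^2 * M) + c^2 * (q * \<zeta>^2) + \<zeta> * (c * cnj P + c^2 * cnj M) + \<zeta>^2 * cnj q * c^2 = 0"
    if "\<zeta> \<noteq> 0" for \<zeta> c
    using R2[OF that, of c 0 0] by (simp add: g0 \<open>\<alpha> = 0\<close> P_def M_def mult.assoc)
  have "q + cnj q = 0" "P + cnj P = 0" "M = 0"
    using R3[of 1 1] R3[of 1 "-1"] R3[of "-1" 1] R3[of "-1" "-1"] by simp_all algebra+
  then have "q = 0" "P = 0" "M = 0" using \<open>Im q = 0\<close> \<open>Im P = 0\<close> by (auto simp: complex_eq_iff)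
  then show ?thesis using f g g0 pm \<open>\<alpha> = 0\<close> by (simp add: P_def M_def)
qed

end

section \<open>Polynomial parts of fixed weight and polarization\<close>

type_synonym mi4 = "nat \<times> nat \<times> nat \<times> nat"

definition mon4 :: "mi4 \<Rightarrow> c4 \<Rightarrow> complex" where
  "mon4 = (\<lambda>(i, j, k, l) (z1, z2, \<zeta>, w). z1 ^ i * z2 ^ j * \<zeta> ^ k * w ^ l)"

definition weight4 :: "mi4 \<Rightarrow> nat" where
  "weight4 = (\<lambda>(i, j, k, l). 2 * i + j + k + 3 * l)"

text \<open>Here \<open>\<sigma>\<close> is 3 minus the weight of the coordinate: 1 for z1, 2 for z2
  and \<zeta>, 0 for w. Thus one index \<open>K\<close> collects, across the four components, the
  part of the field of weight \<open>K - 3\<close>; for \<open>K < \<sigma>\<close> the sum is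
  empty.\<close>

definition wpart :: "nat \<Rightarrow> (mi4 \<Rightarrow> complex) \<Rightarrow> nat \<Rightarrow> c4 \<Rightarrow> complex" where
  "wpart \<sigma> a K p = (\<Sum>\<alpha> | weight4 \<alpha> + \<sigma> = K. a \<alpha> * mon4 \<alpha> p)"

lemma finite_weight4_le: "finite {\<alpha>. weight4 \<alpha> + \<sigma> \<le> K}"
proof (rule finite_subset)
  show "{\<alpha>. weight4 \<alpha> + \<sigma> \<le> K} \<subseteq> {..K} \<times> {..K} \<times> {..K} \<times> {..K}"
    by (auto simp: weight4_def)
qed auto

lemma finite_weight4_eq: "finite {\<alpha>. weight4 \<alpha> + \<sigma> = K}"
  by (rule finite_subset[OF _ finite_weight4_le[of \<sigma> K]]) auto

lemma mon4_holomorphic [holomorphic_intros]: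
  assumes "c1 holomorphic_on S" "c2 holomorphic_on S" "c3 holomorphic_on S" "c4 holomorphic_on S"
  shows "(\<lambda>t. mon4 \<alpha> (c1 t, c2 t, c3 t, c4 t)) holomorphic_on S"
  using assms by (cases \<alpha>) (auto simp: mon4_def intro!: holomorphic_intros)

lemma wpart_holomorphic [holomorphic_intros]:
  assumes "c1 holomorphic_on S" "c2 holomorphic_on S" "c3 holomorphic_on S" "c4 holomorphic_on S"
  shows "(\<lambda>t. wpart \<sigma> a K (c1 t, c2 t, c3 t, c4 t)) holomorphic_on S"
  unfolding wpart_def using assms by (intro holomorphic_intros)

lemma wpart_cnj:
  "wpart \<sigma> (\<lambda>\<alpha>. cnj (a \<alpha>)) K (z1, z2, \<zeta>, w) = cnj (wpart \<sigma> a K (cnj z1, cnj z2, cnj \<zeta>, cnj w))"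
  unfolding wpart_def by (auto simp: mon4_def split_def intro!: sum.cong)

section \<open>Analytic continuation from \<open>Q\<close> to its complexification\<close>

lemma entire_zero_on_interval:
  fixes f :: "complex \<Rightarrow> complex"
  assumes "f holomorphic_on UNIV" "r > 0" "\<And>x. \<bar>x\<bar> < r \<Longrightarrow> f (complex_of_real x) = 0"
  shows "f z = 0"
proof (rule analytic_continuation[of f UNIV "complex_of_real ` {-r<..<r}" 0 z])
  show "0 islimpt complex_of_real ` {-r<..<r}"
    unfolding islimpt_approachable
  proof safe
    fix e :: real assume "e > 0"
    define x where "x = min r e / 2"
    have "0 < x" "x < r" "x < e" using \<open>r > 0\<close> \<open>e > 0\<close> by (auto simp: x_def)
    then show "\<exists>x'\<in>complex_of_real ` {- r<..<r}. x' \<noteq> 0 \<and> dist x' 0 < e"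
      by (intro bexI[of _ "complex_of_real x"]) (auto simp: dist_norm)
  qed
qed (use assms in \<open>auto simp: abs_less_iff\<close>)

text \<open>One real coordinate at a time is set free by \<open>entire_zero_on_interval\<close>
  while the others stay fixed. Seven is the real dimension of \<open>Q\<close>.\<close>

lemma entire_zero_on_cube:
  fixes \<Phi> :: "complex \<Rightarrow> complex \<Rightarrow> complex \<Rightarrow> complex \<Rightarrow> complex \<Rightarrow> complex \<Rightarrow> complex \<Rightarrow> complex"
  assumes r: "r > 0"
    and hol: "\<And>x2 x3 x4 x5 x6 x7. (\<lambda>x. \<Phi> x x2 x3 x4 x5 x6 x7) holomorphic_on UNIV"
      "\<And>x1 x3 x4 x5 x6 x7. (\<lambda>x. \<Phi> x1 x x3 x4 x5 x6 x7) holomorphic_on UNIV"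
      "\<And>x1 x2 x4 x5 x6 x7. (\<lambda>x. \<Phi> x1 x2 x x4 x5 x6 x7) holomorphic_on UNIV"
      "\<And>x1 x2 x3 x5 x6 x7. (\<lambda>x. \<Phi> x1 x2 x3 x x5 x6 x7) holomorphic_on UNIV"
      "\<And>x1 x2 x3 x4 x6 x7. (\<lambda>x. \<Phi> x1 x2 x3 x4 x x6 x7) holomorphic_on UNIV"
      "\<And>x1 x2 x3 x4 x5 x7. (\<lambda>x. \<Phi> x1 x2 x3 x4 x5 x x7) holomorphic_on UNIV"
      "\<And>x1 x2 x3 x4 x5 x6. (\<lambda>x. \<Phi> x1 x2 x3 x4 x5 x6 x) holomorphic_on UNIV"
    and zero: "\<And>x1 x2 x3 x4 x5 x6 x7. \<lbrakk>\<bar>x1\<bar> < r; \<bar>x2\<bar> < r; \<bar>x3\<bar> < r; \<bar>x4\<bar> < r; \<bar>x5\<bar> < r; \<bar>x6\<bar> < r; \<bar>x7\<bar> < r\<rbrakk>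
      \<Longrightarrow> \<Phi> (of_real x1) (of_real x2) (of_real x3) (of_real x4) (of_real x5) (of_real x6) (of_real x7) = 0"
  shows "\<Phi> x1 x2 x3 x4 x5 x6 x7 = 0"
proof -
  have 1: "\<Phi> x1 (of_real x2) (of_real x3) (of_real x4) (of_real x5) (of_real x6) (of_real x7) = 0"
    if "\<bar>x2\<bar> < r" "\<bar>x3\<bar> < r" "\<bar>x4\<bar> < r" "\<bar>x5\<bar> < r" "\<bar>x6\<bar> < r" "\<bar>x7\<bar> < r" for x1 x2 x3 x4 x5 x6 x7
    by (rule entire_zero_on_interval[OF hol(1) r zero[OF _ that]])
  have 2: "\<Phi> x1 x2 (of_real x3) (of_real x4) (of_real x5) (of_real x6) (of_real x7) = 0"
    if "\<bar>x3\<bar> < r" "\<bar>x4\<bar> < r" "\<bar>x5\<bar> < r" "\<bar>x6\<bar> < r" "\<bar>x7\<bar> < r" for x1 x2 x3 x4 x5 x6 x7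
    by (rule entire_zero_on_interval[OF hol(2) r 1[OF _ that]])
  have 3: "\<Phi> x1 x2 x3 (of_real x4) (of_real x5) (of_real x6) (of_real x7) = 0"
    if "\<bar>x4\<bar> < r" "\<bar>x5\<bar> < r" "\<bar>x6\<bar> < r" "\<bar>x7\<bar> < r" for x1 x2 x3 x4 x5 x6 x7
    by (rule entire_zero_on_interval[OF hol(3) r 2[OF _ that]])
  have 4: "\<Phi> x1 x2 x3 x4 (of_real x5) (of_real x6) (of_real x7) = 0"
    if "\<bar>x5\<bar> < r" "\<bar>x6\<bar> < r" "\<bar>x7\<bar> < r" for x1 x2 x3 x4 x5 x6 x7
    by (rule entire_zero_on_interval[OF hol(4) r 3[OF _ that]])
  have 5: "\<Phi> x1 x2 x3 x4 x5 (of_real x6) (of_real x7) = 0"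
    if "\<bar>x6\<bar> < r" "\<bar>x7\<bar> < r" for x1 x2 x3 x4 x5 x6 x7
    by (rule entire_zero_on_interval[OF hol(5) r 4[OF _ that]])
  have 6: "\<Phi> x1 x2 x3 x4 x5 x6 (of_real x7) = 0" if "\<bar>x7\<bar> < r" for x1 x2 x3 x4 x5 x6 x7
    by (rule entire_zero_on_interval[OF hol(6) r 5[OF _ that]])
  show ?thesis by (rule entire_zero_on_interval[OF hol(7) r 6])
qed

text \<open>The derivative of \<open>Qmodel\<close> contains \<open>h\<close> conjugated; under
  \<open>Re\<close> that term is replaced by its conjugate, which makes the bracket complex linear
  in \<open>f\<close>, \<open>g\<close>, \<open>h\<close>.\<close>

definition Q_tangent_at :: "(c4 \<Rightarrow> complex) \<Rightarrow> (c4 \<Rightarrow> complex) \<Rightarrow> (c4 \<Rightarrow> complex) \<Rightarrow> (c4 \<Rightarrow> complex) \<Rightarrow> c3r \<Rightarrow> bool" where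
  "Q_tangent_at f g h e = (\<lambda>(z1, z2, \<zeta>, u). let p = (z1, z2, \<zeta>, Complex u (Qmodel (z1, z2, \<zeta>, u))) in
     Im (e p) = 2 * Re (f p * cnj \<zeta> + g p * cnj \<zeta> ^ 2 + h p * (cnj z1 + 2 * cnj z2 * \<zeta>)))"

lemma wpart_polarize:
  fixes a1 a2 a3 a4 :: "mi4 \<Rightarrow> complex" and K :: nat
  defines "f \<equiv> \<lambda>z1 z2 \<zeta> w. wpart 1 a1 K (z1, z2, \<zeta>, w)" and "g \<equiv> \<lambda>z1 z2 \<zeta> w. wpart 2 a2 K (z1, z2, \<zeta>, w)"
    and "h \<equiv> \<lambda>z1 z2 \<zeta> w. wpart 2 a3 K (z1, z2, \<zeta>, w)" and "e \<equiv> \<lambda>z1 z2 \<zeta> w. wpart 0 a4 K (z1, z2, \<zeta>, w)"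
    and "F \<equiv> \<lambda>z1 z2 \<zeta> w. wpart 1 (\<lambda>\<alpha>. cnj (a1 \<alpha>)) K (z1, z2, \<zeta>, w)"
    and "G \<equiv> \<lambda>z1 z2 \<zeta> w. wpart 2 (\<lambda>\<alpha>. cnj (a2 \<alpha>)) K (z1, z2, \<zeta>, w)"
    and "H \<equiv> \<lambda>z1 z2 \<zeta> w. wpart 2 (\<lambda>\<alpha>. cnj (a3 \<alpha>)) K (z1, z2, \<zeta>, w)"
    and "E \<equiv> \<lambda>z1 z2 \<zeta> w. wpart 0 (\<lambda>\<alpha>. cnj (a4 \<alpha>)) K (z1, z2, \<zeta>, w)"
  assumes r: "r > 0"
    and tan: "\<And>z1 z2 \<zeta> u. \<lbrakk>norm z1 < r; norm z2 < r; norm \<zeta> < r; \<bar>u\<bar> < r\<rbrakk> \<Longrightarrow>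
       Q_tangent_at (wpart 1 a1 K) (wpart 2 a2 K) (wpart 2 a3 K) (wpart 0 a4 K) (z1, z2, \<zeta>, u)"
  shows "polarized_tangency f g h e F G H E"
proof
  define \<Phi> where "\<Phi> z1 a z2 b \<zeta> c w s = e z1 z2 \<zeta> w - E a b c s -
      2 * \<i> * (c * f z1 z2 \<zeta> w + c^2 * g z1 z2 \<zeta> w + (a + 2 * b * \<zeta>) * h z1 z2 \<zeta> w
        + \<zeta> * F a b c s + \<zeta>^2 * G a b c s + (z1 + 2 * z2 * c) * H a b c s)"
    for z1 a z2 b \<zeta> c w s
  have hol: "(\<lambda>x. \<Phi> (c1 x) (c2 x) (c3 x) (c4 x) (c5 x) (c6 x) (c7 x) (c8 x)) holomorphic_on UNIV"
    if "c1 holomorphic_on UNIV" "c2 holomorphic_on UNIV" "c3 holomorphic_on UNIV" "c4 holomorphic_on UNIV"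
      "c5 holomorphic_on UNIV" "c6 holomorphic_on UNIV" "c7 holomorphic_on UNIV" "c8 holomorphic_on UNIV"
    for c1 c2 c3 c4 c5 c6 c7 c8
    unfolding \<Phi>_def f_def g_def h_def e_def F_def G_def H_def E_def
    using that by (intro holomorphic_intros)
  define v where "v z1 a z2 b \<zeta> c = z1 * c + a * \<zeta> + z2 * c^2 + b * \<zeta>^2" for z1 a z2 b \<zeta> c :: complex
  \<comment> \<open>The complexified \<open>Q\<close> parametrized by its seven real coordinates
    made complex, with \<open>w = u + \<i> * v\<close> and \<open>s = u - \<i> * v\<close>. At small
    real arguments its vanishing is the actual tangency condition.\<close>
  define \<Psi> where "\<Psi> x1 y1 x2 y2 x3 y3 u = 
     \<Phi> (x1 + \<i> * y1) (x1 - \<i> * y1) (x2 + \<i> * y2) (x2 - \<i> * y2) (x3 + \<i> * y3) (x3 - \<i> * y3)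
       (u + \<i> * v (x1 + \<i> * y1) (x1 - \<i> * y1) (x2 + \<i> * y2) (x2 - \<i> * y2) (x3 + \<i> * y3) (x3 - \<i> * y3))
       (u - \<i> * v (x1 + \<i> * y1) (x1 - \<i> * y1) (x2 + \<i> * y2) (x2 - \<i> * y2) (x3 + \<i> * y3) (x3 - \<i> * y3))"
    for x1 y1 x2 y2 x3 y3 u
  have zero: "\<Phi> z1 (cnj z1) z2 (cnj z2) \<zeta> (cnj \<zeta>) (Complex u (Qmodel (z1, z2, \<zeta>, u))) (cnj (Complex u (Qmodel (z1, z2, \<zeta>, u)))) = 0"
    if "norm z1 < r" "norm z2 < r" "norm \<zeta> < r" "\<bar>u\<bar> < r" for z1 z2 \<zeta> u
  proof -
    define w where "w = Complex u (Qmodel (z1, z2, \<zeta>, u))"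
    define q where "q = cnj \<zeta> * f z1 z2 \<zeta> w + cnj \<zeta>^2 * g z1 z2 \<zeta> w + (cnj z1 + 2 * cnj z2 * \<zeta>) * h z1 z2 \<zeta> w"
    have "Im (e z1 z2 \<zeta> w) = 2 * Re q"
      using tan[OF that] unfolding q_def w_def
      by (simp add: Q_tangent_at_def Let_def f_def g_def h_def e_def mult.commute)
    moreover have "e z1 z2 \<zeta> w - cnj (e z1 z2 \<zeta> w) = 2 * \<i> * of_real (Im (e z1 z2 \<zeta> w))"
      by (simp add: complex_eq_iff)
    moreover have "q + cnj q = of_real (2 * Re q)" by (simp add: complex_eq_iff)
    ultimately have "e z1 z2 \<zeta> w - cnj (e z1 z2 \<zeta> w) = 2 * \<i> * (q + cnj q)" by simp
    then show ?thesis unfolding w_def[symmetric] \<Phi>_def F_def G_def H_def E_def wpart_cnj complex_cnj_cnj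
      by (simp add: q_def f_def g_def h_def e_def algebra_simps)
  qed
  have \<Psi>0: "\<Psi> x1 y1 x2 y2 x3 y3 u = 0" for x1 y1 x2 y2 x3 y3 u
  proof (rule entire_zero_on_cube[of "r / 2" \<Psi>])
    show "0 < r / 2" using r by simp
    fix x1 y1 x2 y2 x3 y3 u :: real
    assume b: "\<bar>x1\<bar> < r / 2" "\<bar>y1\<bar> < r / 2" "\<bar>x2\<bar> < r / 2" "\<bar>y2\<bar> < r / 2" "\<bar>x3\<bar> < r / 2" "\<bar>y3\<bar> < r / 2" "\<bar>u\<bar> < r / 2"
    have n: "norm (Complex x y) < r" if "\<bar>x\<bar> < r / 2" "\<bar>y\<bar> < r / 2" for x y
      using cmod_le[of "Complex x y"] that by simp
    have C: "of_real x + \<i> * of_real y = Complex x y" "of_real x - \<i> * of_real y = cnj (Complex x y)" for x y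
      by (simp_all add: complex_eq_iff)
    define z1 z2 z3 where z: "z1 = Complex x1 y1" "z2 = Complex x2 y2" "z3 = Complex x3 y3"
    have "v z1 (cnj z1) z2 (cnj z2) z3 (cnj z3) = of_real (Qmodel (z1, z2, z3, u))"
      unfolding v_def Qmodel_def
      by (simp add: complex_eq_iff power2_eq_square algebra_simps)
    then have "\<Psi> (of_real x1) (of_real y1) (of_real x2) (of_real y2) (of_real x3) (of_real y3) (of_real u)
       = \<Phi> z1 (cnj z1) z2 (cnj z2) z3 (cnj z3) (Complex u (Qmodel (z1, z2, z3, u))) (cnj (Complex u (Qmodel (z1, z2, z3, u))))"
      unfolding \<Psi>_def C z by (simp only: C)
    then show "\<Psi> (of_real x1) (of_real y1) (of_real x2) (of_real y2) (of_real x3) (of_real y3) (of_real u) = 0"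
      using zero n b r by (simp add: z)
  qed (unfold \<Psi>_def v_def, (intro hol holomorphic_intros)+)
  fix z1 z2 \<zeta> a b c s w
  assume w: "w = s + 2 * \<i> * (z1 * c + a * \<zeta> + z2 * c^2 + b * \<zeta>^2)"
  define k where "k = v z1 a z2 b \<zeta> c"
  have h: "(x + y) / 2 + \<i> * ((x - y) / (2 * \<i>)) = x" "(x + y) / 2 - \<i> * ((x - y) / (2 * \<i>)) = y" for x y
    by (simp_all add: field_simps)
  \<comment> \<open>The inverse coordinate change; \<open>s + \<i> * k\<close> is the complexified
    \<open>u\<close>, the mean of \<open>w\<close> and \<open>s\<close>.\<close>
  have "\<Psi> ((z1 + a) / 2) ((z1 - a) / (2 * \<i>)) ((z2 + b) / 2) ((z2 - b) / (2 * \<i>)) ((\<zeta> + c) / 2) ((\<zeta> - c) / (2 * \<i>)) (s + \<i> * k)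
     = \<Phi> z1 a z2 b \<zeta> c (s + \<i> * k + \<i> * k) (s + \<i> * k - \<i> * k)"
    unfolding \<Psi>_def h k_def ..
  moreover have "s + \<i> * k + \<i> * k = w" "s + \<i> * k - \<i> * k = s" by (simp_all add: w k_def v_def algebra_simps)
  ultimately have "\<Phi> z1 a z2 b \<zeta> c w s = 0" using \<Psi>0 by metis
  then show "e z1 z2 \<zeta> w - E a b c s =
      2 * \<i> * (c * f z1 z2 \<zeta> w + c^2 * g z1 z2 \<zeta> w + (a + 2 * b * \<zeta>) * h z1 z2 \<zeta> w
        + \<zeta> * F a b c s + \<zeta>^2 * G a b c s + (z1 + 2 * z2 * c) * H a b c s)"
    by (simp add: \<Phi>_def)
next
  show "\<And>z1 z2 \<zeta> w. F z1 z2 \<zeta> w = cnj (f (cnj z1) (cnj z2) (cnj \<zeta>) (cnj w))"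
      "\<And>z1 z2 \<zeta> w. G z1 z2 \<zeta> w = cnj (g (cnj z1) (cnj z2) (cnj \<zeta>) (cnj w))"
      "\<And>z1 z2 \<zeta> w. H z1 z2 \<zeta> w = cnj (h (cnj z1) (cnj z2) (cnj \<zeta>) (cnj w))"
      "\<And>z1 z2 \<zeta> w. E z1 z2 \<zeta> w = cnj (e (cnj z1) (cnj z2) (cnj \<zeta>) (cnj w))"
    by (simp_all add: wpart_cnj f_def g_def h_def e_def F_def G_def H_def E_def)
qed (unfold f_def g_def h_def e_def F_def G_def H_def E_def,
    (rule holomorphic_on_imp_differentiable_at[of _ UNIV], intro holomorphic_intros, auto)+)

section \<open>Taylor coefficients of a weighted part\<close>

lemma DERIV_mon4_axes:
  "((\<lambda>t. mon4 \<alpha> (t, 0, 0, 0)) has_field_derivative (if \<alpha> = (1, 0, 0, 0) then 1 else 0)) (at 0)"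
  "((\<lambda>t. mon4 \<alpha> (0, 0, t, 0)) has_field_derivative (if \<alpha> = (0, 0, 1, 0) then 1 else 0)) (at 0)"
  "((\<lambda>t. mon4 \<alpha> (0, 0, 0, t)) has_field_derivative (if \<alpha> = (0, 0, 0, 1) then 1 else 0)) (at 0)"
proof -
  have pow: "((\<lambda>t::complex. c * t ^ k) has_field_derivative (if k = 1 then c else 0)) (at 0)" for c k
    by (rule DERIV_cong, (rule derivative_eq_intros | simp)+) (auto simp: power_0_left)
  obtain i j k l where \<alpha>: "\<alpha> = (i, j, k, l)" by (cases \<alpha>)
  show "((\<lambda>t. mon4 \<alpha> (t, 0, 0, 0)) has_field_derivative (if \<alpha> = (1, 0, 0, 0) then 1 else 0)) (at 0)"
    by (rule DERIV_cong[OF pow[of "0 ^ j * 0 ^ k * 0 ^ l" i, THEN DERIV_cong_ev[OF refl _ refl, THEN iffD1, rotated]]])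
      (auto simp: \<alpha> mon4_def power_0_left)
  show "((\<lambda>t. mon4 \<alpha> (0, 0, t, 0)) has_field_derivative (if \<alpha> = (0, 0, 1, 0) then 1 else 0)) (at 0)"
    by (rule DERIV_cong[OF pow[of "0 ^ i * 0 ^ j * 0 ^ l" k, THEN DERIV_cong_ev[OF refl _ refl, THEN iffD1, rotated]]])
      (auto simp: \<alpha> mon4_def power_0_left)
  show "((\<lambda>t. mon4 \<alpha> (0, 0, 0, t)) has_field_derivative (if \<alpha> = (0, 0, 0, 1) then 1 else 0)) (at 0)"
    by (rule DERIV_cong[OF pow[of "0 ^ i * 0 ^ j * 0 ^ k" l, THEN DERIV_cong_ev[OF refl _ refl, THEN iffD1, rotated]]])
      (auto simp: \<alpha> mon4_def power_0_left)
qed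

lemma deriv_wpart_axes:
  "deriv (\<lambda>t. wpart \<sigma> a K (t, 0, 0, 0)) 0 = (if 2 + \<sigma> = K then a (1, 0, 0, 0) else 0)"
  "deriv (\<lambda>t. wpart \<sigma> a K (0, 0, t, 0)) 0 = (if 1 + \<sigma> = K then a (0, 0, 1, 0) else 0)"
  "deriv (\<lambda>t. wpart \<sigma> a K (0, 0, 0, t)) 0 = (if 3 + \<sigma> = K then a (0, 0, 0, 1) else 0)"
proof -
  have S: "(\<Sum>\<alpha> | weight4 \<alpha> + \<sigma> = K. a \<alpha> * (if \<alpha> = \<beta> then 1 else 0)) = (if weight4 \<beta> + \<sigma> = K then a \<beta> else 0)" for \<beta>
    using finite_weight4_eq[of \<sigma> K] by (simp add: if_distrib[of "(*) _"] sum.delta cong: if_cong)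
  have D: "deriv (\<lambda>t. wpart \<sigma> a K (c t)) 0 = (if weight4 \<beta> + \<sigma> = K then a \<beta> else 0)"
    if "\<And>\<alpha>. ((\<lambda>t. mon4 \<alpha> (c t)) has_field_derivative (if \<alpha> = \<beta> then 1 else 0)) (at 0)" for c \<beta>
  proof -
    have "((\<lambda>t. wpart \<sigma> a K (c t)) has_field_derivative
        (\<Sum>\<alpha> | weight4 \<alpha> + \<sigma> = K. a \<alpha> * (if \<alpha> = \<beta> then 1 else 0))) (at 0)"
      unfolding wpart_def by (intro DERIV_sum DERIV_cmult that)
    then show ?thesis unfolding S by (rule DERIV_imp_deriv)
  qed
  show "deriv (\<lambda>t. wpart \<sigma> a K (t, 0, 0, 0)) 0 = (if 2 + \<sigma> = K then a (1, 0, 0, 0) else 0)"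
    by (subst D[OF DERIV_mon4_axes(1)]) (simp add: weight4_def)
  show "deriv (\<lambda>t. wpart \<sigma> a K (0, 0, t, 0)) 0 = (if 1 + \<sigma> = K then a (0, 0, 1, 0) else 0)"
    by (subst D[OF DERIV_mon4_axes(2)]) (simp add: weight4_def)
  show "deriv (\<lambda>t. wpart \<sigma> a K (0, 0, 0, t)) 0 = (if 3 + \<sigma> = K then a (0, 0, 0, 1) else 0)"
    by (subst D[OF DERIV_mon4_axes(3)]) (simp add: weight4_def)
qed

lemma wpart_\<zeta>_axis: "wpart \<sigma> a K (0, 0, t, 0) = (if \<sigma> \<le> K then a (0, 0, K - \<sigma>, 0) * t ^ (K - \<sigma>) else 0)"
proof -
  have "wpart \<sigma> a K (0, 0, t, 0) = (\<Sum>\<alpha> | weight4 \<alpha> + \<sigma> = K. if \<alpha> = (0, 0, K - \<sigma>, 0) then a \<alpha> * t ^ (K - \<sigma>) else 0)"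
    unfolding wpart_def by (rule sum.cong) (auto simp: mon4_def weight4_def power_0_left split: if_splits)
  also have "\<dots> = (if \<sigma> \<le> K then a (0, 0, K - \<sigma>, 0) * t ^ (K - \<sigma>) else 0)"
    using finite_weight4_eq[of \<sigma> K] by (auto simp: sum.delta weight4_def)
  finally show ?thesis .
qed

lemma wpart_origin: "wpart \<sigma> a K (0, 0, 0, 0) = (if \<sigma> = K then a (0, 0, 0, 0) else 0)"
  using wpart_\<zeta>_axis[of \<sigma> a K 0] by (auto simp: power_0_left)

lemma deriv2_wpart_\<zeta>_axis:
  "deriv (deriv (\<lambda>t. wpart \<sigma> a K (0, 0, t, 0))) 0 = (if 2 + \<sigma> = K then 2 * a (0, 0, 2, 0) else 0)"
proof -
  define k c where "k = K - \<sigma>" and "c = (if \<sigma> \<le> K then a (0, 0, K - \<sigma>, 0) else 0)"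
  have "(\<lambda>t. wpart \<sigma> a K (0, 0, t, 0)) = (\<lambda>t. c * t ^ k)"
    by (auto simp: wpart_\<zeta>_axis k_def c_def)
  moreover have "deriv (\<lambda>t. c * t ^ k) = (\<lambda>t. c * (of_nat k * t ^ (k - 1)))"
    by (rule ext, rule DERIV_imp_deriv) (rule derivative_eq_intros | simp)+
  moreover have "deriv (\<lambda>t. c * (of_nat k * t ^ (k - 1))) 0 = c * (of_nat k * (of_nat (k - 1) * 0 ^ (k - 2)))"
    by (rule DERIV_imp_deriv) (rule derivative_eq_intros | simp add: numeral_2_eq_2)+
  moreover have "c * (of_nat k * (of_nat (k - 1) * 0 ^ (k - 2))) = (if 2 + \<sigma> = K then 2 * a (0, 0, 2, 0) else 0)"
    by (auto simp: k_def c_def power_0_left)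
  ultimately show ?thesis by simp
qed

abbreviation "coef1 a \<equiv> \<lambda>\<alpha>. fst (a \<alpha>)"
abbreviation "coef2 a \<equiv> \<lambda>\<alpha>. fst (snd (a \<alpha>))"
abbreviation "coef3 a \<equiv> \<lambda>\<alpha>. fst (snd (snd (a \<alpha>)))"
abbreviation "coef4 a \<equiv> \<lambda>\<alpha>. snd (snd (snd (a \<alpha>)))"

text \<open>Reads off the parameters \<open>k, M, m, l, N, n, a, b, c, d\<close> of the model algebra from the
  Taylor coefficients of a field; the first nine real numbers belong to the stabilizer.\<close>

definition params :: "(mi4 \<Rightarrow> c4) \<Rightarrow> nat \<Rightarrow> real" where
  "params a j =
    [Im (coef1 a (0, 0, 1, 0)), Re (coef1 a (1, 0, 0, 0)), Im (coef1 a (1, 0, 0, 0)),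
     - Re (coef2 a (0, 0, 1, 0)), Im (coef2 a (0, 0, 1, 0)), Re (coef4 a (0, 0, 0, 1)) / 3,
     Re (coef1 a (0, 0, 0, 1)), Im (coef1 a (0, 0, 0, 1)), Im (coef2 a (0, 0, 2, 0)),
     Re (coef1 a (0, 0, 0, 0)), Im (coef1 a (0, 0, 0, 0)), Re (coef2 a (0, 0, 0, 0)), Im (coef2 a (0, 0, 0, 0)),
     Re (coef3 a (0, 0, 0, 0)), Im (coef3 a (0, 0, 0, 0)), Re (coef4 a (0, 0, 0, 0))] ! j"

lemma params_zeroD:
  assumes "\<And>j. j < 16 \<Longrightarrow> params a j = 0"
  shows "Im (coef1 a (0, 0, 1, 0)) = 0" "coef1 a (1, 0, 0, 0) = 0" "coef2 a (0, 0, 1, 0) = 0"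
    "Re (coef4 a (0, 0, 0, 1)) = 0" "coef1 a (0, 0, 0, 1) = 0" "Im (coef2 a (0, 0, 2, 0)) = 0"
    "coef1 a (0, 0, 0, 0) = 0" "coef2 a (0, 0, 0, 0) = 0" "coef3 a (0, 0, 0, 0) = 0"
    "Re (coef4 a (0, 0, 0, 0)) = 0"
  using assms[of 0] assms[of 1] assms[of 2] assms[of 3] assms[of 4] assms[of 5] assms[of 6] assms[of 7]
    assms[of 8] assms[of 9] assms[of 10] assms[of 11] assms[of 12] assms[of 13] assms[of 14] assms[of 15]
  by (simp_all add: params_def complex_eq_iff)

text \<open>Each normalization datum of the part with index \<open>K\<close> is either governed by
  an entry of \<open>params\<close> or absent from that weight. So vanishing of all parameters
  normalizes every part at once, whatever \<open>K\<close> is.\<close>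

lemma wpart_tangent_zero:
  assumes "r > 0"
    and "\<And>z1 z2 \<zeta> u. \<lbrakk>norm z1 < r; norm z2 < r; norm \<zeta> < r; \<bar>u\<bar> < r\<rbrakk> \<Longrightarrow>
       Q_tangent_at (wpart 1 (coef1 a) K) (wpart 2 (coef2 a) K) (wpart 2 (coef3 a) K) (wpart 0 (coef4 a) K) (z1, z2, \<zeta>, u)"
    and "\<And>j. j < 16 \<Longrightarrow> params a j = 0"
  shows "wpart 1 (coef1 a) K p = 0 \<and> wpart 2 (coef2 a) K p = 0 \<and> wpart 2 (coef3 a) K p = 0 \<and> wpart 0 (coef4 a) K p = 0"
proof -
  define f g h e F G H E where
    d: "f = (\<lambda>z1 z2 \<zeta> w. wpart 1 (coef1 a) K (z1, z2, \<zeta>, w))"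
      "g = (\<lambda>z1 z2 \<zeta> w. wpart 2 (coef2 a) K (z1, z2, \<zeta>, w))"
      "h = (\<lambda>z1 z2 \<zeta> w. wpart 2 (coef3 a) K (z1, z2, \<zeta>, w))"
      "e = (\<lambda>z1 z2 \<zeta> w. wpart 0 (coef4 a) K (z1, z2, \<zeta>, w))"
      "F = (\<lambda>z1 z2 \<zeta> w. wpart 1 (\<lambda>\<alpha>. cnj (coef1 a \<alpha>)) K (z1, z2, \<zeta>, w))"
      "G = (\<lambda>z1 z2 \<zeta> w. wpart 2 (\<lambda>\<alpha>. cnj (coef2 a \<alpha>)) K (z1, z2, \<zeta>, w))"
      "H = (\<lambda>z1 z2 \<zeta> w. wpart 2 (\<lambda>\<alpha>. cnj (coef3 a \<alpha>)) K (z1, z2, \<zeta>, w))"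
      "E = (\<lambda>z1 z2 \<zeta> w. wpart 0 (\<lambda>\<alpha>. cnj (coef4 a \<alpha>)) K (z1, z2, \<zeta>, w))"
  interpret polarized_tangency f g h e F G H E
    unfolding d by (rule wpart_polarize[OF assms(1,2)])
  interpret polarized_tangency_normalized f g h e F G H E
    by unfold_locales
      (simp_all add: d wpart_origin deriv_wpart_axes deriv2_wpart_\<zeta>_axis params_zeroD[OF assms(3), simplified])
  show ?thesis using f_g_0 h_0 e_0 unfolding d by (cases p) auto
qed

section \<open>Power series in several variables\<close>

text \<open>The tail is dominated by a geometric series of ratio \<open>norm h / \<delta>\<close>,
  at most 1/2, which costs the factor 2.\<close>

lemma power_series_tail_bound:
  fixes a :: "nat \<Rightarrow> complex"
  assumes "(\<lambda>k. a k * h ^ k) sums s" "\<delta> > 0" "\<And>k. norm (a k) \<le> B / \<delta> ^ k" "norm h \<le> \<delta> / 2"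
  shows "norm (s - (\<Sum>k<n. a k * h ^ k)) \<le> 2 * B * (norm h / \<delta>) ^ n"
proof -
  define q where "q = norm h / \<delta>"
  have q: "0 \<le> q" "q \<le> 1 / 2" using assms(2,4) by (auto simp: q_def field_simps)
  have B: "0 \<le> B" using order_trans[OF norm_ge_zero assms(3)[of 0]] by simp
  have "(\<lambda>k. a (k + n) * h ^ (k + n)) sums (s - (\<Sum>k<n. a k * h ^ k))"
    using assms(1) sums_iff_shift'[of "\<lambda>k. a k * h ^ k" n s] by simp
  moreover have g: "(\<lambda>k. B * q ^ n * q ^ k) sums (B * q ^ n * (1 / (1 - q)))"
    by (intro sums_mult geometric_sums) (use q in auto)
  moreover have "norm (a (k + n) * h ^ (k + n)) \<le> B * q ^ n * q ^ k" for k
  proof -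
    have "norm (a (k + n) * h ^ (k + n)) \<le> (B / \<delta> ^ (k + n)) * norm h ^ (k + n)"
      unfolding norm_mult norm_power by (intro mult_right_mono assms) auto
    also have "\<dots> = B * q ^ n * q ^ k" by (simp add: q_def power_add power_divide mult_ac)
    finally show ?thesis .
  qed
  ultimately have "norm (s - (\<Sum>k<n. a k * h ^ k)) \<le> B * q ^ n * (1 / (1 - q))"
    using norm_suminf_le[of "\<lambda>k. a (k + n) * h ^ (k + n)" "\<lambda>k. B * q ^ n * q ^ k"]
    by (simp add: sums_iff)
  also have "\<dots> \<le> B * q ^ n * 2"
    using q B by (intro mult_left_mono) (auto simp: field_simps)
  finally show ?thesis by (simp add: q_def)
qed

text \<open>The coefficients inherit holomorphy in the parameter because they are uniform limits of
  the difference quotients \<open>(F h q - (\<Sum>k<n. a k q * h ^ k)) / h ^ n\<close> as \<open>h \<rightarrow> 0\<close>.\<close>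

lemma power_series_param:
  fixes F :: "complex \<Rightarrow> 'a \<Rightarrow> complex"
  assumes \<rho>: "\<rho> > 0"
    and hol: "\<And>q. q \<in> K \<Longrightarrow> (\<lambda>z. F z q) holomorphic_on ball 0 \<rho>"
    and bd: "\<And>z q. z \<in> ball 0 \<rho> \<Longrightarrow> q \<in> K \<Longrightarrow> norm (F z q) \<le> B"
    and \<Gamma>: "\<And>\<gamma> z. \<gamma> \<in> \<Gamma> \<Longrightarrow> z \<in> ball 0 \<rho> \<Longrightarrow> \<gamma> z \<in> K"
    and hol\<Gamma>: "\<And>\<gamma> z. \<gamma> \<in> \<Gamma> \<Longrightarrow> z \<in> ball 0 \<rho> \<Longrightarrow> (\<lambda>x. F z (\<gamma> x)) holomorphic_on ball 0 \<rho>"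
  obtains a where "\<And>q z. q \<in> K \<Longrightarrow> norm z \<le> \<rho> / 4 \<Longrightarrow> ((\<lambda>n. a n q * z ^ n) has_sum F z q) UNIV"
    "\<And>q n. q \<in> K \<Longrightarrow> norm (a n q) \<le> B / (\<rho> / 2) ^ n"
    "\<And>\<gamma> n. \<gamma> \<in> \<Gamma> \<Longrightarrow> (\<lambda>x. a n (\<gamma> x)) holomorphic_on ball 0 \<rho>"
proof -
  define a where "a n q = (deriv ^^ n) (\<lambda>z. F z q) 0 / fact n" for n q
  \<comment> \<open>Cauchy's estimate needs a closed disc inside the domain; for
    \<open>norm z \<le> \<rho> / 4 = \<delta> / 2\<close> the series then has ratio at most
    1/2.\<close>
  define \<delta> where "\<delta> = \<rho> / 2"
  have \<delta>: "\<delta> > 0" using \<rho> by (simp add: \<delta>_def)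
  have an: "norm (a n q) \<le> B / \<delta> ^ n" if "q \<in> K" for n q
  proof -
    have "norm ((deriv ^^ n) (\<lambda>z. F z q) 0) \<le> fact n * B / \<delta> ^ n"
    proof (rule Cauchy_inequality)
      show "(\<lambda>z. F z q) holomorphic_on ball 0 \<delta>"
        by (rule holomorphic_on_subset[OF hol[OF that]]) (use \<rho> in \<open>auto simp: \<delta>_def\<close>)
      show "continuous_on (cball 0 \<delta>) (\<lambda>z. F z q)"
        by (rule holomorphic_on_imp_continuous_on, rule holomorphic_on_subset[OF hol[OF that]])
          (use \<rho> in \<open>auto simp: \<delta>_def\<close>)
    qed (use \<rho> that bd in \<open>auto simp: \<delta>_def\<close>)
    then show ?thesis by (simp add: a_def norm_divide field_simps)
  qed
  have sm: "(\<lambda>n. a n q * z ^ n) sums F z q" if "q \<in> K" "norm z < \<rho>" for q z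
    using holomorphic_power_series[OF hol[OF that(1)], of z] that(2) by (simp add: a_def)
  have ha: "(\<lambda>x. a n (\<gamma> x)) holomorphic_on ball 0 \<rho>" if "\<gamma> \<in> \<Gamma>" for \<gamma> n
  \<comment> \<open>Strong induction, because the difference quotient for \<open>a n\<close>
    subtracts all lower coefficients.\<close>
  proof (induction n rule: less_induct)
    case (less n)
    define h where "h m = complex_of_real (\<delta> / 2 / real (Suc m))" for m
    have hpos: "h m \<noteq> 0" for m
      using \<delta> unfolding h_def by (subst of_real_eq_0_iff) auto
    have "\<delta> / 2 / real (Suc m) \<le> \<delta> / 2 / 1" for m using \<delta> by (intro divide_left_mono) auto
    then have hle: "norm (h m) \<le> \<delta> / 2" for m using \<delta> unfolding h_def norm_of_real by (simp add: abs_of_pos)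
    have hr: "norm (h m) < \<rho>" for m using hle[of m] \<rho> by (simp add: \<delta>_def)
    define g where "g m x = (F (h m) (\<gamma> x) - (\<Sum>k<n. a k (\<gamma> x) * h m ^ k)) / h m ^ n" for m x
    have err: "norm (g m x - a n (\<gamma> x)) \<le> 2 * B / \<delta> ^ Suc n * norm (h m)" if "x \<in> ball 0 \<rho>" for m x
    proof -
      have xK: "\<gamma> x \<in> K" using \<Gamma> \<open>\<gamma> \<in> \<Gamma>\<close> that by auto
      have "norm (F (h m) (\<gamma> x) - (\<Sum>k<Suc n. a k (\<gamma> x) * h m ^ k)) \<le> 2 * B * (norm (h m) / \<delta>) ^ Suc n"
        using power_series_tail_bound[OF sm[OF xK hr] \<delta> an[OF xK] hle] .
      moreover have "g m x - a n (\<gamma> x) = (F (h m) (\<gamma> x) - (\<Sum>k<Suc n. a k (\<gamma> x) * h m ^ k)) / h m ^ n"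
        using hpos by (simp add: g_def field_simps)
      ultimately have "norm (g m x - a n (\<gamma> x)) \<le> 2 * B * (norm (h m) / \<delta>) ^ Suc n / norm (h m) ^ n"
        by (simp only: norm_divide norm_power) (intro divide_right_mono; simp)
      also have "\<dots> = 2 * B / \<delta> ^ Suc n * norm (h m)"
        using hpos by (simp add: power_divide field_simps)
      finally show ?thesis .
    qed
    have lim: "(\<lambda>m. 2 * B / \<delta> ^ Suc n * norm (h m)) \<longlonglongrightarrow> 0"
    proof -
      have "(\<lambda>m. \<delta> / 2 / real (Suc m)) \<longlonglongrightarrow> 0"
        using LIMSEQ_Suc[OF lim_const_over_n[of "\<delta> / 2"]] .
      then have "(\<lambda>m. h m) \<longlonglongrightarrow> of_real 0" unfolding h_def by (intro tendsto_of_real)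
      then have "(\<lambda>m. norm (h m)) \<longlonglongrightarrow> 0" using tendsto_norm_zero by simp
      from tendsto_mult_left[OF this, of "2 * B / \<delta> ^ Suc n"] show ?thesis by simp
    qed
    have ul: "uniform_limit (ball 0 \<rho>) g (\<lambda>x. a n (\<gamma> x)) sequentially"
    proof (rule uniform_limitI)
      fix e :: real assume "e > 0"
      from order_tendstoD(2)[OF lim this]
      show "\<forall>\<^sub>F m in sequentially. \<forall>x\<in>ball 0 \<rho>. dist (g m x) (a n (\<gamma> x)) < e"
        by (rule eventually_mono) (use le_less_trans[OF err] in \<open>auto simp only: dist_norm\<close>)
    qed
    show ?case
    proof (rule holomorphic_uniform_sequence[of "ball 0 \<rho>" g])
      show "g m holomorphic_on ball 0 \<rho>" for m
        unfolding g_def using hpos hol\<Gamma>[OF that, of "h m"] hr[of m] less.IH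
        by (intro holomorphic_intros) auto
      fix x :: complex assume "x \<in> ball 0 \<rho>"
      then obtain d where "d > 0" "cball x d \<subseteq> ball 0 \<rho>"
        using open_contains_cball[of "ball (0::complex) \<rho>"] by blast
      then show "\<exists>d>0. cball x d \<subseteq> ball 0 \<rho> \<and> uniform_limit (cball x d) g (\<lambda>x. a n (\<gamma> x)) sequentially"
        using uniform_limit_on_subset[OF ul] by blast
    qed auto
  qed
  have hs: "((\<lambda>n. a n q * z ^ n) has_sum F z q) UNIV" if "q \<in> K" "norm z \<le> \<rho> / 4" for q z
  proof (rule norm_summable_imp_has_sum)
    show "(\<lambda>n. a n q * z ^ n) sums F z q" using that \<rho> by (intro sm) auto
    have "summable (\<lambda>n. B * (norm z / \<delta>) ^ n)"
      using that \<rho> by (intro summable_mult summable_geometric) (auto simp: \<delta>_def)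
    then show "summable (\<lambda>n. norm (a n q * z ^ n))"
    proof (rule summable_comparison_test[rotated], intro exI allI impI)
      fix n
      have "norm (a n q * z ^ n) \<le> B / \<delta> ^ n * norm z ^ n"
        unfolding norm_mult norm_power by (intro mult_right_mono an that) auto
      then show "norm (norm (a n q * z ^ n)) \<le> B * (norm z / \<delta>) ^ n" by (simp add: power_divide)
    qed
  qed
  from that[OF hs an[unfolded \<delta>_def] ha] show thesis by blast
qed


text \<open>\<open>\<Gamma>\<close> is a family of coordinate discs in \<open>K\<close>; every bounded function on \<open>K\<close> that is holomorphic
  along them has an absolutely convergent expansion on \<open>K'\<close> in the functions \<open>M i\<close>.\<close>

definition expandable :: "real \<Rightarrow> 'a set \<Rightarrow> (complex \<Rightarrow> 'a) set \<Rightarrow> 'a set \<Rightarrow> ('i \<Rightarrow> 'a \<Rightarrow> complex) \<Rightarrow> ('i \<Rightarrow> real) \<Rightarrow> bool" where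
  "expandable \<rho> K \<Gamma> K' M S \<longleftrightarrow>
     K' \<subseteq> K \<and> (\<forall>\<gamma>\<in>\<Gamma>. \<gamma> ` ball 0 \<rho> \<subseteq> K) \<and> S summable_on UNIV \<and> (\<forall>i. 0 \<le> S i) \<and>
     (\<forall>f B. (\<forall>q\<in>K. norm (f q) \<le> B) \<longrightarrow> (\<forall>\<gamma>\<in>\<Gamma>. (\<lambda>x. f (\<gamma> x)) holomorphic_on ball 0 \<rho>) \<longrightarrow>
       (\<exists>c. \<forall>q\<in>K'. ((\<lambda>i. c i * M i q) has_sum f q) UNIV \<and> (\<forall>i. norm (c i * M i q) \<le> B * S i)))"

lemma expandableD:
  assumes "expandable \<rho> K \<Gamma> K' M S" "\<And>q. q \<in> K \<Longrightarrow> norm (f q) \<le> B"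
    and "\<And>\<gamma>. \<gamma> \<in> \<Gamma> \<Longrightarrow> (\<lambda>x. f (\<gamma> x)) holomorphic_on ball 0 \<rho>"
  shows "\<exists>c. \<forall>q\<in>K'. ((\<lambda>i. c i * M i q) has_sum f q) UNIV"
proof -
  have "(\<forall>q\<in>K. norm (f q) \<le> B) \<longrightarrow> (\<forall>\<gamma>\<in>\<Gamma>. (\<lambda>x. f (\<gamma> x)) holomorphic_on ball 0 \<rho>) \<longrightarrow>
      (\<exists>c. \<forall>q\<in>K'. ((\<lambda>i. c i * M i q) has_sum f q) UNIV \<and> (\<forall>i. norm (c i * M i q) \<le> B * S i))"
    using assms(1) unfolding expandable_def by (elim conjE allE)
  then show ?thesis using assms(2,3) by fast
qed

text \<open>Base of the induction on the number of variables: a one-point space without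
  discs.\<close>

lemma expandable_unit: "expandable \<rho> UNIV {} UNIV (\<lambda>(_::unit) (_::unit). 1) (\<lambda>_. 1)"
  unfolding expandable_def
proof (intro conjI allI impI)
  fix f :: "unit \<Rightarrow> complex" and B assume b: "\<forall>q\<in>UNIV. norm (f q) \<le> B"
  show "\<exists>c. \<forall>q\<in>UNIV. ((\<lambda>i. c i * 1) has_sum f q) UNIV \<and> (\<forall>i::unit. norm (c i * 1) \<le> B * 1)"
    by (rule exI[of _ f]) (use b in \<open>auto simp: has_sum_finite_iff UNIV_unit\<close>)
qed auto

text \<open>The new variable is expanded with the old ones as parameters:
  \<open>power_series_param\<close> bounds the coefficients by \<open>B / (\<rho> / 2) ^ n\<close>
  and keeps them holomorphic along the old discs, so the hypothesis expands each of them. On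
  \<open>norm z \<le> \<rho> / 4\<close> this produces the majorant
  \<open>(1 / 2) ^ n * S i\<close>. The bound \<open>B * S i\<close> in \<open>expandable\<close> is
  linear in \<open>B\<close> precisely so that it passes through this step.\<close>

lemma expandable_prod:
  fixes K :: "'a set" and M :: "'i \<Rightarrow> 'a \<Rightarrow> complex"
  assumes \<rho>: "\<rho> > 0" and ex: "expandable \<rho> K \<Gamma> K' M S"
  shows "expandable \<rho> (ball 0 \<rho> \<times> K)
      ({(\<lambda>x. (x, q)) |q. q \<in> K} \<union> {(\<lambda>x. (z, \<gamma> x)) |z \<gamma>. z \<in> ball 0 \<rho> \<and> \<gamma> \<in> \<Gamma>})
      (cball 0 (\<rho> / 4) \<times> K') (\<lambda>(n, i) (z, q). z ^ n * M i q) (\<lambda>(n, i). (1 / 2) ^ n * S i)"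
  unfolding expandable_def
proof (intro conjI allI impI)
  have K': "K' \<subseteq> K" and \<Gamma>0: "\<forall>\<gamma>\<in>\<Gamma>. \<gamma> ` ball 0 \<rho> \<subseteq> K"
    and S: "S summable_on UNIV" and S0: "\<And>i. 0 \<le> S i"
    using ex by (auto simp: expandable_def)
  have \<Gamma>: "\<gamma> z \<in> K" if "\<gamma> \<in> \<Gamma>" "z \<in> ball 0 \<rho>" for \<gamma> z
    using bspec[OF \<Gamma>0 that(1)] that(2) by blast
  show "cball 0 (\<rho> / 4) \<times> K' \<subseteq> ball 0 \<rho> \<times> K" using K' \<rho> by auto
  show "\<forall>\<gamma>\<in>{\<lambda>x. (x, q) |q. q \<in> K} \<union> {\<lambda>x. (z, \<gamma> x) |z \<gamma>. z \<in> ball 0 \<rho> \<and> \<gamma> \<in> \<Gamma>}.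
       \<gamma> ` ball 0 \<rho> \<subseteq> ball 0 \<rho> \<times> K" using \<Gamma> by auto
  show S': "(\<lambda>(n, i). (1 / 2) ^ n * S i) summable_on UNIV"
  proof -
    have "(\<lambda>(n, i). (1 / 2) ^ n * S i) summable_on (UNIV \<times> UNIV)"
    proof (rule summable_on_SigmaI)
      fix n :: nat
      show "((\<lambda>y. case (n, y) of (n, i) \<Rightarrow> (1 / 2) ^ n * S i) has_sum ((1 / 2) ^ n * infsum S UNIV)) UNIV"
        using has_sum_cmult_right[OF has_sum_infsum[OF S], of "(1 / 2) ^ n"] by simp
      have "summable (\<lambda>n. (1 / 2 :: real) ^ n * \<bar>infsum S UNIV\<bar>)"
        by (intro summable_mult2 summable_geometric) simp
      then have "summable (\<lambda>n. norm ((1 / 2 :: real) ^ n * infsum S UNIV))"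
        by (simp add: abs_mult)
      then show "(\<lambda>n. (1 / 2) ^ n * infsum S UNIV) summable_on UNIV"
        by (rule norm_summable_imp_summable_on)
    qed (use S0 in auto)
    then show ?thesis by simp
  qed
  show "0 \<le> (case i of (n, i) \<Rightarrow> (1 / 2) ^ n * S i)" for i using S0 by (cases i) auto
  fix f :: "complex \<times> 'a \<Rightarrow> complex" and B
  assume bd: "\<forall>q\<in>ball 0 \<rho> \<times> K. norm (f q) \<le> B"
    and hol: "\<forall>\<gamma>\<in>{\<lambda>x. (x, q) |q. q \<in> K} \<union> {\<lambda>x. (z, \<gamma> x) |z \<gamma>. z \<in> ball 0 \<rho> \<and> \<gamma> \<in> \<Gamma>}.
       (\<lambda>x. f (\<gamma> x)) holomorphic_on ball 0 \<rho>"
  obtain a where a: "\<And>q z. q \<in> K \<Longrightarrow> norm z \<le> \<rho> / 4 \<Longrightarrow> ((\<lambda>n. a n q * z ^ n) has_sum f (z, q)) UNIV"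
    "\<And>q n. q \<in> K \<Longrightarrow> norm (a n q) \<le> B / (\<rho> / 2) ^ n"
    "\<And>\<gamma> n. \<gamma> \<in> \<Gamma> \<Longrightarrow> (\<lambda>x. a n (\<gamma> x)) holomorphic_on ball 0 \<rho>"
  proof (rule power_series_param[OF \<rho>, of K "\<lambda>z q. f (z, q)" B \<Gamma>])
    show "(\<lambda>z. f (z, q)) holomorphic_on ball 0 \<rho>" if "q \<in> K" for q
      using bspec[OF hol, of "\<lambda>x. (x, q)"] that by auto
    show "(\<lambda>x. f (z, \<gamma> x)) holomorphic_on ball 0 \<rho>" if "\<gamma> \<in> \<Gamma>" "z \<in> ball 0 \<rho>" for \<gamma> z
      using bspec[OF hol, of "\<lambda>x. (z, \<gamma> x)"] that by auto
  qed (use bd \<Gamma> in auto)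
  have "\<forall>n. \<exists>c. \<forall>q\<in>K'. ((\<lambda>i. c i * M i q) has_sum a n q) UNIV \<and>
      (\<forall>i. norm (c i * M i q) \<le> B / (\<rho> / 2) ^ n * S i)"
    using ex a(2,3) unfolding expandable_def by blast
  then obtain c where c: "\<And>n q. q \<in> K' \<Longrightarrow> ((\<lambda>i. c n i * M i q) has_sum a n q) UNIV"
    "\<And>n q i. q \<in> K' \<Longrightarrow> norm (c n i * M i q) \<le> B / (\<rho> / 2) ^ n * S i"
    by metis
  show "\<exists>c. \<forall>q\<in>cball 0 (\<rho> / 4) \<times> K'.
     ((\<lambda>i. c i * (case i of (n, i) \<Rightarrow> \<lambda>(z, q). z ^ n * M i q) q) has_sum f q) UNIV \<and>
     (\<forall>i. norm (c i * (case i of (n, i) \<Rightarrow> \<lambda>(z, q). z ^ n * M i q) q) \<le> B * (case i of (n, i) \<Rightarrow> (1 / 2) ^ n * S i))"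
  proof (intro exI[of _ "\<lambda>(n, i). c n i"] ballI, elim SigmaE, clarify)
    fix z :: complex and q :: 'a assume z: "z \<in> cball 0 (\<rho> / 4)" and q: "q \<in> K'"
    define t where "t = (\<lambda>(n, i). c n i * (z ^ n * M i q))"
    have bt: "norm (t (n, i)) \<le> B * ((1 / 2) ^ n * S i)" for n i
    proof -
      have B: "0 \<le> B" using bd q K' \<rho> by (smt (verit) SigmaI centre_in_ball norm_ge_zero subsetD)
      have "norm (t (n, i)) = norm (c n i * M i q) * norm z ^ n" by (simp add: t_def norm_mult norm_power)
      also have "\<dots> \<le> (B / (\<rho> / 2) ^ n * S i) * (\<rho> / 4) ^ n"
        using z \<rho> B S0 by (intro mult_mono c q power_mono) auto
      also have "\<dots> = B * ((1 / 2) ^ n * S i)"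
      proof -
        have "(\<rho> / 4) ^ n = (1 / 2) ^ n * (\<rho> / 2) ^ n" by (simp flip: power_mult_distrib)
        moreover have "(\<rho> / 2) ^ n \<noteq> 0" using \<rho> by simp
        ultimately show ?thesis using \<rho> by simp
      qed
      finally show ?thesis .
    qed
    have "(\<lambda>i. norm (t i)) summable_on UNIV"
      by (rule Infinite_Sum.abs_summable_on_comparison_test'[OF summable_on_cmult_right[OF S', of B]]) (use bt in auto)
    then have "t summable_on (UNIV \<times> UNIV)" using abs_summable_summable by simp
    \<comment> \<open>Absolute summability of the double family lets its sum be computed
      iteratively, over \<open>i\<close> and then over \<open>n\<close>.\<close>
    then have "(t has_sum f (z, q)) (UNIV \<times> UNIV)"
    proof (rule has_sum_SigmaI[rotated 2])
      show "((\<lambda>n. a n q * z ^ n) has_sum f (z, q)) UNIV" using a(1) q z K' by auto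
      show "((\<lambda>i. t (n, i)) has_sum a n q * z ^ n) UNIV" for n
        using has_sum_cmult_left[OF c(1)[OF q, of n], of "z ^ n"] by (simp add: t_def mult_ac)
    qed
    moreover have "(\<lambda>i. (case i of (n, i) \<Rightarrow> c n i) * (case i of (n, i) \<Rightarrow> \<lambda>(z, q). z ^ n * M i q) (z, q)) = t"
      by (auto simp: t_def)
    ultimately show "((\<lambda>i. (case i of (n, i) \<Rightarrow> c n i) * (case i of (n, i) \<Rightarrow> \<lambda>(z, q). z ^ n * M i q) (z, q)) has_sum f (z, q)) UNIV \<and>
      (\<forall>i. norm ((case i of (n, i) \<Rightarrow> c n i) * (case i of (n, i) \<Rightarrow> \<lambda>(z, q). z ^ n * M i q) (z, q)) \<le> B * (case i of (n, i) \<Rightarrow> (1 / 2) ^ n * S i))"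
      using bt by (auto simp: t_def)
  qed
qed

section \<open>Power series of holomorphic fields in four complex variables\<close>

lemma norm_c4_le: "norm ((z1, z2, \<zeta>, w) :: c4) \<le> norm z1 + norm z2 + norm \<zeta> + norm w"
  using norm_Pair_le[of z1 "(z2, \<zeta>, w)"] norm_Pair_le[of z2 "(\<zeta>, w)"] norm_Pair_le[of \<zeta> w] by linarith

definition polydisc :: "real \<Rightarrow> c4 set" where
  "polydisc \<rho> = cball 0 \<rho> \<times> cball 0 \<rho> \<times> cball 0 \<rho> \<times> cball 0 \<rho>"

text \<open>Complex linearity turns \<open>D (cmul4 h v)\<close> into \<open>h * D v\<close>, which
  is a complex derivative in one variable. Applied to the coordinate lines.\<close>

lemma holomorphic_along_curve:
  fixes f :: "c4 \<Rightarrow> complex"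
  assumes f: "\<And>p. p \<in> U \<Longrightarrow> \<exists>D. (f has_derivative D) (at p) \<and> (\<forall>c v. D (cmul4 c v) = c * D v)"
    and \<gamma>: "\<And>x. x \<in> S \<Longrightarrow> \<gamma> x \<in> U" "\<And>x. x \<in> S \<Longrightarrow> (\<gamma> has_derivative (\<lambda>h. cmul4 h v)) (at x)"
    and S: "open S"
  shows "(\<lambda>x. f (\<gamma> x)) holomorphic_on S"
  unfolding holomorphic_on_open[OF S]
proof (intro ballI)
  fix x assume x: "x \<in> S"
  obtain D where D: "(f has_derivative D) (at (\<gamma> x))" "\<forall>c v. D (cmul4 c v) = c * D v"
    using f \<gamma>(1) x by blast
  have "((\<lambda>x. f (\<gamma> x)) has_derivative (\<lambda>h. D (cmul4 h v))) (at x)"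
    by (rule has_derivative_compose[OF \<gamma>(2)[OF x] D(1)])
  moreover have "(\<lambda>h. D (cmul4 h v)) = (*) (D v)"
    by (rule ext) (simp only: D(2)[rule_format] mult.commute)
  ultimately have "((\<lambda>x. f (\<gamma> x)) has_field_derivative D v) (at x)"
    by (simp only: has_field_derivative_def)
  then show "\<exists>f'. ((\<lambda>x. f (\<gamma> x)) has_field_derivative f') (at x)" by blast
qed

lemma power_series_c4:
  fixes f :: "c4 \<Rightarrow> complex"
  assumes r: "r > 0"
    and f: "\<And>p. p \<in> ball 0 r \<Longrightarrow> \<exists>D. (f has_derivative D) (at p) \<and> (\<forall>c v. D (cmul4 c v) = c * D v)"
  shows "\<exists>a. \<forall>p\<in>polydisc (r / 32). ((\<lambda>\<alpha>. a \<alpha> * mon4 \<alpha> p) has_sum f p) UNIV"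
proof -
  \<comment> \<open>Four coordinates below \<open>r / 8\<close> keep the point in the compact ball
    of radius \<open>r / 2\<close>, where \<open>f\<close> is bounded; the factor 4 of
    \<open>expandable_prod\<close> then gives \<open>r / 32\<close>.\<close>
  define \<rho> where "\<rho> = r / 8"
  have \<rho>: "\<rho> > 0" using r by (simp add: \<rho>_def)
  have inb: "norm ((z1, z2, \<zeta>, w) :: c4) \<le> r / 2" "(z1, z2, \<zeta>, w) \<in> ball 0 r"
    if "norm z1 < \<rho>" "norm z2 < \<rho>" "norm \<zeta> < \<rho>" "norm w < \<rho>" for z1 z2 \<zeta> w
    using norm_c4_le[of z1 z2 \<zeta> w] that r by (auto simp: \<rho>_def)
  have "continuous_on (cball 0 (r / 2)) f"
  proof (rule continuous_at_imp_continuous_on, intro ballI)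
    fix p :: c4 assume "p \<in> cball 0 (r / 2)"
    then have "p \<in> ball 0 r" using r by auto
    then show "continuous (at p) f" using f has_derivative_continuous by blast
  qed
  then have "compact (f ` cball 0 (r / 2))" by (intro compact_continuous_image compact_cball)
  then obtain B where B: "\<And>p. p \<in> cball 0 (r / 2) \<Longrightarrow> norm (f p) \<le> B"
    using compact_imp_bounded bounded_iff by (metis imageI)
  \<comment> \<open>The trailing \<open>unit\<close> coordinate matches the base case
    \<open>expandable_unit\<close>.\<close>
  define f' where "f' = (\<lambda>(z1, z2, \<zeta>, w, u :: unit). f (z1, z2, \<zeta>, w))"
  note ex = expandable_prod[OF \<rho> expandable_prod[OF \<rho> expandable_prod[OF \<rho> expandable_prod[OF \<rho> expandable_unit[of \<rho>]]]]]
  have h1: "(\<lambda>x. f (x, z2, \<zeta>, w)) holomorphic_on ball 0 \<rho>" if "norm z2 < \<rho>" "norm \<zeta> < \<rho>" "norm w < \<rho>" for z2 \<zeta> w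
    by (rule holomorphic_along_curve[OF f, of "ball 0 r" _ _ "(1, 0, 0, 0)"])
      (use that inb in \<open>auto simp: cmul4_def zero_prod_def intro!: derivative_eq_intros\<close>)
  have h2: "(\<lambda>x. f (z1, x, \<zeta>, w)) holomorphic_on ball 0 \<rho>" if "norm z1 < \<rho>" "norm \<zeta> < \<rho>" "norm w < \<rho>" for z1 \<zeta> w
    by (rule holomorphic_along_curve[OF f, of "ball 0 r" _ _ "(0, 1, 0, 0)"])
      (use that inb in \<open>auto simp: cmul4_def zero_prod_def intro!: derivative_eq_intros\<close>)
  have h3: "(\<lambda>x. f (z1, z2, x, w)) holomorphic_on ball 0 \<rho>" if "norm z1 < \<rho>" "norm z2 < \<rho>" "norm w < \<rho>" for z1 z2 w
    by (rule holomorphic_along_curve[OF f, of "ball 0 r" _ _ "(0, 0, 1, 0)"])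
      (use that inb in \<open>auto simp: cmul4_def zero_prod_def intro!: derivative_eq_intros\<close>)
  have h4: "(\<lambda>x. f (z1, z2, \<zeta>, x)) holomorphic_on ball 0 \<rho>" if "norm z1 < \<rho>" "norm z2 < \<rho>" "norm \<zeta> < \<rho>" for z1 z2 \<zeta>
    by (rule holomorphic_along_curve[OF f, of "ball 0 r" _ _ "(0, 0, 0, 1)"])
      (use that inb in \<open>auto simp: cmul4_def zero_prod_def intro!: derivative_eq_intros\<close>)
  obtain c :: "nat \<times> nat \<times> nat \<times> nat \<times> unit \<Rightarrow> complex" where c: "\<forall>q\<in>cball 0 (\<rho> / 4) \<times> cball 0 (\<rho> / 4) \<times> cball 0 (\<rho> / 4) \<times> cball 0 (\<rho> / 4) \<times> UNIV.
     ((\<lambda>i. c i * (\<lambda>(n, i) (z, q). z ^ n * (\<lambda>(n, i) (z, q). z ^ n *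
       (\<lambda>(n, i) (z, q). z ^ n * (\<lambda>(n, i) (z, q). z ^ n * 1) i q) i q) i q) i q) has_sum f' q) UNIV"
  proof (atomize_elim, rule expandableD[OF ex, of f' B])
    show "norm (f' q) \<le> B" if "q \<in> ball 0 \<rho> \<times> ball 0 \<rho> \<times> ball 0 \<rho> \<times> ball 0 \<rho> \<times> UNIV" for q
      using that B inb(1) by (auto simp: f'_def)
  qed (use h1 h2 h3 h4 in \<open>auto simp: f'_def\<close>)
  show ?thesis
  proof (intro exI[of _ "\<lambda>(i, j, k, l). c (i, j, k, l, ())"] ballI)
    fix p assume "p \<in> polydisc (r / 32)"
    then obtain z1 z2 \<zeta> w where p: "p = (z1, z2, \<zeta>, w)"
      and "(z1, z2, \<zeta>, w, ()) \<in> cball 0 (\<rho> / 4) \<times> cball 0 (\<rho> / 4) \<times> cball 0 (\<rho> / 4) \<times> cball 0 (\<rho> / 4) \<times> UNIV"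
      by (auto simp: \<rho>_def polydisc_def)
    note hs = bspec[OF c this(2)]
    have bij: "bij_betw (\<lambda>(i, j, k, l). (i, j, k, l, ())) (UNIV :: mi4 set) UNIV"
      by (rule bij_betwI[of _ _ _ "\<lambda>(i, j, k, l, _). (i, j, k, l)"]) auto
    show "((\<lambda>\<alpha>. (case \<alpha> of (i, j, k, l) \<Rightarrow> c (i, j, k, l, ())) * mon4 \<alpha> p) has_sum f p) UNIV"
      using hs[folded has_sum_reindex_bij_betw[OF bij]]
      by (simp add: p f'_def mon4_def split_def mult.assoc)
  qed
qed

definition power_series_on :: "real \<Rightarrow> (mi4 \<Rightarrow> c4) \<Rightarrow> vf \<Rightarrow> bool" where
  "power_series_on \<rho> a X \<longleftrightarrow> (\<forall>p\<in>polydisc \<rho>. ((\<lambda>\<alpha>. cmul4 (mon4 \<alpha> p) (a \<alpha>)) has_sum X p) UNIV)"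

lemma has_sum_Pair:
  assumes "(f has_sum a) A" "(g has_sum b) A"
  shows "((\<lambda>x. (f x, g x)) has_sum (a, b)) A"
proof -
  have "sum (\<lambda>x. (f x, g x)) = (\<lambda>F. (sum f F, sum g F))"
    by (rule ext) (simp add: sum_prod)
  then show ?thesis
    using tendsto_Pair[OF assms[unfolded has_sum_def]] unfolding has_sum_def by simp
qed

lemma holo4_on_power_series:
  assumes "r > 0" "holo4_on (ball 0 r) X"
  shows "\<exists>a. power_series_on (r / 32) a X"
proof -
  have comp: "\<exists>a. \<forall>p\<in>polydisc (r / 32). ((\<lambda>\<alpha>. a \<alpha> * mon4 \<alpha> p) has_sum \<pi> (X p)) UNIV"
    if \<pi>: "bounded_linear \<pi>" "\<And>c v. \<pi> (cmul4 c v) = c * \<pi> v" for \<pi>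
  proof (rule power_series_c4[OF assms(1), of "\<lambda>p. \<pi> (X p)"])
    fix p :: c4 assume "p \<in> ball 0 r"
    then obtain D where D: "(X has_derivative D) (at p)" "\<forall>c v. D (cmul4 c v) = cmul4 c (D v)"
      using assms(2) unfolding holo4_on_def by blast
    then show "\<exists>D. ((\<lambda>p. \<pi> (X p)) has_derivative D) (at p) \<and> (\<forall>c v. D (cmul4 c v) = c * D v)"
      using bounded_linear.has_derivative[OF \<pi>(1) D(1)] \<pi>(2) by (intro exI[of _ "\<lambda>v. \<pi> (D v)"]) auto
  qed
  have b: "bounded_linear (fst :: c4 \<Rightarrow> _)" "bounded_linear (\<lambda>p :: c4. fst (snd p))"
    "bounded_linear (\<lambda>p :: c4. fst (snd (snd p)))" "bounded_linear (\<lambda>p :: c4. snd (snd (snd p)))"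
    by (intro bounded_linear_intros)+
  obtain a1 where a1: "\<forall>p\<in>polydisc (r / 32). ((\<lambda>\<alpha>. a1 \<alpha> * mon4 \<alpha> p) has_sum fst (X p)) UNIV"
    using comp[OF b(1)] by (auto simp: cmul4_def split_def)
  obtain a2 where a2: "\<forall>p\<in>polydisc (r / 32). ((\<lambda>\<alpha>. a2 \<alpha> * mon4 \<alpha> p) has_sum fst (snd (X p))) UNIV"
    using comp[OF b(2)] by (auto simp: cmul4_def split_def)
  obtain a3 where a3: "\<forall>p\<in>polydisc (r / 32). ((\<lambda>\<alpha>. a3 \<alpha> * mon4 \<alpha> p) has_sum fst (snd (snd (X p)))) UNIV"
    using comp[OF b(3)] by (auto simp: cmul4_def split_def)
  obtain a4 where a4: "\<forall>p\<in>polydisc (r / 32). ((\<lambda>\<alpha>. a4 \<alpha> * mon4 \<alpha> p) has_sum snd (snd (snd (X p)))) UNIV"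
    using comp[OF b(4)] by (auto simp: cmul4_def split_def)
  show ?thesis
    unfolding power_series_on_def
  proof (intro exI[of _ "\<lambda>\<alpha>. (a1 \<alpha>, a2 \<alpha>, a3 \<alpha>, a4 \<alpha>)"] ballI)
    fix p assume p: "p \<in> polydisc (r / 32)"
    show "((\<lambda>\<alpha>. cmul4 (mon4 \<alpha> p) (a1 \<alpha>, a2 \<alpha>, a3 \<alpha>, a4 \<alpha>)) has_sum X p) UNIV"
      using has_sum_Pair[OF bspec[OF a1 p] has_sum_Pair[OF bspec[OF a2 p] has_sum_Pair[OF bspec[OF a3 p] bspec[OF a4 p]]]]
      by (simp add: cmul4_def mult.commute)
  qed
qed

section \<open>Dilations and the leading part\<close>

definition dil4 :: "real \<Rightarrow> c4 \<Rightarrow> c4" where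
  "dil4 t = (\<lambda>(z1, z2, \<zeta>, w). (of_real (t ^ 2) * z1, of_real t * z2, of_real t * \<zeta>, of_real (t ^ 3) * w))"

lemma mon4_dil4: "mon4 \<alpha> (dil4 t p) = of_real (t ^ weight4 \<alpha>) * mon4 \<alpha> p"
  by (cases \<alpha>; cases p)
    (simp add: mon4_def dil4_def weight4_def power_mult_distrib power_add mult_ac flip: power_mult)

lemma norm_mon4_le:
  assumes "p \<in> polydisc \<rho>" "\<rho> \<ge> 0"
  shows "norm (mon4 \<alpha> p) \<le> norm (mon4 \<alpha> (of_real \<rho>, of_real \<rho>, of_real \<rho>, of_real \<rho>))"
  using assms by (cases \<alpha>; cases p)
    (auto simp: mon4_def polydisc_def norm_mult norm_power intro!: mult_mono power_mono)

lemma dil4_polydisc: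
  assumes "p \<in> polydisc \<rho>" "0 \<le> t" "t \<le> 1"
  shows "dil4 t p \<in> polydisc \<rho>"
proof -
  have "t ^ n * norm z \<le> \<rho>" if "norm z \<le> \<rho>" for n and z :: complex
    using mult_mono[of "t ^ n" 1 "norm z" \<rho>] power_le_one[of t n] assms that by simp
  from this[where n = 1] this[where n = 2] this[where n = 3] show ?thesis
    using assms by (cases p) (auto simp: polydisc_def dil4_def norm_mult norm_power)
qed

lemma has_sum_minus_finite:
  fixes f :: "'i \<Rightarrow> 'a :: real_normed_vector"
  assumes "(f has_sum s) UNIV" "finite A"
  shows "((\<lambda>i. if i \<in> A then 0 else f i) has_sum (s - sum f A)) UNIV"
proof -
  have "((\<lambda>i. if i \<in> A then - f i else 0) has_sum - sum f A) UNIV"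
    by (rule has_sum_finite_neutralI[of A]) (use assms in \<open>auto simp: sum_negf\<close>)
  from has_sum_add[OF assms(1) this] have "((\<lambda>i. f i + (if i \<in> A then - f i else 0)) has_sum (s - sum f A)) UNIV"
    by simp
  also have "(\<lambda>i. f i + (if i \<in> A then - f i else 0)) = (\<lambda>i. if i \<in> A then 0 else f i)" by auto
  finally show ?thesis .
qed

text \<open>Dilation multiplies the term of index \<open>\<alpha>\<close> by
  \<open>t ^ (weight4 \<alpha> + \<sigma>)\<close>. As the parts below \<open>K\<close> vanish,
  everything besides part \<open>K\<close> carries at least \<open>t ^ Suc K\<close>. The constant
  is the sum of absolute values at the corner of the polydisc and is chosen before \<open>K\<close>,
  so that \<open>K\<close> may later tend to infinity.\<close>

lemma wpart_asymptotics:
  fixes f :: "c4 \<Rightarrow> complex"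
  assumes \<rho>: "\<rho> > 0" and f: "\<And>p. p \<in> polydisc \<rho> \<Longrightarrow> ((\<lambda>\<alpha>. a \<alpha> * mon4 \<alpha> p) has_sum f p) UNIV"
  shows "\<exists>C\<ge>0. \<forall>K p t. p \<in> polydisc \<rho> \<longrightarrow> 0 < t \<longrightarrow> t \<le> 1 \<longrightarrow> (\<forall>k<K. \<forall>q. wpart \<sigma> a k q = 0) \<longrightarrow>
     norm (of_real (t ^ \<sigma>) * f (dil4 t p) - of_real (t ^ K) * wpart \<sigma> a K p) \<le> C * t ^ Suc K"
proof -
  define p\<^sub>0 :: c4 where "p\<^sub>0 = (of_real \<rho>, of_real \<rho>, of_real \<rho>, of_real \<rho>)"
  have "p\<^sub>0 \<in> polydisc \<rho>" using \<rho> by (simp add: p\<^sub>0_def polydisc_def)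
  then have "(\<lambda>\<alpha>. norm (a \<alpha> * mon4 \<alpha> p\<^sub>0)) summable_on UNIV"
    by (intro summable_on_iff_abs_summable_on_complex[THEN iffD1] has_sum_imp_summable[OF f])
  then obtain C where C: "((\<lambda>\<alpha>. norm (a \<alpha> * mon4 \<alpha> p\<^sub>0)) has_sum C) UNIV"
    by (auto simp: summable_on_def)
  show ?thesis
  proof (intro exI[of _ C] conjI allI impI)
    show "0 \<le> C" using C by (rule has_sum_nonneg) auto
    fix K p and t :: real
    assume p: "p \<in> polydisc \<rho>" and t: "0 < t" "t \<le> 1" and low: "\<forall>k<K. \<forall>q. wpart \<sigma> a k q = 0"
    define h where "h \<alpha> = of_real (t ^ (weight4 \<alpha> + \<sigma>)) * (a \<alpha> * mon4 \<alpha> p)" for \<alpha>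
    define A where "A = {\<alpha>. weight4 \<alpha> + \<sigma> \<le> K}"
    have "((\<lambda>\<alpha>. of_real (t ^ \<sigma>) * (a \<alpha> * mon4 \<alpha> (dil4 t p))) has_sum of_real (t ^ \<sigma>) * f (dil4 t p)) UNIV"
      by (intro has_sum_cmult_right f dil4_polydisc) (use p t in auto)
    moreover have "(\<lambda>\<alpha>. of_real (t ^ \<sigma>) * (a \<alpha> * mon4 \<alpha> (dil4 t p))) = h"
      by (auto simp: h_def mon4_dil4 power_add mult_ac)
    ultimately have hs: "((\<lambda>\<alpha>. if \<alpha> \<in> A then 0 else h \<alpha>) has_sum (of_real (t ^ \<sigma>) * f (dil4 t p) - sum h A)) UNIV"
      using has_sum_minus_finite[of h _ A] finite_weight4_le[of \<sigma> K] by (simp add: A_def)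
    have "sum h A = (\<Sum>k\<le>K. \<Sum>\<alpha> | \<alpha> \<in> A \<and> weight4 \<alpha> + \<sigma> = k. h \<alpha>)"
      by (rule sum.group[symmetric]) (auto simp: A_def finite_weight4_le)
    also have "\<dots> = (\<Sum>k\<le>K. of_real (t ^ k) * wpart \<sigma> a k p)"
    proof (rule sum.cong[OF refl])
      fix k assume "k \<in> {..K}"
      then have "{\<alpha>. \<alpha> \<in> A \<and> weight4 \<alpha> + \<sigma> = k} = {\<alpha>. weight4 \<alpha> + \<sigma> = k}" by (auto simp: A_def)
      then show "(\<Sum>\<alpha> | \<alpha> \<in> A \<and> weight4 \<alpha> + \<sigma> = k. h \<alpha>) = of_real (t ^ k) * wpart \<sigma> a k p"
        by (simp add: wpart_def sum_distrib_left h_def)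
    qed
    also have "\<dots> = of_real (t ^ K) * wpart \<sigma> a K p"
    proof -
      have "(\<Sum>k<K. of_real (t ^ k) * wpart \<sigma> a k p) = 0"
        by (rule sum.neutral) (simp add: low)
      then show ?thesis by (simp add: lessThan_Suc_atMost[symmetric])
    qed
    finally have hs: "((\<lambda>\<alpha>. if \<alpha> \<in> A then 0 else h \<alpha>) has_sum
        (of_real (t ^ \<sigma>) * f (dil4 t p) - of_real (t ^ K) * wpart \<sigma> a K p)) UNIV"
      using hs by simp
    show "norm (of_real (t ^ \<sigma>) * f (dil4 t p) - of_real (t ^ K) * wpart \<sigma> a K p) \<le> C * t ^ Suc K"
    proof (rule norm_infsum_le[OF hs has_sum_cmult_left[OF C]])
      fix \<alpha>
      show "norm (if \<alpha> \<in> A then 0 else h \<alpha>) \<le> norm (a \<alpha> * mon4 \<alpha> p\<^sub>0) * t ^ Suc K"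
      proof (cases "\<alpha> \<in> A")
        case False
        then have "t ^ (weight4 \<alpha> + \<sigma>) \<le> t ^ Suc K"
          using t by (intro power_decreasing) (auto simp: A_def)
        moreover have "norm (a \<alpha> * mon4 \<alpha> p) \<le> norm (a \<alpha> * mon4 \<alpha> p\<^sub>0)"
          unfolding norm_mult p\<^sub>0_def using \<rho> by (intro mult_left_mono norm_mon4_le p) auto
        ultimately have "t ^ (weight4 \<alpha> + \<sigma>) * norm (a \<alpha> * mon4 \<alpha> p) \<le> t ^ Suc K * norm (a \<alpha> * mon4 \<alpha> p\<^sub>0)"
          using t by (intro mult_mono) auto
        then show ?thesis using False t by (simp add: h_def norm_mult norm_power mult.commute)
      qed (use t in auto)
    qed
  qed
qed

section \<open>Differentiability and dilation of the defining function\<close>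

text \<open>Controls a derivative through increments of the function alone, as a limit of difference
  quotients in the direction \<open>v\<close>.\<close>

lemma has_derivative_lipschitz_bound:
  fixes f :: "'a :: real_normed_vector \<Rightarrow> real"
  assumes "(f has_derivative D) (at x)" "\<delta> > 0"
    and lip: "\<And>y. y \<in> ball x \<delta> \<Longrightarrow> \<bar>f y - f x\<bar> \<le> L * norm (y - x)"
  shows "\<bar>D v\<bar> \<le> L * norm v"
proof -
  interpret D: bounded_linear D using assms(1) by (rule has_derivative_bounded_linear)
  have l: "((\<lambda>s. x + s *\<^sub>R v) has_derivative (\<lambda>s. s *\<^sub>R v)) (at 0)"
    by (auto intro!: derivative_eq_intros)
  have "((\<lambda>s. f (x + s *\<^sub>R v)) has_derivative (\<lambda>s. D (s *\<^sub>R v))) (at 0)"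
    by (rule has_derivative_compose[OF l]) (use assms(1) in simp)
  moreover have "(\<lambda>s. D (s *\<^sub>R v)) = (*) (D v)" by (auto simp: D.scaleR)
  ultimately have "DERIV (\<lambda>s. f (x + s *\<^sub>R v)) 0 :> D v" by (simp add: has_field_derivative_def)
  then have lim: "((\<lambda>h. \<bar>(f (x + h *\<^sub>R v) - f x) / h\<bar>) \<longlongrightarrow> \<bar>D v\<bar>) (at 0)"
    by (intro tendsto_rabs) (simp add: DERIV_def)
  have "((\<lambda>s. x + s *\<^sub>R v) \<longlongrightarrow> x + 0 *\<^sub>R v) (at 0)" by (intro tendsto_intros)
  then have "\<forall>\<^sub>F s in at 0. x + s *\<^sub>R v \<in> ball x \<delta>"
    using \<open>\<delta> > 0\<close> by (intro topological_tendstoD) auto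
  then have "\<forall>\<^sub>F h in at 0. \<bar>(f (x + h *\<^sub>R v) - f x) / h\<bar> \<le> L * norm v"
    using eventually_at_ball'[OF zero_less_one, of "0::real" UNIV]
  proof eventually_elim
    case (elim h)
    then have "\<bar>f (x + h *\<^sub>R v) - f x\<bar> \<le> L * (\<bar>h\<bar> * norm v)" using lip[of "x + h *\<^sub>R v"] by simp
    then show ?case using elim by (simp add: abs_divide divide_le_eq mult_ac)
  qed
  then show ?thesis using tendsto_upperbound[OF lim] by simp
qed

text \<open>Summable Lipschitz constants make the tails of the increments and of the derivatives
  small relative to \<open>norm (y - x)\<close>, so the termwise sum is a derivative. Existence has
  to be proved, since \<open>aut_hyp\<close> says nothing at points where \<open>hyp_rho F\<close>
  has no derivative.\<close>

lemma differentiable_has_sum_lipschitz: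
  fixes m :: "'i \<Rightarrow> 'a :: real_normed_vector \<Rightarrow> real"
  assumes \<delta>: "\<delta> > 0" and S: "S summable_on UNIV"
    and D: "\<And>i. (m i has_derivative D i) (at x)"
    and lip: "\<And>i y. y \<in> ball x \<delta> \<Longrightarrow> \<bar>m i y - m i x\<bar> \<le> S i * norm (y - x)"
    and G: "\<And>y. y \<in> ball x \<delta> \<Longrightarrow> ((\<lambda>i. m i y) has_sum G y) UNIV"
  shows "\<exists>D. (G has_derivative D) (at x)"
proof -
  have Db: "\<bar>D i v\<bar> \<le> S i * norm v" for i v
    by (rule has_derivative_lipschitz_bound[OF D \<delta> lip])
  have Dl: "bounded_linear (D i)" for i using D by (rule has_derivative_bounded_linear)
  obtain T where T: "(S has_sum T) UNIV" using S by (auto simp: summable_on_def)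
  have "(\<lambda>i. D i v) summable_on UNIV" for v
  proof (rule abs_summable_summable, rule Infinite_Sum.abs_summable_on_comparison_test')
    show "(\<lambda>i. S i * norm v) summable_on UNIV" by (rule summable_on_cmult_left[OF S])
  qed (use Db in auto)
  then have Ds: "((\<lambda>i. D i v) has_sum (\<Sum>\<^sub>\<infinity>i. D i v)) UNIV" for v by simp
  define D' where "D' v = (\<Sum>\<^sub>\<infinity>i. D i v)" for v
  have D': "bounded_linear D'"
  proof (rule bounded_linear_intro[of _ T])
    fix v w :: 'a and r :: real
    have "((\<lambda>i. D i (v + w)) has_sum (D' v + D' w)) UNIV"
      using has_sum_add[OF Ds[of v] Ds[of w]] by (simp add: D'_def linear_add[OF bounded_linear.linear[OF Dl]])
    then show "D' (v + w) = D' v + D' w" using has_sum_unique[OF Ds[of "v + w"]] by (simp add: D'_def)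
    have "((\<lambda>i. D i (r *\<^sub>R v)) has_sum (r * D' v)) UNIV"
      using has_sum_cmult_right[OF Ds[of v], of r] by (simp add: D'_def linear_scale[OF bounded_linear.linear[OF Dl]])
    then show "D' (r *\<^sub>R v) = r *\<^sub>R D' v" using has_sum_unique[OF Ds[of "r *\<^sub>R v"]] by (simp add: D'_def)
    show "norm (D' v) \<le> norm v * T"
      using norm_infsum_le[OF Ds[of v] has_sum_cmult_left[OF T, of "norm v"]] Db by (simp add: D'_def mult.commute)
  qed
  have "(G has_derivative D') (at x)"
    unfolding has_derivative_at_alt
  proof (intro conjI D' allI impI)
    fix e :: real assume "e > 0"
    have "(sum S \<longlongrightarrow> T) (finite_subsets_at_top UNIV)" using T by (simp add: has_sum_def)
    then have "\<forall>\<^sub>F A in finite_subsets_at_top UNIV. dist (sum S A) T < e / 4"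
      using \<open>e > 0\<close> by (intro tendstoD) auto
    \<comment> \<open>The tail counts twice, for increments and for derivatives, hence
      \<open>e / 4\<close>; the finite part over \<open>A\<close> takes the other
      \<open>e / 2\<close>.\<close>
    then obtain A where A: "finite A" "\<bar>sum S A - T\<bar> < e / 4"
      unfolding eventually_finite_subsets_at_top by (force simp: dist_real_def)
    have "((\<lambda>y. \<Sum>i\<in>A. m i y) has_derivative (\<lambda>v. \<Sum>i\<in>A. D i v)) (at x)"
      by (intro has_derivative_sum D)
    then obtain d where d: "d > 0" "\<And>y. norm (y - x) < d \<Longrightarrow>
        norm ((\<Sum>i\<in>A. m i y) - (\<Sum>i\<in>A. m i x) - (\<Sum>i\<in>A. D i (y - x))) \<le> e / 2 * norm (y - x)"
      unfolding has_derivative_at_alt using \<open>e > 0\<close> by (meson half_gt_zero)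
    show "\<exists>d>0. \<forall>y. norm (y - x) < d \<longrightarrow> norm (G y - G x - D' (y - x)) \<le> e * norm (y - x)"
    proof (intro exI[of _ "min d \<delta>"] conjI allI impI)
      show "0 < min d \<delta>" using d \<delta> by simp
      fix y assume y: "norm (y - x) < min d \<delta>"
      then have yb: "y \<in> ball x \<delta>" by (simp add: dist_norm norm_minus_commute)
      define n where "n i = m i y - m i x - D i (y - x)" for i
      have "((\<lambda>i. m i y + - m i x + - D i (y - x)) has_sum (G y + - G x + - D' (y - x))) UNIV"
        unfolding D'_def
        by (intro has_sum_add has_sum_uminusI G yb Ds) (use \<delta> in simp)
      then have "(n has_sum (G y - G x - D' (y - x))) UNIV" by (simp add: n_def[abs_def])
      from has_sum_minus_finite[OF this A(1)]
      have 1: "((\<lambda>i. if i \<in> A then 0 else n i) has_sum (G y - G x - D' (y - x) - sum n A)) UNIV" .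
      have 2: "((\<lambda>i. (if i \<in> A then 0 else S i) * (2 * norm (y - x))) has_sum (T - sum S A) * (2 * norm (y - x))) UNIV"
        by (rule has_sum_cmult_left[OF has_sum_minus_finite[OF T A(1)]])
      have "\<bar>n i\<bar> \<le> S i * (2 * norm (y - x))" for i
        using lip[OF yb, of i] Db[of i "y - x"] unfolding n_def by linarith
      then have "norm (G y - G x - D' (y - x) - sum n A) \<le> (T - sum S A) * (2 * norm (y - x))"
        by (intro norm_infsum_le[OF 1 2]) auto
      also have "\<dots> \<le> e / 4 * (2 * norm (y - x))"
      proof (rule mult_right_mono)
        show "T - sum S A \<le> e / 4" using A(2) by linarith
      qed auto
      finally have "\<bar>G y - G x - D' (y - x) - sum n A\<bar> \<le> e / 2 * norm (y - x)" by simp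
      moreover have "\<bar>sum n A\<bar> \<le> e / 2 * norm (y - x)"
        using d(2)[of y] y by (simp add: n_def sum_subtractf)
      ultimately show "norm (G y - G x - D' (y - x)) \<le> e * norm (y - x)"
        unfolding real_norm_def by linarith
    qed
  qed
  then show ?thesis by blast
qed

section \<open>Real monomials on cubes and the higher order terms of \<open>F\<close>\<close>

definition box7 :: "real \<Rightarrow> c3r set" where
  "box7 \<rho> = {(z1, z2, \<zeta>, u). \<bar>Re z1\<bar> \<le> \<rho> \<and> \<bar>Im z1\<bar> \<le> \<rho> \<and> \<bar>Re z2\<bar> \<le> \<rho> \<and> \<bar>Im z2\<bar> \<le> \<rho> \<and>
     \<bar>Re \<zeta>\<bar> \<le> \<rho> \<and> \<bar>Im \<zeta>\<bar> \<le> \<rho> \<and> \<bar>u\<bar> \<le> \<rho>}"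

text \<open>All seven real coordinates equal \<open>\<rho>\<close>; for positive
  \<open>\<rho>\<close> every monomial has its largest absolute value on \<open>box7 \<rho>\<close>
  here.\<close>

definition corner7 :: "real \<Rightarrow> c3r" where
  "corner7 \<rho> = (Complex \<rho> \<rho>, Complex \<rho> \<rho>, Complex \<rho> \<rho>, \<rho>)"

text \<open>The factor \<open>n\<close> lost by differentiating is absorbed by halving the radius,
  as \<open>n \<le> 2 ^ n\<close>. The bound is therefore a fixed multiple of the same power at
  \<open>\<rho>\<close>, which keeps the Lipschitz constants summable.\<close>

lemma abs_power_diff_le:
  fixes x y :: real
  assumes "\<bar>x\<bar> \<le> \<rho> / 2" "\<bar>y\<bar> \<le> \<rho> / 2" "\<rho> > 0"
  shows "\<bar>x ^ n - y ^ n\<bar> \<le> 2 / \<rho> * \<rho> ^ n * \<bar>x - y\<bar>"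
proof -
  have "\<bar>x ^ n - y ^ n\<bar> \<le> real n * (\<rho> / 2) ^ (n - 1) * \<bar>x - y\<bar>"
  proof (induction n)
    case (Suc n)
    have "x ^ Suc n - y ^ Suc n = x * (x ^ n - y ^ n) + (x - y) * y ^ n" by (simp add: algebra_simps)
    then have "\<bar>x ^ Suc n - y ^ Suc n\<bar> \<le> \<bar>x\<bar> * \<bar>x ^ n - y ^ n\<bar> + \<bar>x - y\<bar> * \<bar>y\<bar> ^ n"
      by (metis abs_mult abs_triangle_ineq power_abs)
    also have "\<dots> \<le> \<rho> / 2 * (real n * (\<rho> / 2) ^ (n - 1) * \<bar>x - y\<bar>) + \<bar>x - y\<bar> * (\<rho> / 2) ^ n"
      using assms Suc.IH by (intro add_mono mult_mono power_mono) auto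
    also have "\<dots> = real (Suc n) * (\<rho> / 2) ^ (Suc n - 1) * \<bar>x - y\<bar>"
      by (cases n) (simp_all add: algebra_simps)
    finally show ?case .
  qed simp
  also have "real n * (\<rho> / 2) ^ (n - 1) \<le> 2 / \<rho> * \<rho> ^ n"
  proof (cases n)
    case (Suc k)
    have "real n \<le> 2 ^ n" using less_exp[of n] by (metis less_imp_le of_nat_le_iff of_nat_numeral of_nat_power)
    then have "real n * \<rho> ^ k \<le> 2 ^ n * \<rho> ^ k" using assms by (intro mult_right_mono) auto
    then show ?thesis using assms Suc by (simp add: power_divide field_simps)
  qed (use assms in auto)
  then have "real n * (\<rho> / 2) ^ (n - 1) * \<bar>x - y\<bar> \<le> 2 / \<rho> * \<rho> ^ n * \<bar>x - y\<bar>"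
    by (intro mult_right_mono) auto
  finally show ?thesis .
qed

text \<open>The three conclusions have the form of the three premises \<open>A\<close>, so the lemma
  iterates over the factors of a monomial; each factor raises the Lipschitz constant by
  \<open>2 / \<rho>\<close>.\<close>

lemma lipschitz_times_power:
  fixes A A' x y :: real
  assumes A: "\<bar>A\<bar> \<le> M" "\<bar>A'\<bar> \<le> M" "\<bar>A - A'\<bar> \<le> L * M * d"
    and x: "\<bar>x\<bar> \<le> \<rho> / 2" "\<bar>y\<bar> \<le> \<rho> / 2" "\<bar>x - y\<bar> \<le> d" and \<rho>: "\<rho> > 0"
  shows "\<bar>A * x ^ n\<bar> \<le> M * \<rho> ^ n" "\<bar>A' * y ^ n\<bar> \<le> M * \<rho> ^ n"
    "\<bar>A * x ^ n - A' * y ^ n\<bar> \<le> (L + 2 / \<rho>) * (M * \<rho> ^ n) * d"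
proof -
  have M: "0 \<le> M" using A by linarith
  have xn: "\<bar>x ^ n\<bar> \<le> \<rho> ^ n" "\<bar>y ^ n\<bar> \<le> \<rho> ^ n"
    using x \<rho> by (auto simp: power_abs intro!: power_mono)
  show "\<bar>A * x ^ n\<bar> \<le> M * \<rho> ^ n" "\<bar>A' * y ^ n\<bar> \<le> M * \<rho> ^ n"
    unfolding abs_mult using A M xn by (auto intro!: mult_mono)
  have "A * x ^ n - A' * y ^ n = (A - A') * x ^ n + A' * (x ^ n - y ^ n)" by (simp add: algebra_simps)
  then have "\<bar>A * x ^ n - A' * y ^ n\<bar> \<le> \<bar>A - A'\<bar> * \<bar>x ^ n\<bar> + \<bar>A'\<bar> * \<bar>x ^ n - y ^ n\<bar>"
    by (metis abs_mult abs_triangle_ineq)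
  also have "\<dots> \<le> (L * M * d) * \<rho> ^ n + M * (2 / \<rho> * \<rho> ^ n * d)"
  proof (intro add_mono mult_mono A xn)
    have "\<bar>x ^ n - y ^ n\<bar> \<le> 2 / \<rho> * \<rho> ^ n * \<bar>x - y\<bar>" by (rule abs_power_diff_le[OF x(1,2) \<rho>])
    also have "\<dots> \<le> 2 / \<rho> * \<rho> ^ n * d" using x \<rho> by (intro mult_left_mono) auto
    finally show "\<bar>x ^ n - y ^ n\<bar> \<le> 2 / \<rho> * \<rho> ^ n * d" .
    show "0 \<le> L * M * d" using A(3) by linarith
  qed (use M in auto)
  also have "\<dots> = (L + 2 / \<rho>) * (M * \<rho> ^ n) * d" by (simp add: algebra_simps)
  finally show "\<bar>A * x ^ n - A' * y ^ n\<bar> \<le> (L + 2 / \<rho>) * (M * \<rho> ^ n) * d" .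
qed

lemma mon7_lipschitz:
  assumes q: "q \<in> box7 (\<rho> / 2)" "q' \<in> box7 (\<rho> / 2)" and \<rho>: "\<rho> > 0"
  shows "\<bar>mon7 \<alpha> q\<bar> \<le> mon7 \<alpha> (corner7 \<rho>)"
    "\<bar>mon7 \<alpha> q - mon7 \<alpha> q'\<bar> \<le> 14 / \<rho> * mon7 \<alpha> (corner7 \<rho>) * norm (q - q')"
proof -
  obtain z1 z2 \<zeta> u where qe: "q = (z1, z2, \<zeta>, u)" by (cases q)
  obtain z1' z2' \<zeta>' u' where qe': "q' = (z1', z2', \<zeta>', u')" by (cases q')
  obtain a0 a1 a2 a3 a4 a5 a6 where \<alpha>: "\<alpha> = (a0, a1, a2, a3, a4, a5, a6)" by (cases \<alpha>)
  define d where "d = norm (q - q')"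
  have n: "norm (z1 - z1') \<le> d" "norm (z2 - z2') \<le> d" "norm (\<zeta> - \<zeta>') \<le> d" "\<bar>u - u'\<bar> \<le> d"
    unfolding d_def qe qe'
    using norm_fst_le[of "z1 - z1'" "(z2 - z2', \<zeta> - \<zeta>', u - u')"] norm_snd_le[of "(z2 - z2', \<zeta> - \<zeta>', u - u')" "z1 - z1'"]
      norm_fst_le[of "z2 - z2'" "(\<zeta> - \<zeta>', u - u')"] norm_snd_le[of "(\<zeta> - \<zeta>', u - u')" "z2 - z2'"]
      norm_fst_le[of "\<zeta> - \<zeta>'" "u - u'"] norm_snd_le[of "u - u'" "\<zeta> - \<zeta>'"] by auto
  have c: "\<bar>Re z1 - Re z1'\<bar> \<le> d" "\<bar>Im z1 - Im z1'\<bar> \<le> d" "\<bar>Re z2 - Re z2'\<bar> \<le> d" "\<bar>Im z2 - Im z2'\<bar> \<le> d"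
    "\<bar>Re \<zeta> - Re \<zeta>'\<bar> \<le> d" "\<bar>Im \<zeta> - Im \<zeta>'\<bar> \<le> d"
    using n abs_Re_le_cmod[of "z1 - z1'"] abs_Im_le_cmod[of "z1 - z1'"] abs_Re_le_cmod[of "z2 - z2'"]
      abs_Im_le_cmod[of "z2 - z2'"] abs_Re_le_cmod[of "\<zeta> - \<zeta>'"] abs_Im_le_cmod[of "\<zeta> - \<zeta>'"] by auto
  have b: "\<bar>Re z1\<bar> \<le> \<rho> / 2" "\<bar>Im z1\<bar> \<le> \<rho> / 2" "\<bar>Re z2\<bar> \<le> \<rho> / 2" "\<bar>Im z2\<bar> \<le> \<rho> / 2"
    "\<bar>Re \<zeta>\<bar> \<le> \<rho> / 2" "\<bar>Im \<zeta>\<bar> \<le> \<rho> / 2" "\<bar>u\<bar> \<le> \<rho> / 2"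
    and b': "\<bar>Re z1'\<bar> \<le> \<rho> / 2" "\<bar>Im z1'\<bar> \<le> \<rho> / 2" "\<bar>Re z2'\<bar> \<le> \<rho> / 2" "\<bar>Im z2'\<bar> \<le> \<rho> / 2"
    "\<bar>Re \<zeta>'\<bar> \<le> \<rho> / 2" "\<bar>Im \<zeta>'\<bar> \<le> \<rho> / 2" "\<bar>u'\<bar> \<le> \<rho> / 2"
    using q by (auto simp: box7_def qe qe')
  \<comment> \<open>The empty product has Lipschitz constant 0; seven factors lead to
    \<open>14 / \<rho>\<close>.\<close>
  have s0: "\<bar>1::real\<bar> \<le> 1" "\<bar>1::real\<bar> \<le> 1" "\<bar>1 - 1 :: real\<bar> \<le> 0 * 1 * d" by auto
  note s1 = lipschitz_times_power[OF s0 b(1) b'(1) c(1) \<rho>, of a0]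
  note s2 = lipschitz_times_power[OF s1 b(2) b'(2) c(2) \<rho>, of a1]
  note s3 = lipschitz_times_power[OF s2 b(3) b'(3) c(3) \<rho>, of a2]
  note s4 = lipschitz_times_power[OF s3 b(4) b'(4) c(4) \<rho>, of a3]
  note s5 = lipschitz_times_power[OF s4 b(5) b'(5) c(5) \<rho>, of a4]
  note s6 = lipschitz_times_power[OF s5 b(6) b'(6) c(6) \<rho>, of a5]
  note s7 = lipschitz_times_power[OF s6 b(7) b'(7) n(4) \<rho>, of a6]
  show "\<bar>mon7 \<alpha> q\<bar> \<le> mon7 \<alpha> (corner7 \<rho>)"
    using s7(1) by (simp add: mon7_def \<alpha> qe corner7_def)
  show "\<bar>mon7 \<alpha> q - mon7 \<alpha> q'\<bar> \<le> 14 / \<rho> * mon7 \<alpha> (corner7 \<rho>) * norm (q - q')"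
    unfolding d_def[symmetric] using s7(3) by (simp add: mon7_def \<alpha> qe qe' corner7_def)
qed

definition dil7 :: "real \<Rightarrow> c3r \<Rightarrow> c3r" where
  "dil7 t = (\<lambda>(z1, z2, \<zeta>, u). (of_real (t ^ 2) * z1, of_real t * z2, of_real t * \<zeta>, t ^ 3 * u))"

lemma mon7_dil7: "mon7 \<alpha> (dil7 t q) = t ^ weight7 \<alpha> * mon7 \<alpha> q"
  by (cases \<alpha>; cases q)
    (simp add: mon7_def dil7_def weight7_def power_mult_distrib power_add mult_ac flip: power_mult of_real_power)

lemma bounded_linear_dil7: "bounded_linear (dil7 t)"
  unfolding dil7_def split_def by (intro bounded_linear_intros)

lemma dil7_box7:
  assumes "q \<in> box7 \<rho>" "0 \<le> t" "t \<le> 1"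
  shows "dil7 t q \<in> box7 \<rho>"
proof -
  have "\<bar>t ^ n * x\<bar> \<le> \<rho>" if "\<bar>x\<bar> \<le> \<rho>" for n x
    using mult_mono[of "t ^ n" 1 "\<bar>x\<bar>" \<rho>] power_le_one[of t n] assms that by (simp add: abs_mult)
  from this[where n = 1] this[where n = 2] this[where n = 3] show ?thesis
    using assms by (cases q) (auto simp: box7_def dil7_def simp flip: of_real_power)
qed

lemma norm_c3r_le: "norm ((z1, z2, \<zeta>, u) :: c3r) \<le> norm z1 + norm z2 + norm \<zeta> + \<bar>u\<bar>"
  using norm_Pair_le[of z1 "(z2, \<zeta>, u)"] norm_Pair_le[of z2 "(\<zeta>, u)"] norm_Pair_le[of \<zeta> u] by simp

lemma norm_box7: "norm q \<le> 7 * \<rho>" if "q \<in> box7 \<rho>"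
proof -
  obtain z1 z2 \<zeta> u where q: "q = (z1, z2, \<zeta>, u)" by (cases q)
  show ?thesis using that norm_c3r_le[of z1 z2 \<zeta> u] cmod_le[of z1] cmod_le[of z2] cmod_le[of \<zeta>]
    unfolding q box7_def by auto
qed

lemma ball_box7:
  assumes "q \<in> box7 \<rho>" "y \<in> ball q \<delta>"
  shows "y \<in> box7 (\<rho> + \<delta>)"
proof -
  obtain z1 z2 \<zeta> u where q: "q = (z1, z2, \<zeta>, u)" by (cases q)
  obtain z1' z2' \<zeta>' u' where y: "y = (z1', z2', \<zeta>', u')" by (cases y)
  have d: "norm (y - q) < \<delta>" using assms(2) by (simp add: dist_norm norm_minus_commute)
  have n: "norm (z1' - z1) < \<delta>" "norm (z2' - z2) < \<delta>" "norm (\<zeta>' - \<zeta>) < \<delta>" "\<bar>u' - u\<bar> < \<delta>"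
    using d unfolding q y
    using norm_fst_le[of "z1' - z1" "(z2' - z2, \<zeta>' - \<zeta>, u' - u)"] norm_snd_le[of "(z2' - z2, \<zeta>' - \<zeta>, u' - u)" "z1' - z1"]
      norm_fst_le[of "z2' - z2" "(\<zeta>' - \<zeta>, u' - u)"] norm_snd_le[of "(\<zeta>' - \<zeta>, u' - u)" "z2' - z2"]
      norm_fst_le[of "\<zeta>' - \<zeta>" "u' - u"] norm_snd_le[of "u' - u" "\<zeta>' - \<zeta>"] by auto
  have c: "\<bar>Re z1' - Re z1\<bar> < \<delta>" "\<bar>Im z1' - Im z1\<bar> < \<delta>" "\<bar>Re z2' - Re z2\<bar> < \<delta>" "\<bar>Im z2' - Im z2\<bar> < \<delta>"
    "\<bar>Re \<zeta>' - Re \<zeta>\<bar> < \<delta>" "\<bar>Im \<zeta>' - Im \<zeta>\<bar> < \<delta>"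
    using n abs_Re_le_cmod[of "z1' - z1"] abs_Im_le_cmod[of "z1' - z1"] abs_Re_le_cmod[of "z2' - z2"]
      abs_Im_le_cmod[of "z2' - z2"] abs_Re_le_cmod[of "\<zeta>' - \<zeta>"] abs_Im_le_cmod[of "\<zeta>' - \<zeta>"] by auto
  have "\<bar>b\<bar> \<le> \<rho> + \<delta>" if "\<bar>a\<bar> \<le> \<rho>" "\<bar>b - a\<bar> < \<delta>" for a b :: real using that by linarith
  then show ?thesis using assms(1) c n(4) unfolding q y box7_def by auto
qed

lemma box7_mono: "q \<in> box7 a \<Longrightarrow> a \<le> b \<Longrightarrow> q \<in> box7 b"
  by (cases q) (auto simp: box7_def)

lemma mon7_differentiable: "mon7 \<alpha> differentiable (at x)"
proof -
  obtain a0 a1 a2 a3 a4 a5 a6 where \<alpha>: "\<alpha> = (a0, a1, a2, a3, a4, a5, a6)" by (cases \<alpha>)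
  have m: "mon7 \<alpha> = (\<lambda>q. Re (fst q) ^ a0 * Im (fst q) ^ a1 * Re (fst (snd q)) ^ a2 * Im (fst (snd q)) ^ a3
      * Re (fst (snd (snd q))) ^ a4 * Im (fst (snd (snd q))) ^ a5 * snd (snd (snd q)) ^ a6)"
    by (auto simp: mon7_def \<alpha>)
  show ?thesis unfolding m
    by (intro differentiable_mult differentiable_power bounded_linear_imp_differentiable bounded_linear_intros
        bounded_linear_Re[THEN bounded_linear_compose] bounded_linear_Im[THEN bounded_linear_compose])
qed

text \<open>All exponents have weight at least 4, so dilation puts a factor \<open>t ^ 4\<close>
  before every term of the series. The second estimate concerns the derivative of the dilated
  function, hence the argument \<open>dil7 t v\<close> of \<open>D\<close>.\<close>

lemma Gamma0_estimates:
  assumes "Gamma0_form F"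
  obtains \<rho> C where "\<rho> > 0"
    "\<And>q t. \<lbrakk>q \<in> box7 \<rho>; 0 < t; t \<le> 1\<rbrakk> \<Longrightarrow> \<bar>F (dil7 t q) - Qmodel (dil7 t q)\<bar> \<le> C * t ^ 4"
    "\<And>q t. \<lbrakk>q \<in> box7 \<rho>; 0 < t; t \<le> 1\<rbrakk> \<Longrightarrow> \<exists>D. ((\<lambda>q. F q - Qmodel q) has_derivative D) (at (dil7 t q)) \<and>
       (\<forall>v. \<bar>D (dil7 t v)\<bar> \<le> C * t ^ 4 * norm v)"
proof -
  define G where "G q = F q - Qmodel q" for q
  obtain r c where r: "r > 0" and c0: "\<And>\<alpha>. weight7 \<alpha> < 4 \<Longrightarrow> c \<alpha> = 0"
    and G0: "\<And>q. q \<in> ball 0 r \<Longrightarrow> ((\<lambda>\<alpha>. c \<alpha> * mon7 \<alpha> q) has_sum G q) UNIV"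
    using assms unfolding Gamma0_form_def G_def by blast
  \<comment> \<open>By \<open>norm_box7\<close> the cube lies in the ball of radius
    \<open>r\<close>, since \<open>7 * \<rho> < r\<close>.\<close>
  define \<rho> where "\<rho> = r / 8"
  have \<rho>: "\<rho> > 0" using r by (simp add: \<rho>_def)
  have G: "((\<lambda>\<alpha>. c \<alpha> * mon7 \<alpha> q) has_sum G q) UNIV" if "q \<in> box7 \<rho>" for q
    by (rule G0) (use norm_box7[OF that] r in \<open>simp add: \<rho>_def\<close>)
  have cb: "corner7 \<rho> \<in> box7 \<rho>" using \<rho> by (simp add: corner7_def box7_def)
  have mc: "0 \<le> mon7 \<alpha> (corner7 \<rho>)" for \<alpha> using \<rho> by (cases \<alpha>) (simp add: mon7_def corner7_def)
  define S where "S \<alpha> = \<bar>c \<alpha>\<bar> * mon7 \<alpha> (corner7 \<rho>)" for \<alpha>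
  have "(\<lambda>\<alpha>. norm (c \<alpha> * mon7 \<alpha> (corner7 \<rho>))) summable_on UNIV"
    by (intro summable_on_iff_abs_summable_on_real[THEN iffD1] has_sum_imp_summable[OF G[OF cb]])
  then have S: "S summable_on UNIV" by (simp add: S_def[abs_def] abs_mult mc)
  then obtain T where T: "(S has_sum T) UNIV" by (auto simp: summable_on_def)
  have S0: "0 \<le> S \<alpha>" for \<alpha> by (simp add: S_def mc)
  have T0: "0 \<le> T" using T S0 by (rule has_sum_nonneg)
  define L where "L = 14 / \<rho>"
  have L: "L > 0" using \<rho> by (simp add: L_def)
  have half: "q \<in> box7 (\<rho> / 2)" "q \<in> box7 \<rho>" "y \<in> ball q (\<rho> / 4) \<Longrightarrow> y \<in> box7 (\<rho> / 2)" if "q \<in> box7 (\<rho> / 4)" for q y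
  proof -
    show "q \<in> box7 (\<rho> / 2)" "q \<in> box7 \<rho>" using \<rho> by (auto intro: box7_mono[OF that])
    show "y \<in> box7 (\<rho> / 2)" if "y \<in> ball q (\<rho> / 4)"
      using ball_box7[OF \<open>q \<in> box7 (\<rho> / 4)\<close> that] by simp
  qed
  have lip: "\<bar>c \<alpha> * mon7 \<alpha> y - c \<alpha> * mon7 \<alpha> q\<bar> \<le> S \<alpha> * L * norm (y - q)"
    if "q \<in> box7 (\<rho> / 2)" "y \<in> box7 (\<rho> / 2)" for q y \<alpha>
  proof -
    have "\<bar>c \<alpha> * mon7 \<alpha> y - c \<alpha> * mon7 \<alpha> q\<bar> = \<bar>c \<alpha>\<bar> * \<bar>mon7 \<alpha> y - mon7 \<alpha> q\<bar>"
      by (simp add: abs_mult flip: right_diff_distrib)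
    also have "\<dots> \<le> \<bar>c \<alpha>\<bar> * (14 / \<rho> * mon7 \<alpha> (corner7 \<rho>) * norm (y - q))"
      by (intro mult_left_mono mon7_lipschitz that \<rho>) auto
    finally show ?thesis by (simp add: S_def L_def mult_ac)
  qed
  have tw: "t ^ weight7 \<alpha> * \<bar>x\<bar> \<le> t ^ 4 * \<bar>x\<bar>" if "0 < t" "t \<le> 1" "c \<alpha> = 0 \<longrightarrow> x = 0" for t x :: real and \<alpha>
  proof (cases "weight7 \<alpha> < 4")
    case False
    then show ?thesis using that by (intro mult_right_mono power_decreasing) auto
  qed (use that c0 in auto)
  have half2: "q \<in> box7 \<rho>" if "q \<in> box7 (\<rho> / 2)" for q using \<rho> by (auto intro: box7_mono[OF that])
  define C where "C = T * (1 + L)"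
  show thesis
  proof (rule that[of "\<rho> / 4" C])
    show "\<rho> / 4 > 0" using \<rho> by simp
    fix q and t :: real assume q: "q \<in> box7 (\<rho> / 4)" and t: "0 < t" "t \<le> 1"
    have "((\<lambda>\<alpha>. c \<alpha> * mon7 \<alpha> (dil7 t q)) has_sum G (dil7 t q)) UNIV"
      by (intro G dil7_box7 half(2) q) (use t in auto)
    then have "norm (G (dil7 t q)) \<le> T * t ^ 4"
    proof (rule norm_infsum_le[OF _ has_sum_cmult_left[OF T]])
      fix \<alpha>
      have "norm (c \<alpha> * mon7 \<alpha> (dil7 t q)) = t ^ weight7 \<alpha> * \<bar>c \<alpha> * mon7 \<alpha> q\<bar>"
        using t by (simp add: mon7_dil7 abs_mult)
      also have "\<dots> \<le> t ^ 4 * \<bar>c \<alpha> * mon7 \<alpha> q\<bar>" by (intro tw t) simp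
      also have "\<dots> \<le> t ^ 4 * S \<alpha>"
        unfolding S_def abs_mult using t by (intro mult_left_mono mon7_lipschitz(1)[OF half(1)[OF q] half(1)[OF q] \<rho>]) auto
      finally show "norm (c \<alpha> * mon7 \<alpha> (dil7 t q)) \<le> S \<alpha> * t ^ 4" by (simp add: mult.commute)
    qed
    also have "\<dots> \<le> C * t ^ 4" unfolding C_def using t T0 L by (intro mult_right_mono) (auto simp: algebra_simps)
    finally show "\<bar>F (dil7 t q) - Qmodel (dil7 t q)\<bar> \<le> C * t ^ 4" by (simp add: G_def)
    have dq: "dil7 t q \<in> box7 (\<rho> / 4)" by (intro dil7_box7 q) (use t in auto)
    obtain D where D: "(G has_derivative D) (at (dil7 t q))"
    proof (atomize_elim, rule differentiable_has_sum_lipschitz[of "\<rho> / 4" "\<lambda>\<alpha>. S \<alpha> * L" "\<lambda>\<alpha> y. c \<alpha> * mon7 \<alpha> y"])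
      show "\<rho> / 4 > 0" using \<rho> by simp
      show "(\<lambda>\<alpha>. S \<alpha> * L) summable_on UNIV" by (rule summable_on_cmult_left[OF S])
      show "((\<lambda>y. c \<alpha> * mon7 \<alpha> y) has_derivative (\<lambda>v. c \<alpha> * frechet_derivative (mon7 \<alpha>) (at (dil7 t q)) v)) (at (dil7 t q))" for \<alpha>
        by (intro has_derivative_mult_right frechet_derivative_works[THEN iffD1] mon7_differentiable)
    next
      fix \<alpha> y assume y: "y \<in> ball (dil7 t q) (\<rho> / 4)"
      show "\<bar>c \<alpha> * mon7 \<alpha> y - c \<alpha> * mon7 \<alpha> (dil7 t q)\<bar> \<le> S \<alpha> * L * norm (y - dil7 t q)"
        by (rule lip[OF half(1)[OF dq] half(3)[OF dq y]])
      show "((\<lambda>\<alpha>. c \<alpha> * mon7 \<alpha> y) has_sum G y) UNIV" using y half(3)[OF dq] half2 G by blast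
    qed
    have comp: "((\<lambda>y. G (dil7 t y)) has_derivative (\<lambda>v. D (dil7 t v))) (at q)"
      by (rule has_derivative_compose[OF bounded_linear_imp_has_derivative[OF bounded_linear_dil7] D])
    \<comment> \<open>\<open>D\<close> is never computed: by the chain rule
      \<open>D (dil7 t v)\<close> is the derivative of the dilated function, whose increments from
      \<open>q\<close> are bounded by \<open>C * t ^ 4\<close> times the distance.\<close>
    have "\<bar>D (dil7 t v)\<bar> \<le> C * t ^ 4 * norm v" for v
    proof (rule has_derivative_lipschitz_bound[OF comp])
      show "\<rho> / 4 > 0" using \<rho> by simp
      fix y assume y: "y \<in> ball q (\<rho> / 4)"
      then have yb: "y \<in> box7 (\<rho> / 2)" by (rule half(3)[OF q])
      have "((\<lambda>\<alpha>. c \<alpha> * mon7 \<alpha> (dil7 t y) + - (c \<alpha> * mon7 \<alpha> (dil7 t q))) has_sum (G (dil7 t y) + - G (dil7 t q))) UNIV"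
        by (intro has_sum_add has_sum_uminusI G dil7_box7 half2 yb half(1) q) (use t in auto)
      then have "norm (G (dil7 t y) + - G (dil7 t q)) \<le> T * (L * t ^ 4 * norm (y - q))"
      proof (rule norm_infsum_le[OF _ has_sum_cmult_left[OF T]])
        fix \<alpha>
        have "norm (c \<alpha> * mon7 \<alpha> (dil7 t y) + - (c \<alpha> * mon7 \<alpha> (dil7 t q)))
           = t ^ weight7 \<alpha> * \<bar>c \<alpha> * mon7 \<alpha> y - c \<alpha> * mon7 \<alpha> q\<bar>"
        proof -
          have "c \<alpha> * mon7 \<alpha> (dil7 t y) + - (c \<alpha> * mon7 \<alpha> (dil7 t q))
             = t ^ weight7 \<alpha> * (c \<alpha> * mon7 \<alpha> y - c \<alpha> * mon7 \<alpha> q)"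
            by (simp add: mon7_dil7 algebra_simps)
          then show ?thesis using t by (simp add: abs_mult)
        qed
        also have "\<dots> \<le> t ^ 4 * \<bar>c \<alpha> * mon7 \<alpha> y - c \<alpha> * mon7 \<alpha> q\<bar>" by (intro tw t) simp
        also have "\<dots> \<le> t ^ 4 * (S \<alpha> * L * norm (y - q))"
          using t by (intro mult_left_mono lip half(1) q yb) auto
        finally show "norm (c \<alpha> * mon7 \<alpha> (dil7 t y) + - (c \<alpha> * mon7 \<alpha> (dil7 t q))) \<le> S \<alpha> * (L * t ^ 4 * norm (y - q))"
          by (simp add: mult_ac)
      qed
      also have "\<dots> = (T * L) * t ^ 4 * norm (y - q)" by simp
      also have "\<dots> \<le> C * t ^ 4 * norm (y - q)"
        unfolding C_def using t T0 L by (intro mult_right_mono) (auto simp: algebra_simps)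
      finally show "\<bar>G (dil7 t y) - G (dil7 t q)\<bar> \<le> C * t ^ 4 * norm (y - q)" by simp
    qed
    then show "\<exists>D. ((\<lambda>q. F q - Qmodel q) has_derivative D) (at (dil7 t q)) \<and> (\<forall>v. \<bar>D (dil7 t v)\<bar> \<le> C * t ^ 4 * norm v)"
      using D unfolding G_def by blast
  qed
qed


section \<open>Derivative of the defining function\<close>

lemma Qmodel_has_derivative:
  "(Qmodel has_derivative (\<lambda>(v1, v2, v3, v4). 2 * Re (v1 * cnj \<zeta> + z1 * cnj v3 + v2 * cnj \<zeta> ^ 2 + 2 * z2 * cnj \<zeta> * cnj v3)))
     (at (z1, z2, \<zeta>, u))"
proof -
  have Q: "Qmodel = (\<lambda>q. 2 * Re (fst q * cnj (fst (snd (snd q))) + fst (snd q) * cnj (fst (snd (snd q))) ^ 2))"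
    by (auto simp: Qmodel_def)
  show ?thesis unfolding Q
    by (rule derivative_eq_intros refl | simp)+ (auto simp: algebra_simps)
qed

lemma hyp_rho_has_derivative:
  assumes "((\<lambda>q. F q - Qmodel q) has_derivative DG) (at (z1, z2, \<zeta>, Re w))"
  shows "(hyp_rho F has_derivative (\<lambda>(v1, v2, v3, v4). Im v4 -
     (2 * Re (v1 * cnj \<zeta> + z1 * cnj v3 + v2 * cnj \<zeta> ^ 2 + 2 * z2 * cnj \<zeta> * cnj v3) + DG (v1, v2, v3, Re v4)))) (at (z1, z2, \<zeta>, w))"
proof -
  define \<pi> :: "c4 \<Rightarrow> c3r" where "\<pi> = (\<lambda>p. (fst p, fst (snd p), fst (snd (snd p)), Re (snd (snd (snd p)))))"
  have "bounded_linear \<pi>" unfolding \<pi>_def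
    by (intro bounded_linear_intros bounded_linear_Re[THEN bounded_linear_compose])
  then have \<pi>: "(\<pi> has_derivative \<pi>) (at (z1, z2, \<zeta>, w))" by (rule bounded_linear_imp_has_derivative)
  have \<pi>0: "\<pi> (z1, z2, \<zeta>, w) = (z1, z2, \<zeta>, Re w)" by (simp add: \<pi>_def)
  have "(F has_derivative (\<lambda>v. (case v of (v1, v2, v3, v4) \<Rightarrow> 2 * Re (v1 * cnj \<zeta> + z1 * cnj v3 + v2 * cnj \<zeta> ^ 2 + 2 * z2 * cnj \<zeta> * cnj v3)) + DG v))
     (at (z1, z2, \<zeta>, Re w))"
    using has_derivative_add[OF Qmodel_has_derivative assms] by simp
  from has_derivative_compose[OF \<pi> this[folded \<pi>0]]
  have "((\<lambda>p. F (\<pi> p)) has_derivative (\<lambda>v. (case \<pi> v of (v1, v2, v3, v4) \<Rightarrow> 2 * Re (v1 * cnj \<zeta> + z1 * cnj v3 + v2 * cnj \<zeta> ^ 2 + 2 * z2 * cnj \<zeta> * cnj v3)) + DG (\<pi> v)))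
     (at (z1, z2, \<zeta>, w))" .
  moreover have "((\<lambda>p :: c4. Im (snd (snd (snd p)))) has_derivative (\<lambda>v. Im (snd (snd (snd v))))) (at (z1, z2, \<zeta>, w))"
    by (intro bounded_linear_imp_has_derivative bounded_linear_intros bounded_linear_Im[THEN bounded_linear_compose])
  ultimately have "((\<lambda>p. Im (snd (snd (snd p))) - F (\<pi> p)) has_derivative
      (\<lambda>v. Im (snd (snd (snd v))) - ((case \<pi> v of (v1, v2, v3, v4) \<Rightarrow> 2 * Re (v1 * cnj \<zeta> + z1 * cnj v3 + v2 * cnj \<zeta> ^ 2 + 2 * z2 * cnj \<zeta> * cnj v3)) + DG (\<pi> v))))
     (at (z1, z2, \<zeta>, w))" by (intro has_derivative_diff)
  moreover have "(\<lambda>p. Im (snd (snd (snd p))) - F (\<pi> p)) = hyp_rho F" by (auto simp: hyp_rho_def \<pi>_def)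
  ultimately show ?thesis by (simp add: \<pi>_def split_def)
qed

section \<open>Leading parts of infinitesimal automorphisms\<close>

lemma power_series_on_component:
  assumes "power_series_on \<rho> a X" "bounded_linear \<pi>" "\<And>c v. \<pi> (cmul4 c v) = c * \<pi> v" "p \<in> polydisc \<rho>"
  shows "((\<lambda>\<alpha>. \<pi> (a \<alpha>) * mon4 \<alpha> p) has_sum \<pi> (X p)) UNIV"
proof -
  have "((\<lambda>\<alpha>. \<pi> (cmul4 (mon4 \<alpha> p) (a \<alpha>))) has_sum \<pi> (X p)) UNIV"
    using assms(1,4) unfolding power_series_on_def by (intro has_sum_bounded_linear[OF assms(2)]) blast
  then show ?thesis by (simp add: assms(3) mult.commute)
qed

lemma power_series_on_components:
  assumes "power_series_on \<rho> a X" "p \<in> polydisc \<rho>"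
  shows "((\<lambda>\<alpha>. coef1 a \<alpha> * mon4 \<alpha> p) has_sum fst (X p)) UNIV"
    "((\<lambda>\<alpha>. coef2 a \<alpha> * mon4 \<alpha> p) has_sum fst (snd (X p))) UNIV"
    "((\<lambda>\<alpha>. coef3 a \<alpha> * mon4 \<alpha> p) has_sum fst (snd (snd (X p)))) UNIV"
    "((\<lambda>\<alpha>. coef4 a \<alpha> * mon4 \<alpha> p) has_sum snd (snd (snd (X p)))) UNIV"
proof -
  have b: "bounded_linear (fst :: c4 \<Rightarrow> _)" "bounded_linear (\<lambda>p :: c4. fst (snd p))"
    "bounded_linear (\<lambda>p :: c4. fst (snd (snd p)))" "bounded_linear (\<lambda>p :: c4. snd (snd (snd p)))"
    by (intro bounded_linear_intros)+
  show "((\<lambda>\<alpha>. coef1 a \<alpha> * mon4 \<alpha> p) has_sum fst (X p)) UNIV"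
    by (rule power_series_on_component[OF assms(1) b(1) _ assms(2)]) (simp add: cmul4_def split_def)
  show "((\<lambda>\<alpha>. coef2 a \<alpha> * mon4 \<alpha> p) has_sum fst (snd (X p))) UNIV"
    by (rule power_series_on_component[OF assms(1) b(2) _ assms(2)]) (simp add: cmul4_def split_def)
  show "((\<lambda>\<alpha>. coef3 a \<alpha> * mon4 \<alpha> p) has_sum fst (snd (snd (X p)))) UNIV"
    by (rule power_series_on_component[OF assms(1) b(3) _ assms(2)]) (simp add: cmul4_def split_def)
  show "((\<lambda>\<alpha>. coef4 a \<alpha> * mon4 \<alpha> p) has_sum snd (snd (snd (X p)))) UNIV"
    by (rule power_series_on_component[OF assms(1) b(4) _ assms(2)]) (simp add: cmul4_def split_def)
qed

text \<open>The last coordinate moves with \<open>t\<close> because the point has to lie on the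
  dilated hypersurface, whose height over a fixed base point only tends to that of
  \<open>Q\<close>.\<close>

lemma wpart_limit:
  fixes f :: "c4 \<Rightarrow> complex"
  assumes \<rho>: "\<rho> > 0" and f: "\<And>p. p \<in> polydisc \<rho> \<Longrightarrow> ((\<lambda>\<alpha>. a \<alpha> * mon4 \<alpha> p) has_sum f p) UNIV"
    and low: "\<And>k q. k < K \<Longrightarrow> wpart \<sigma> a k q = 0"
    and w: "(w \<longlongrightarrow> w0) (at_right (0::real))" "\<forall>\<^sub>F t in at_right 0. (z1, z2, \<zeta>, w t) \<in> polydisc \<rho>"
  shows "((\<lambda>t. of_real (t ^ \<sigma> / t ^ K) * f (dil4 t (z1, z2, \<zeta>, w t))) \<longlongrightarrow> wpart \<sigma> a K (z1, z2, \<zeta>, w0)) (at_right 0)"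
proof -
  obtain C where C: "\<And>p t. \<lbrakk>p \<in> polydisc \<rho>; 0 < t; t \<le> 1\<rbrakk> \<Longrightarrow>
     norm (of_real (t ^ \<sigma>) * f (dil4 t p) - of_real (t ^ K) * wpart \<sigma> a K p) \<le> C * t ^ Suc K"
    using wpart_asymptotics[OF \<rho> f, of \<sigma>] low by metis
  have "isCont (\<lambda>w. wpart \<sigma> a K (z1, z2, \<zeta>, w)) w0"
    by (rule field_differentiable_imp_continuous_at, rule holomorphic_on_imp_differentiable_at[of _ UNIV])
      (auto intro!: holomorphic_intros)
  from isCont_tendsto_compose[OF this w(1)]
  have lim: "((\<lambda>t. wpart \<sigma> a K (z1, z2, \<zeta>, w t)) \<longlongrightarrow> wpart \<sigma> a K (z1, z2, \<zeta>, w0)) (at_right 0)" .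
  have "((\<lambda>t. of_real (t ^ \<sigma> / t ^ K) * f (dil4 t (z1, z2, \<zeta>, w t)) - wpart \<sigma> a K (z1, z2, \<zeta>, w t)) \<longlongrightarrow> 0) (at_right 0)"
  proof (rule Lim_null_comparison)
    show "((\<lambda>t. C * t) \<longlongrightarrow> 0) (at_right 0)" by (auto intro!: tendsto_eq_intros)
    have "\<forall>\<^sub>F t in at_right (0::real). 0 < t \<and> t \<le> 1"
      by (subst eventually_at_right[of 0 1]) (auto intro!: exI[of _ 1])
    with w(2) show "\<forall>\<^sub>F t in at_right 0. norm (of_real (t ^ \<sigma> / t ^ K) * f (dil4 t (z1, z2, \<zeta>, w t)) - wpart \<sigma> a K (z1, z2, \<zeta>, w t)) \<le> C * t"
    proof eventually_elim
      case (elim t)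
      let ?p = "(z1, z2, \<zeta>, w t)"
      have "of_real (t ^ \<sigma> / t ^ K) * f (dil4 t ?p) - wpart \<sigma> a K ?p
          = (of_real (t ^ \<sigma>) * f (dil4 t ?p) - of_real (t ^ K) * wpart \<sigma> a K ?p) / of_real (t ^ K)"
        using elim by (simp add: diff_divide_distrib)
      then have "norm (of_real (t ^ \<sigma> / t ^ K) * f (dil4 t ?p) - wpart \<sigma> a K ?p)
          = norm (of_real (t ^ \<sigma>) * f (dil4 t ?p) - of_real (t ^ K) * wpart \<sigma> a K ?p) / t ^ K"
        using elim by (simp only: norm_divide norm_of_real) simp
      also have "\<dots> \<le> C * t ^ Suc K / t ^ K"
        using C[of ?p t] elim by (intro divide_right_mono) auto
      also have "\<dots> = C * t" using elim by simp
      finally show ?case .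
    qed
  qed
  from tendsto_add[OF this lim] show ?thesis by simp
qed

lemma Qmodel_dil7: "Qmodel (dil7 t q) = t ^ 3 * Qmodel q"
proof -
  obtain z1 z2 \<zeta> u where q: "q = (z1, z2, \<zeta>, u)" by (cases q)
  have "of_real (t ^ 2) * z1 * cnj (of_real t * \<zeta>) + of_real t * z2 * cnj (of_real t * \<zeta>) ^ 2
      = of_real (t ^ 3) * (z1 * cnj \<zeta> + z2 * cnj \<zeta> ^ 2)"
    by (simp add: algebra_simps power2_eq_square power3_eq_cube)
  then show ?thesis unfolding Qmodel_def dil7_def q split
    by (simp only: times_complex.sel Re_complex_of_real Im_complex_of_real) simp
qed

text \<open>The vector \<open>x\<close> is a tangent vector at a point \<open>t\<close>-dilated from \<open>(z1, z2, \<zeta>)\<close>; after rescaling, the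
  linearized equation of \<open>F\<close> differs from that of \<open>Q\<close> by a term of relative size \<open>t\<close>.\<close>

lemma rescaled_tangency:
  assumes t: "0 < t" "t \<le> 1"
    and D: "\<And>v. \<bar>DG (dil7 t v)\<bar> \<le> C * t ^ 4 * norm v" and C: "C \<ge> 0"
    and eq: "Im x4 - (2 * Re (x1 * cnj (of_real t * \<zeta>) + of_real (t ^ 2) * z1 * cnj x3 + x2 * cnj (of_real t * \<zeta>) ^ 2
        + 2 * (of_real t * z2) * cnj (of_real t * \<zeta>) * cnj x3) + DG (x1, x2, x3, Re x4)) = 0"
    and y: "y1 = of_real (t ^ 1 / t ^ K) * x1" "y2 = of_real (t ^ 2 / t ^ K) * x2"
      "y3 = of_real (t ^ 2 / t ^ K) * x3" "y4 = of_real (t ^ 0 / t ^ K) * x4"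
  shows "\<bar>Im y4 - 2 * Re (y1 * cnj \<zeta> + y2 * cnj \<zeta> ^ 2 + y3 * (cnj z1 + 2 * cnj z2 * \<zeta>))\<bar>
     \<le> C * t * (norm y1 + norm y2 + norm y3 + norm y4)"
proof -
  define s where "s = 1 / t ^ K"
  have s: "s > 0" using t by (simp add: s_def)
  have y': "y1 = of_real (s * t) * x1" "y2 = of_real (s * t ^ 2) * x2" "y3 = of_real (s * t ^ 2) * x3" "y4 = of_real s * x4"
    using y by (simp_all add: s_def)
  define A where "A = Re (x1 * cnj (of_real t * \<zeta>) + of_real (t ^ 2) * z1 * cnj x3 + x2 * cnj (of_real t * \<zeta>) ^ 2
        + 2 * (of_real t * z2) * cnj (of_real t * \<zeta>) * cnj x3)"
  have A: "Re (y1 * cnj \<zeta> + y2 * cnj \<zeta> ^ 2 + y3 * (cnj z1 + 2 * cnj z2 * \<zeta>)) = s * A"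
    unfolding y' A_def by (simp add: power2_eq_square algebra_simps)
  have "DG (x1, x2, x3, Re x4) = Im x4 - 2 * A" using eq unfolding A_def by linarith
  moreover have "Im y4 = s * Im x4" by (simp add: y')
  ultimately have "Im y4 - 2 * Re (y1 * cnj \<zeta> + y2 * cnj \<zeta> ^ 2 + y3 * (cnj z1 + 2 * cnj z2 * \<zeta>)) = s * DG (x1, x2, x3, Re x4)"
    unfolding A by (simp only: right_diff_distrib mult.left_commute)
  \<comment> \<open>The preimage of the vector under \<open>dil7 t\<close>, where the bound on
    \<open>DG\<close> applies. Since \<open>s * t ^ 3 * norm v\<close> is at most the sum of the
    norms of the rescaled components, a factor \<open>C * t\<close> remains.\<close>
  moreover define v :: c3r where "v = (of_real (1 / t ^ 2) * x1, of_real (1 / t) * x2, of_real (1 / t) * x3, Re x4 / t ^ 3)"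
  have "dil7 t v = (x1, x2, x3, Re x4)" using t by (simp add: v_def dil7_def)
  then have "\<bar>DG (x1, x2, x3, Re x4)\<bar> \<le> C * t ^ 4 * norm v" using D[of v] by simp
  moreover have "s * (C * t ^ 4 * norm v) \<le> C * t * (norm y1 + norm y2 + norm y3 + norm y4)"
  proof -
    have "norm v \<le> norm x1 / t ^ 2 + norm x2 / t + norm x3 / t + \<bar>Re x4\<bar> / t ^ 3"
      unfolding v_def using norm_c3r_le[of "of_real (1 / t ^ 2) * x1" "of_real (1 / t) * x2" "of_real (1 / t) * x3" "Re x4 / t ^ 3"] t
      by (simp add: norm_mult norm_divide norm_power)
    also have "\<dots> \<le> norm x1 / t ^ 2 + norm x2 / t + norm x3 / t + norm x4 / t ^ 3"
      using t by (intro add_mono divide_right_mono abs_Re_le_cmod) auto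
    finally have "t ^ 3 * norm v \<le> t ^ 3 * (norm x1 / t ^ 2 + norm x2 / t + norm x3 / t + norm x4 / t ^ 3)"
      using t by (intro mult_left_mono) auto
    also have "\<dots> = t * norm x1 + t ^ 2 * norm x2 + t ^ 2 * norm x3 + norm x4"
      using t by (simp add: field_simps power2_eq_square power3_eq_cube)
    finally have "s * (t ^ 3 * norm v) \<le> s * (t * norm x1 + t ^ 2 * norm x2 + t ^ 2 * norm x3 + norm x4)"
      using s by (intro mult_left_mono) auto
    also have "\<dots> = norm y1 + norm y2 + norm y3 + norm y4"
      unfolding y' using s t by (simp add: norm_mult norm_power algebra_simps)
    finally have "(C * t) * (s * (t ^ 3 * norm v)) \<le> (C * t) * (norm y1 + norm y2 + norm y3 + norm y4)"
      using C t by (intro mult_left_mono) auto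
    then show ?thesis by (simp add: power4_eq_xxxx power3_eq_cube mult_ac)
  qed
  ultimately show ?thesis
    using s by (simp add: abs_mult) (meson mult_left_mono less_imp_le order_trans)
qed

text \<open>The tangency equation is taken along a curve \<open>P t\<close> on the hypersurface
  tending to 0. Divided by \<open>t ^ K\<close> its components converge because the lower parts
  vanish, and \<open>F - Qmodel\<close> contributes only a term of order \<open>t\<close>; the limit
  is tangency to \<open>Q\<close> over \<open>(z1, z2, \<zeta>, u)\<close>.\<close>

lemma leading_part_tangent:
  assumes F: "Gamma0_form F" and X: "X \<in> aut_hyp F" and \<rho>: "\<rho> > 0" and a: "power_series_on \<rho> a X"
    and low: "\<And>k q. k < K \<Longrightarrow> wpart 1 (coef1 a) k q = 0 \<and> wpart 2 (coef2 a) k q = 0 \<and>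
      wpart 2 (coef3 a) k q = 0 \<and> wpart 0 (coef4 a) k q = 0"
  shows "\<exists>r>0. \<forall>z1 z2 \<zeta> u. norm z1 < r \<longrightarrow> norm z2 < r \<longrightarrow> norm \<zeta> < r \<longrightarrow> \<bar>u\<bar> < r \<longrightarrow>
     Q_tangent_at (wpart 1 (coef1 a) K) (wpart 2 (coef2 a) K) (wpart 2 (coef3 a) K) (wpart 0 (coef4 a) K) (z1, z2, \<zeta>, u)"
proof -
  obtain \<rho>' C where \<rho>': "\<rho>' > 0"
    and C1: "\<And>q t. \<lbrakk>q \<in> box7 \<rho>'; 0 < t; t \<le> 1\<rbrakk> \<Longrightarrow> \<bar>F (dil7 t q) - Qmodel (dil7 t q)\<bar> \<le> C * t ^ 4"
    and C2: "\<And>q t. \<lbrakk>q \<in> box7 \<rho>'; 0 < t; t \<le> 1\<rbrakk> \<Longrightarrow> \<exists>D. ((\<lambda>q. F q - Qmodel q) has_derivative D) (at (dil7 t q)) \<and>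
       (\<forall>v. \<bar>D (dil7 t v)\<bar> \<le> C * t ^ 4 * norm v)"
    using Gamma0_estimates[OF F] by blast
  have "(0, 0, 0, 0) \<in> box7 \<rho>'" using \<rho>' by (simp add: box7_def)
  from C1[OF this, of 1] have C0: "C \<ge> 0" by simp
  obtain R where R: "R > 0" and tan: "\<And>p D. \<lbrakk>p \<in> ball 0 R; hyp_rho F p = 0; (hyp_rho F has_derivative D) (at p)\<rbrakk> \<Longrightarrow> D (X p) = 0"
    using X unfolding aut_hyp_def by blast
  \<comment> \<open>With \<open>r \<le> 1\<close> the height of \<open>Q\<close> is at most
    \<open>4 * r\<close>, so \<open>norm w0 < 5 * r\<close> stays within the radius
    \<open>\<rho>\<close> of the series; \<open>\<rho>'\<close> serves the estimates of
    \<open>F\<close>.\<close>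
  define r where "r = min (min 1 (\<rho> / 8)) \<rho>'"
  have r: "0 < r" "r \<le> 1" "8 * r \<le> \<rho>" "r \<le> \<rho>'" using \<rho> \<rho>' by (auto simp: r_def)
  show ?thesis
  proof (intro exI[of _ r] conjI allI impI)
    show "r > 0" by (rule r)
    fix z1 z2 \<zeta> :: complex and u :: real
    assume z: "norm z1 < r" "norm z2 < r" "norm \<zeta> < r" "\<bar>u\<bar> < r"
    define q where "q = (z1, z2, \<zeta>, u)"
    have qb: "q \<in> box7 \<rho>'"
      using z r(4) abs_Re_le_cmod[of z1] abs_Im_le_cmod[of z1] abs_Re_le_cmod[of z2] abs_Im_le_cmod[of z2]
        abs_Re_le_cmod[of \<zeta>] abs_Im_le_cmod[of \<zeta>] by (simp add: q_def box7_def)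
    have Qq: "\<bar>Qmodel q\<bar> \<le> 4 * r"
    proof -
      have "\<bar>Re (z1 * cnj \<zeta> + z2 * cnj \<zeta> ^ 2)\<bar> \<le> norm (z1 * cnj \<zeta> + z2 * cnj \<zeta> ^ 2)" by (rule abs_Re_le_cmod)
      also have "\<dots> \<le> norm z1 * norm \<zeta> + norm z2 * norm \<zeta> ^ 2"
        by (rule order_trans[OF norm_triangle_ineq]) (simp add: norm_mult norm_power)
      also have "\<dots> \<le> r * 1 + r * 1 ^ 2" using z r by (intro add_mono mult_mono power_mono) auto
      finally show ?thesis by (simp add: q_def Qmodel_def)
    qed
    \<comment> \<open>Height over \<open>q\<close> of the hypersurface magnified by the inverse
      dilation.\<close>
    define v where "v t = F (dil7 t q) / t ^ 3" for t
    have ev1: "\<forall>\<^sub>F t in at_right (0::real). 0 < t \<and> t \<le> 1"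
      by (subst eventually_at_right[of 0 1]) (auto intro!: exI[of _ 1])
    have "((\<lambda>t. v t - Qmodel q) \<longlongrightarrow> 0) (at_right 0)"
    proof (rule Lim_null_comparison)
      show "((\<lambda>t. C * t) \<longlongrightarrow> 0) (at_right 0)" by (auto intro!: tendsto_eq_intros)
      show "\<forall>\<^sub>F t in at_right 0. norm (v t - Qmodel q) \<le> C * t"
        using ev1
      proof eventually_elim
        case (elim t)
        have "v t - Qmodel q = (F (dil7 t q) - Qmodel (dil7 t q)) / t ^ 3"
          using elim by (simp add: v_def Qmodel_dil7 diff_divide_distrib)
        then have "norm (v t - Qmodel q) = \<bar>F (dil7 t q) - Qmodel (dil7 t q)\<bar> / t ^ 3"
          using elim by (simp add: abs_divide)
        also have "\<dots> \<le> C * t ^ 4 / t ^ 3" using C1[OF qb, of t] elim by (intro divide_right_mono) auto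
        also have "\<dots> = C * t" using elim by (simp add: power4_eq_xxxx power3_eq_cube)
        finally show ?case .
      qed
    qed
    from tendsto_add[OF this tendsto_const[of "Qmodel q"]] have v: "(v \<longlongrightarrow> Qmodel q) (at_right 0)" by simp
    define w where "w t = Complex u (v t)" for t
    define w0 where "w0 = Complex u (Qmodel q)"
    have w: "(w \<longlongrightarrow> w0) (at_right 0)" unfolding w_def w0_def by (intro tendsto_intros v)
    have "norm w0 < \<rho>"
      using cmod_le[of w0] Qq z r unfolding w0_def by simp
    then have "\<forall>\<^sub>F t in at_right 0. norm (w t) < \<rho>"
      using tendsto_norm[OF w] by (rule order_tendstoD(2)[rotated])
    then have pd: "\<forall>\<^sub>F t in at_right 0. (z1, z2, \<zeta>, w t) \<in> polydisc \<rho>"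
      by eventually_elim (use z r in \<open>simp add: polydisc_def\<close>)
    define P where "P t = dil4 t (z1, z2, \<zeta>, w t)" for t
    have "(P \<longlongrightarrow> (of_real (0 ^ 2) * z1, of_real 0 * z2, of_real 0 * \<zeta>, of_real (0 ^ 3) * w0)) (at_right 0)"
      unfolding P_def dil4_def split by (intro tendsto_intros w)
    then have "(P \<longlongrightarrow> 0) (at_right 0)" by (simp add: zero_prod_def)
    then have Pb: "\<forall>\<^sub>F t in at_right 0. P t \<in> ball 0 R"
      using R by (intro topological_tendstoD) auto
    define y1 y2 y3 y4 where y: "y1 = (\<lambda>t. of_real (t ^ 1 / t ^ K) * fst (X (P t)))"
      "y2 = (\<lambda>t. of_real (t ^ 2 / t ^ K) * fst (snd (X (P t))))"
      "y3 = (\<lambda>t. of_real (t ^ 2 / t ^ K) * fst (snd (snd (X (P t)))))"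
      "y4 = (\<lambda>t. of_real (t ^ 0 / t ^ K) * snd (snd (snd (X (P t)))))"
    note wl = wpart_limit[OF \<rho> _ _ w pd, folded P_def]
    have l: "(y1 \<longlongrightarrow> wpart 1 (coef1 a) K (z1, z2, \<zeta>, w0)) (at_right 0)"
      "(y2 \<longlongrightarrow> wpart 2 (coef2 a) K (z1, z2, \<zeta>, w0)) (at_right 0)"
      "(y3 \<longlongrightarrow> wpart 2 (coef3 a) K (z1, z2, \<zeta>, w0)) (at_right 0)"
      "(y4 \<longlongrightarrow> wpart 0 (coef4 a) K (z1, z2, \<zeta>, w0)) (at_right 0)"
      unfolding y
      by (rule wl; use power_series_on_components[OF a] low in blast)+
    define d where "d t = Im (y4 t) - 2 * Re (y1 t * cnj \<zeta> + y2 t * cnj \<zeta> ^ 2 + y3 t * (cnj z1 + 2 * cnj z2 * \<zeta>))" for t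
    have "(d \<longlongrightarrow> 0) (at_right 0)"
    proof (rule Lim_null_comparison)
      show "((\<lambda>t. C * t * (norm (y1 t) + norm (y2 t) + norm (y3 t) + norm (y4 t))) \<longlongrightarrow> 0) (at_right 0)"
        by (rule tendsto_eq_intros l | simp)+
      show "\<forall>\<^sub>F t in at_right 0. norm (d t) \<le> C * t * (norm (y1 t) + norm (y2 t) + norm (y3 t) + norm (y4 t))"
        using ev1 Pb
      proof eventually_elim
        case (elim t)
        then have t: "0 < t" "t \<le> 1" by auto
        obtain DG where DG: "((\<lambda>q. F q - Qmodel q) has_derivative DG) (at (dil7 t q))"
          "\<And>v. \<bar>DG (dil7 t v)\<bar> \<le> C * t ^ 4 * norm v" using C2[OF qb t] by blast
        have P: "P t = (of_real (t ^ 2) * z1, of_real t * z2, of_real t * \<zeta>, of_real (t ^ 3) * w t)"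
          by (simp add: P_def dil4_def)
        have q': "dil7 t q = (of_real (t ^ 2) * z1, of_real t * z2, of_real t * \<zeta>, Re (of_real (t ^ 3) * w t))"
          by (simp add: dil7_def q_def w_def)
        have "Im (of_real (t ^ 3) * w t) = F (dil7 t q)" using t by (simp add: w_def v_def)
        then have "hyp_rho F (P t) = 0" unfolding P hyp_rho_def split q'[symmetric] by simp
        from tan[OF _ this[unfolded P] hyp_rho_has_derivative[OF DG(1)[unfolded q']]] elim(2)
        have eq: "(\<lambda>(v1, v2, v3, v4). Im v4 - (2 * Re (v1 * cnj (of_real t * \<zeta>) + of_real (t ^ 2) * z1 * cnj v3 + v2 * cnj (of_real t * \<zeta>) ^ 2
           + 2 * (of_real t * z2) * cnj (of_real t * \<zeta>) * cnj v3) + DG (v1, v2, v3, Re v4))) (X (P t)) = 0"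
          unfolding P by blast
        show ?case unfolding d_def real_norm_def
          by (rule rescaled_tangency[OF t DG(2) C0 eq[unfolded split_def] y[THEN fun_cong]])
      qed
    qed
    moreover have "(d \<longlongrightarrow> Im (wpart 0 (coef4 a) K (z1, z2, \<zeta>, w0)) - 2 * Re (wpart 1 (coef1 a) K (z1, z2, \<zeta>, w0) * cnj \<zeta>
        + wpart 2 (coef2 a) K (z1, z2, \<zeta>, w0) * cnj \<zeta> ^ 2 + wpart 2 (coef3 a) K (z1, z2, \<zeta>, w0) * (cnj z1 + 2 * cnj z2 * \<zeta>))) (at_right 0)"
      unfolding d_def by (intro tendsto_intros l)
    ultimately have "Im (wpart 0 (coef4 a) K (z1, z2, \<zeta>, w0)) - 2 * Re (wpart 1 (coef1 a) K (z1, z2, \<zeta>, w0) * cnj \<zeta>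
        + wpart 2 (coef2 a) K (z1, z2, \<zeta>, w0) * cnj \<zeta> ^ 2 + wpart 2 (coef3 a) K (z1, z2, \<zeta>, w0) * (cnj z1 + 2 * cnj z2 * \<zeta>)) = 0"
      by (intro tendsto_unique[of "at_right (0::real)" d]) auto
    then show "Q_tangent_at (wpart 1 (coef1 a) K) (wpart 2 (coef2 a) K) (wpart 2 (coef3 a) K) (wpart 0 (coef4 a) K) (z1, z2, \<zeta>, u)"
      unfolding Q_tangent_at_def Let_def split w0_def q_def by simp
  qed
qed

text \<open>The asymptotics are used at the single value \<open>t = 1 / 2\<close> with
  \<open>K\<close> tending to infinity, the constant being independent of \<open>K\<close>. The
  radius \<open>\<rho> / 8\<close> leaves room for \<open>dil4 2\<close>, whose largest factor is
  \<open>2 ^ 3\<close>.\<close>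

lemma wparts_zero_imp_zero:
  fixes f :: "c4 \<Rightarrow> complex"
  assumes \<rho>: "\<rho> > 0" and f: "\<And>p. p \<in> polydisc \<rho> \<Longrightarrow> ((\<lambda>\<alpha>. a \<alpha> * mon4 \<alpha> p) has_sum f p) UNIV"
    and zero: "\<And>k q. wpart \<sigma> a k q = 0" and p: "p \<in> polydisc (\<rho> / 8)"
  shows "f p = 0"
proof -
  define p' where "p' = dil4 2 p"
  have p': "p' \<in> polydisc \<rho>" using p \<rho> by (cases p) (auto simp: p'_def dil4_def polydisc_def norm_mult)
  have pe: "dil4 (1 / 2) p' = p" by (cases p) (simp add: p'_def dil4_def power_divide)
  obtain C where C: "\<And>K. norm (of_real ((1 / 2) ^ \<sigma>) * f (dil4 (1 / 2) p') - of_real ((1 / 2) ^ K) * wpart \<sigma> a K p') \<le> C * (1 / 2) ^ Suc K"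
  proof -
    obtain C where "\<forall>K p t. p \<in> polydisc \<rho> \<longrightarrow> 0 < t \<longrightarrow> t \<le> 1 \<longrightarrow> (\<forall>k<K. \<forall>q. wpart \<sigma> a k q = 0) \<longrightarrow>
       norm (of_real (t ^ \<sigma>) * f (dil4 t p) - of_real (t ^ K) * wpart \<sigma> a K p) \<le> C * t ^ Suc K"
      using wpart_asymptotics[OF \<rho> f, of \<sigma>] by blast
    from this[rule_format, OF p', of "1 / 2"] zero show thesis by (intro that) auto
  qed
  have "norm (of_real ((1 / 2) ^ \<sigma>) * f p) \<le> C * (1 / 2) ^ Suc K" for K
    using C[of K] zero by (simp add: pe)
  moreover have "(\<lambda>K. C * (1 / 2) ^ Suc K) \<longlonglongrightarrow> C * 0"
    by (intro tendsto_intros LIMSEQ_Suc LIMSEQ_power_zero) auto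
  ultimately have "norm (of_real ((1 / 2) ^ \<sigma>) * f p) \<le> C * 0"
    by (intro LIMSEQ_le_const[of "\<lambda>K. C * (1 / 2) ^ Suc K"]) auto
  then show ?thesis by simp
qed

lemma germ_zero_if_params_zero:
  assumes F: "Gamma0_form F" and X: "X \<in> aut_hyp F" and \<rho>: "\<rho> > 0" and a: "power_series_on \<rho> a X"
    and par: "\<And>j. j < 16 \<Longrightarrow> params a j = 0"
  shows "germ_eq X (\<lambda>_. 0)"
proof -
  have wz: "\<forall>q. wpart 1 (coef1 a) K q = 0 \<and> wpart 2 (coef2 a) K q = 0 \<and> wpart 2 (coef3 a) K q = 0 \<and> wpart 0 (coef4 a) K q = 0" for K
  proof (induction K rule: less_induct)
    case (less K)
    obtain r where "r > 0" and r: "\<And>z1 z2 \<zeta> u. \<lbrakk>norm z1 < r; norm z2 < r; norm \<zeta> < r; \<bar>u\<bar> < r\<rbrakk> \<Longrightarrow>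
     Q_tangent_at (wpart 1 (coef1 a) K) (wpart 2 (coef2 a) K) (wpart 2 (coef3 a) K) (wpart 0 (coef4 a) K) (z1, z2, \<zeta>, u)"
      using leading_part_tangent[OF F X \<rho> a, of K] less.IH by blast
    show ?case using wpart_tangent_zero[OF \<open>r > 0\<close> r par] by blast
  qed
  have "X p = 0" if p: "p \<in> polydisc (\<rho> / 8)" for p
  proof -
    have "fst (X p) = 0"
      by (rule wparts_zero_imp_zero[OF \<rho> power_series_on_components(1)[OF a] _ p]) (use wz in blast)+
    moreover have "fst (snd (X p)) = 0"
      by (rule wparts_zero_imp_zero[OF \<rho> power_series_on_components(2)[OF a] _ p]) (use wz in blast)+
    moreover have "fst (snd (snd (X p))) = 0"
      by (rule wparts_zero_imp_zero[OF \<rho> power_series_on_components(3)[OF a] _ p]) (use wz in blast)+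
    moreover have "snd (snd (snd (X p))) = 0"
      by (rule wparts_zero_imp_zero[OF \<rho> power_series_on_components(4)[OF a] _ p]) (use wz in blast)+
    ultimately show ?thesis by (simp add: prod_eq_iff)
  qed
  moreover have "p \<in> polydisc (\<rho> / 8)" if "p \<in> ball 0 (\<rho> / 8)" for p
  proof -
    obtain z1 z2 \<zeta> w where pe: "p = (z1, z2, \<zeta>, w)" by (cases p)
    have "norm p < \<rho> / 8" using that by simp
    then show ?thesis unfolding pe polydisc_def
      using norm_fst_le[of z1 "(z2, \<zeta>, w)"] norm_snd_le[of "(z2, \<zeta>, w)" z1]
        norm_fst_le[of z2 "(\<zeta>, w)"] norm_snd_le[of "(\<zeta>, w)" z2] norm_fst_le[of \<zeta> w] norm_snd_le[of w \<zeta>]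
      by auto
  qed
  ultimately show ?thesis unfolding germ_eq_def using \<rho> by (intro exI[of _ "\<rho> / 8"]) auto
qed

section \<open>The model algebra and the dimension bounds\<close>

lemma cmul4_real_linear: "linear (cmul4 c)"
  by (rule linearI) (auto simp: cmul4_def algebra_simps)

lemma cmul4_sum: "cmul4 c (\<Sum>i\<in>A. r i *\<^sub>R v i) = (\<Sum>i\<in>A. r i *\<^sub>R cmul4 c (v i))"
  using linear_sum[OF cmul4_real_linear] linear_scale[OF cmul4_real_linear] by (metis (no_types, lifting) sum.cong)

lemma holo4_on_sum:
  assumes "\<And>i. i \<in> A \<Longrightarrow> holo4_on S (X i)"
  shows "holo4_on S (\<lambda>p. \<Sum>i\<in>A. c i *\<^sub>R X i p)"
  unfolding holo4_on_def
proof
  fix p assume "p \<in> S"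
  then have "\<forall>i\<in>A. \<exists>D. (X i has_derivative D) (at p) \<and> (\<forall>c v. D (cmul4 c v) = cmul4 c (D v))"
    using assms unfolding holo4_on_def by blast
  then obtain D where D: "\<And>i. i \<in> A \<Longrightarrow> (X i has_derivative D i) (at p)"
    "\<And>i c v. i \<in> A \<Longrightarrow> D i (cmul4 c v) = cmul4 c (D i v)"
    by metis
  show "\<exists>D. ((\<lambda>p. \<Sum>i\<in>A. c i *\<^sub>R X i p) has_derivative D) (at p) \<and> (\<forall>c v. D (cmul4 c v) = cmul4 c (D v))"
  proof (intro exI[of _ "\<lambda>v. \<Sum>i\<in>A. c i *\<^sub>R D i v"] conjI allI)
    show "((\<lambda>p. \<Sum>i\<in>A. c i *\<^sub>R X i p) has_derivative (\<lambda>v. \<Sum>i\<in>A. c i *\<^sub>R D i v)) (at p)"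
      by (intro has_derivative_sum has_derivative_scaleR_right D)
    show "(\<Sum>i\<in>A. c i *\<^sub>R D i (cmul4 z v)) = cmul4 z (\<Sum>i\<in>A. c i *\<^sub>R D i v)" for z v
      by (simp add: cmul4_sum D(2) cong: sum.cong)
  qed
qed

lemma aut_hyp_sum:
  assumes "finite A" "\<And>i. i \<in> A \<Longrightarrow> X i \<in> aut_hyp F"
  shows "(\<lambda>p. \<Sum>i\<in>A. c i *\<^sub>R X i p) \<in> aut_hyp F"
proof -
  have "\<forall>i\<in>A. \<exists>r>0. holo4_on (ball 0 r) (X i) \<and> (\<forall>p\<in>ball 0 r. hyp_rho F p = 0 \<longrightarrow>
         (\<forall>D. (hyp_rho F has_derivative D) (at p) \<longrightarrow> D (X i p) = 0))"
    using assms(2) unfolding aut_hyp_def by blast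
  then obtain r where r: "\<And>i. i \<in> A \<Longrightarrow> r i > 0" "\<And>i. i \<in> A \<Longrightarrow> holo4_on (ball 0 (r i)) (X i)"
    "\<And>i p D. \<lbrakk>i \<in> A; p \<in> ball 0 (r i); hyp_rho F p = 0; (hyp_rho F has_derivative D) (at p)\<rbrakk> \<Longrightarrow> D (X i p) = 0"
    by metis
  define R where "R = Min (insert 1 (r ` A))"
  have R: "R > 0" "\<And>i. i \<in> A \<Longrightarrow> R \<le> r i" using assms(1) r(1) by (auto simp: R_def)
  have sub: "ball 0 R \<subseteq> ball 0 (r i)" if "i \<in> A" for i using R(2)[OF that] by auto
  show ?thesis unfolding aut_hyp_def
  proof (intro CollectI exI[of _ R] conjI ballI impI allI)
    show "R > 0" by (rule R)
    show "holo4_on (ball 0 R) (\<lambda>p. \<Sum>i\<in>A. c i *\<^sub>R X i p)"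
    proof (rule holo4_on_sum)
      fix i assume "i \<in> A"
      then show "holo4_on (ball 0 R) (X i)" using r(2) sub unfolding holo4_on_def by blast
    qed
    fix p D assume p: "p \<in> ball 0 R" "hyp_rho F p = 0" and D: "(hyp_rho F has_derivative D) (at p)"
    have "D (X i p) = 0" if "i \<in> A" for i using r(3)[OF that _ p(2) D] sub[OF that] p(1) by blast
    moreover have "linear D" using D has_derivative_linear by blast
    ultimately show "D (\<Sum>i\<in>A. c i *\<^sub>R X i p) = 0"
      by (simp add: linear_sum linear_scale)
  qed
qed

lemma power_series_on_mono: "power_series_on \<rho> a X \<Longrightarrow> \<rho>' \<le> \<rho> \<Longrightarrow> power_series_on \<rho>' a X"
  unfolding power_series_on_def polydisc_def by force

lemma has_sum_finite_sum:
  fixes f :: "'j \<Rightarrow> 'i \<Rightarrow> 'a :: real_normed_vector"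
  assumes "finite A" "\<And>j. j \<in> A \<Longrightarrow> (f j has_sum s j) UNIV"
  shows "((\<lambda>i. \<Sum>j\<in>A. f j i) has_sum (\<Sum>j\<in>A. s j)) UNIV"
  using assms by (induction A) (auto intro: has_sum_add has_sum_0)

lemma power_series_on_sum:
  assumes "finite A" "\<And>i. i \<in> A \<Longrightarrow> power_series_on \<rho> (a i) (X i)"
  shows "power_series_on \<rho> (\<lambda>\<alpha>. \<Sum>i\<in>A. c i *\<^sub>R a i \<alpha>) (\<lambda>p. \<Sum>i\<in>A. c i *\<^sub>R X i p)"
  unfolding power_series_on_def
proof
  fix p assume p: "p \<in> polydisc \<rho>"
  have "((\<lambda>\<alpha>. \<Sum>i\<in>A. c i *\<^sub>R cmul4 (mon4 \<alpha> p) (a i \<alpha>)) has_sum (\<Sum>i\<in>A. c i *\<^sub>R X i p)) UNIV"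
  proof (rule has_sum_finite_sum[OF assms(1)])
    fix i assume "i \<in> A"
    then have "((\<lambda>\<alpha>. cmul4 (mon4 \<alpha> p) (a i \<alpha>)) has_sum X i p) UNIV"
      using assms(2) p unfolding power_series_on_def by blast
    then show "((\<lambda>\<alpha>. c i *\<^sub>R cmul4 (mon4 \<alpha> p) (a i \<alpha>)) has_sum c i *\<^sub>R X i p) UNIV"
      by (rule has_sum_bounded_linear[OF bounded_linear_scaleR_right])
  qed
  then show "((\<lambda>\<alpha>. cmul4 (mon4 \<alpha> p) (\<Sum>i\<in>A. c i *\<^sub>R a i \<alpha>)) has_sum (\<Sum>i\<in>A. c i *\<^sub>R X i p)) UNIV"
    by (simp add: cmul4_sum)
qed

lemma less_16_cases:
  assumes "j < (16::nat)"
  obtains "j = 0" | "j = 1" | "j = 2" | "j = 3" | "j = 4" | "j = 5" | "j = 6" | "j = 7" | "j = 8" | "j = 9"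
    | "j = 10" | "j = 11" | "j = 12" | "j = 13" | "j = 14" | "j = 15"
proof -
  have "j = 0 \<or> j = 1 \<or> j = 2 \<or> j = 3 \<or> j = 4 \<or> j = 5 \<or> j = 6 \<or> j = 7 \<or> j = 8 \<or> j = 9
    \<or> j = 10 \<or> j = 11 \<or> j = 12 \<or> j = 13 \<or> j = 14 \<or> j = 15" using assms by presburger
  then show ?thesis using that by metis
qed

lemma params_sum:
  assumes "j < 16"
  shows "params (\<lambda>\<alpha>. \<Sum>i\<in>A. c i *\<^sub>R a i \<alpha>) j = (\<Sum>i\<in>A. c i * params (a i) j)"
  using assms
  by (cases rule: less_16_cases)
    (simp_all add: params_def fst_sum snd_sum sum_negf sum_divide_distrib)

lemma power_series_on_at_0:
  assumes "power_series_on \<rho> a X" "\<rho> > 0"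
  shows "X 0 = a (0, 0, 0, 0)"
proof -
  have "((\<lambda>\<alpha>. cmul4 (mon4 \<alpha> 0) (a \<alpha>)) has_sum X 0) UNIV"
    using assms unfolding power_series_on_def by (auto simp: polydisc_def zero_prod_def)
  moreover have "((\<lambda>\<alpha>. cmul4 (mon4 \<alpha> 0) (a \<alpha>)) has_sum a (0, 0, 0, 0)) UNIV"
  proof (rule has_sum_finite_neutralI[of "{(0, 0, 0, 0)}"])
    show "cmul4 (mon4 \<alpha> 0) (a \<alpha>) = 0" if "\<alpha> \<in> UNIV - {(0, 0, 0, 0)}" for \<alpha>
      using that by (cases \<alpha>) (auto simp: cmul4_def mon4_def zero_prod_def power_0_left split_def)
  qed (auto simp: cmul4_def mon4_def zero_prod_def split_def)
  ultimately show ?thesis by (rule has_sum_unique)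
qed

lemma homogeneous_system_nontrivial:
  fixes L :: "'i \<Rightarrow> nat \<Rightarrow> real"
  assumes "finite I" "n < card I"
  shows "\<exists>c. (\<exists>i\<in>I. c i \<noteq> 0) \<and> (\<forall>j<n. (\<Sum>i\<in>I. c i * L i j) = 0)"
  using assms
proof (induction n arbitrary: I L)
  case 0
  then obtain i where "i \<in> I" by fastforce
  then show ?case by (intro exI[of _ "\<lambda>_. 1"]) auto
next
  case (Suc n)
  show ?case
  proof (cases "\<forall>i\<in>I. L i n = 0")
    case True
    obtain c where "\<exists>i\<in>I. c i \<noteq> 0" "\<forall>j<n. (\<Sum>i\<in>I. c i * L i j) = 0"
      using Suc.IH[of I L] Suc.prems by auto
    then show ?thesis using True by (intro exI[of _ c]) (auto simp: less_Suc_eq)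
  next
    case False
    then obtain k where k: "k \<in> I" "L k n \<noteq> 0" by auto
    \<comment> \<open>Elimination with pivot \<open>k\<close>: this makes \<open>L' i n = 0\<close>,
      and the coefficient at \<open>k\<close> is recovered from equation \<open>n\<close>.\<close>
    define L' where "L' i j = L i j - L i n / L k n * L k j" for i j
    obtain c where c: "\<exists>i\<in>I - {k}. c i \<noteq> 0" "\<And>j. j < n \<Longrightarrow> (\<Sum>i\<in>I - {k}. c i * L' i j) = 0"
    proof -
      have "n < card (I - {k})" using Suc.prems k by (simp add: less_diff_conv)
      then show thesis using Suc.IH[of "I - {k}" L'] Suc.prems(1) that by auto
    qed
    define s where "s = (\<Sum>i\<in>I - {k}. c i * L i n)"
    define c' where "c' i = (if i = k then - s / L k n else c i)" for i
    have sum: "(\<Sum>i\<in>I. c' i * L i j) = (\<Sum>i\<in>I - {k}. c i * L i j) - s / L k n * L k j" for j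
      using k Suc.prems by (simp add: sum.remove[of I k] c'_def)
    have "(\<Sum>i\<in>I. c' i * L i j) = (\<Sum>i\<in>I - {k}. c i * L' i j)" for j
      unfolding sum L'_def s_def
      by (simp add: right_diff_distrib sum_subtractf sum_divide_distrib sum_distrib_left mult_ac)
    moreover have "(\<Sum>i\<in>I. c' i * L i n) = 0" unfolding sum using k by (simp add: s_def)
    ultimately show ?thesis using c by (intro exI[of _ c']) (auto simp: less_Suc_eq c'_def)
  qed
qed

lemma aut_hyp_power_series:
  assumes "X \<in> aut_hyp F"
  obtains \<rho> a where "\<rho> > 0" "power_series_on \<rho> a X"
proof -
  obtain r where "r > 0" "holo4_on (ball 0 r) X" using assms unfolding aut_hyp_def by blast
  then show ?thesis using that[of "r / 32"] holo4_on_power_series by auto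
qed

text \<open>More than \<open>n\<close> fields admit a nontrivial real combination whose first
  \<open>n\<close> parameters vanish; the others vanish by \<open>par\<close>, so the combination is
  the zero germ. For the full algebra \<open>n = 16\<close> and \<open>par\<close> is vacuous; for
  the stabilizer \<open>n = 9\<close>.\<close>

lemma germ_dim_le_params:
  assumes F: "Gamma0_form F" and S: "S \<subseteq> aut_hyp F" and n: "n \<le> 16"
    and par: "\<And>X \<rho> a j. \<lbrakk>X \<in> S; \<rho> > 0; power_series_on \<rho> a X; n \<le> j; j < 16\<rbrakk> \<Longrightarrow> params a j = 0"
  shows "germ_dim_le S n"
  unfolding germ_dim_le_def
proof (intro allI impI, rule ccontr)
  fix Xs assume Xs: "set Xs \<subseteq> S" "germ_indep Xs" and long: "\<not> length Xs \<le> n"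
  define N where "N = length Xs"
  have XS: "Xs ! i \<in> S" if "i < N" for i using Xs(1) that nth_mem N_def by blast
  have "\<forall>i. \<exists>\<rho> a. i < N \<longrightarrow> \<rho> > 0 \<and> power_series_on \<rho> a (Xs ! i)"
    using aut_hyp_power_series XS S by (metis subsetD)
  then obtain \<rho> a where a: "\<And>i. i < N \<Longrightarrow> \<rho> i > 0" "\<And>i. i < N \<Longrightarrow> power_series_on (\<rho> i) (a i) (Xs ! i)"
    by metis
  define R where "R = Min (insert 1 (\<rho> ` {..<N}))"
  have R: "R > 0" "\<And>i. i < N \<Longrightarrow> R \<le> \<rho> i" using a(1) by (auto simp: R_def)
  obtain c where c: "\<exists>i<N. c i \<noteq> 0" "\<And>j. j < n \<Longrightarrow> (\<Sum>i<N. c i * params (a i) j) = 0"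
    using homogeneous_system_nontrivial[of "{..<N}" n "\<lambda>i. params (a i)"] long by (auto simp: N_def)
  have "params (\<lambda>\<alpha>. \<Sum>i<N. c i *\<^sub>R a i \<alpha>) j = 0" if "j < 16" for j
  proof (cases "j < n")
    case False
    then have "params (a i) j = 0" if "i < N" for i using par[OF XS[OF that] a(1,2)[OF that]] \<open>j < 16\<close> by auto
    then show ?thesis unfolding params_sum[OF that] by (intro sum.neutral) simp
  qed (simp add: params_sum[OF that] c)
  moreover have "power_series_on R (\<lambda>\<alpha>. \<Sum>i<N. c i *\<^sub>R a i \<alpha>) (\<lambda>p. \<Sum>i<N. c i *\<^sub>R (Xs ! i) p)"
    by (rule power_series_on_sum) (use power_series_on_mono[OF a(2) R(2)] in auto)
  moreover have "(\<lambda>p. \<Sum>i<N. c i *\<^sub>R (Xs ! i) p) \<in> aut_hyp F"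
    by (rule aut_hyp_sum) (use XS S in auto)
  ultimately have "germ_eq (\<lambda>p. \<Sum>i<N. c i *\<^sub>R (Xs ! i) p) (\<lambda>_. 0)"
    using germ_zero_if_params_zero[OF F _ R(1)] by blast
  moreover have "(\<lambda>p. \<Sum>i<N. c i *\<^sub>R (Xs ! i) p) = lincomb (map c [0..<N]) Xs"
    unfolding lincomb_def N_def by (intro ext sum.cong) auto
  ultimately have "\<forall>i<N. map c [0..<N] ! i = 0"
    using Xs(2) unfolding germ_indep_def by (metis N_def length_map length_upt diff_zero)
  then show False using c(1) by auto
qed

lemma germ_dim_le_aut_hyp: "Gamma0_form F \<Longrightarrow> germ_dim_le (aut_hyp F) 16"
  by (rule germ_dim_le_params) auto

text \<open>The entries 9 to 15 are real and imaginary parts of components of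
  \<open>X 0\<close>.\<close>

lemma params_stabilizer:
  assumes "X 0 = 0" "\<rho> > 0" "power_series_on \<rho> a X" "9 \<le> j" "j < 16"
  shows "params a j = 0"
proof -
  have "a (0, 0, 0, 0) = 0" using power_series_on_at_0[OF assms(3,2)] assms(1) by simp
  with \<open>j < 16\<close> \<open>9 \<le> j\<close> show ?thesis by (cases rule: less_16_cases) (simp_all add: params_def)
qed

lemma germ_dim_le_aut0_hyp: "Gamma0_form F \<Longrightarrow> germ_dim_le (aut0_hyp F) 9"
  by (rule germ_dim_le_params) (auto simp: aut0_hyp_def intro: params_stabilizer)

lemma Gamma0_form_Qmodel: "Gamma0_form Qmodel"
  unfolding Gamma0_form_def by (intro exI[of _ 1] conjI exI[of _ "\<lambda>_. 0"]) (auto intro: has_sum_0)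


section \<open>The sixteen-parameter family of fields tangent to \<open>Q\<close>\<close>

definition model_field ::
  "real \<Rightarrow> complex \<Rightarrow> complex \<Rightarrow> real \<Rightarrow> complex \<Rightarrow> real \<Rightarrow> complex \<Rightarrow> complex \<Rightarrow> complex \<Rightarrow> real \<Rightarrow> vf" where
  "model_field k M m l N n a b c d = (\<lambda>(z1, z2, \<zeta>, w).
     (a - 2 * cnj c * z2 + \<i> * of_real k * \<zeta> + M * z1 + m * \<zeta> ^ 2 + 2 * \<i> * cnj N * z1 * \<zeta> + N * w,
      b + (2 * M - 3 * of_real l) * z2 - cnj m * \<zeta> + 2 * \<i> * cnj N * z2 * \<zeta> - \<i> * N * z1 + \<i> * of_real n * \<zeta> ^ 2,
      c + (3 * of_real l - cnj M) * \<zeta> + \<i> * cnj N * \<zeta> ^ 2,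
      of_real d + 2 * \<i> * cnj a * \<zeta> + 2 * \<i> * cnj c * z1 + 2 * \<i> * cnj b * \<zeta> ^ 2 + 3 * of_real l * w
        + 2 * \<i> * cnj N * \<zeta> * w))"

definition model_coef ::
  "real \<Rightarrow> complex \<Rightarrow> complex \<Rightarrow> real \<Rightarrow> complex \<Rightarrow> real \<Rightarrow> complex \<Rightarrow> complex \<Rightarrow> complex \<Rightarrow> real \<Rightarrow> mi4 \<Rightarrow> c4" where
  "model_coef k M m l N n a b c d \<alpha> =
     (if \<alpha> = (0, 0, 0, 0) then (a, b, c, of_real d)
      else if \<alpha> = (1, 0, 0, 0) then (M, - \<i> * N, 0, 2 * \<i> * cnj c)
      else if \<alpha> = (0, 1, 0, 0) then (- 2 * cnj c, 2 * M - 3 * of_real l, 0, 0)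
      else if \<alpha> = (0, 0, 1, 0) then (\<i> * of_real k, - cnj m, 3 * of_real l - cnj M, 2 * \<i> * cnj a)
      else if \<alpha> = (0, 0, 0, 1) then (N, 0, 0, 3 * of_real l)
      else if \<alpha> = (0, 0, 2, 0) then (m, \<i> * of_real n, \<i> * cnj N, 2 * \<i> * cnj b)
      else if \<alpha> = (1, 0, 1, 0) then (2 * \<i> * cnj N, 0, 0, 0)
      else if \<alpha> = (0, 1, 1, 0) then (0, 2 * \<i> * cnj N, 0, 0)
      else if \<alpha> = (0, 0, 1, 1) then (0, 0, 0, 2 * \<i> * cnj N)
      else 0)"

lemma model_field_power_series: "power_series_on \<rho> (model_coef k M m l N n a b c d) (model_field k M m l N n a b c d)"
  unfolding power_series_on_def
proof
  fix p :: c4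
  obtain z1 z2 \<zeta> w where p: "p = (z1, z2, \<zeta>, w)" by (cases p)
  let ?B = "{(0, 0, 0, 0), (1, 0, 0, 0), (0, 1, 0, 0), (0, 0, 1, 0), (0, 0, 0, 1), (0, 0, 2, 0), (1, 0, 1, 0), (0, 1, 1, 0), (0, 0, 1, 1)} :: mi4 set"
  show "((\<lambda>\<alpha>. cmul4 (mon4 \<alpha> p) (model_coef k M m l N n a b c d \<alpha>)) has_sum model_field k M m l N n a b c d p) UNIV"
  proof (rule has_sum_finite_neutralI[of ?B])
    show "cmul4 (mon4 \<alpha> p) (model_coef k M m l N n a b c d \<alpha>) = 0" if "\<alpha> \<in> UNIV - ?B" for \<alpha>
    proof -
      have "model_coef k M m l N n a b c d \<alpha> = 0" using that by (simp add: model_coef_def)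
      then show ?thesis by (simp add: cmul4_def zero_prod_def)
    qed
    show "model_field k M m l N n a b c d p = (\<Sum>\<alpha>\<in>?B. cmul4 (mon4 \<alpha> p) (model_coef k M m l N n a b c d \<alpha>))"
      by (simp add: p model_field_def model_coef_def cmul4_def mon4_def algebra_simps)
  qed auto
qed

lemma model_field_holo4: "holo4_on S (model_field k M m l N n a b c d)"
  unfolding holo4_on_def
proof
  fix p :: c4
  obtain z1 z2 \<zeta> w where p: "p = (z1, z2, \<zeta>, w)" by (cases p)
  define D :: "c4 \<Rightarrow> c4" where "D = (\<lambda>v. case v of (v1, v2, v3, v4) \<Rightarrow>
    (- 2 * cnj c * v2 + \<i> * of_real k * v3 + M * v1 + 2 * m * \<zeta> * v3 + 2 * \<i> * cnj N * (v1 * \<zeta> + z1 * v3) + N * v4,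
     (2 * M - 3 * of_real l) * v2 - cnj m * v3 + 2 * \<i> * cnj N * (v2 * \<zeta> + z2 * v3) - \<i> * N * v1 + 2 * \<i> * of_real n * \<zeta> * v3,
     (3 * of_real l - cnj M) * v3 + 2 * \<i> * cnj N * \<zeta> * v3,
     2 * \<i> * cnj a * v3 + 2 * \<i> * cnj c * v1 + 4 * \<i> * cnj b * \<zeta> * v3 + 3 * of_real l * v4 + 2 * \<i> * cnj N * (v3 * w + \<zeta> * v4)))"
  have "(model_field k M m l N n a b c d has_derivative D) (at p)"
    unfolding model_field_def D_def split_def p
    by (rule has_derivative_eq_rhs, (rule derivative_intros)+) (auto simp: algebra_simps)
  moreover have "D (cmul4 c v) = cmul4 c (D v)" for c v
    by (cases v) (simp add: D_def cmul4_def algebra_simps)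
  ultimately show "\<exists>D. (model_field k M m l N n a b c d has_derivative D) (at p) \<and> (\<forall>c v. D (cmul4 c v) = cmul4 c (D v))"
    by blast
qed

text \<open>Once all conjugates are named as separate symbols, tangency is a polynomial identity
  modulo the equation \<open>W\<close> of \<open>Q\<close> and
  \<open>\<i> * \<i> = -1\<close>.\<close>

lemma model_field_tangent:
  fixes z1 z2 \<zeta> w :: complex
  assumes w: "Im w = 2 * Re (z1 * cnj \<zeta> + z2 * cnj \<zeta> ^ 2)"
    and X: "model_field k M m l N n a b c d (z1, z2, \<zeta>, w) = (x1, x2, x3, x4)"
  shows "Im x4 = 2 * Re (x1 * cnj \<zeta> + z1 * cnj x3 + x2 * cnj \<zeta> ^ 2 + 2 * z2 * cnj \<zeta> * cnj x3)"
proof -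
  define Z1 Z2 Z3 W where Z: "Z1 = cnj z1" "Z2 = cnj z2" "Z3 = cnj \<zeta>" "W = cnj w"
  have ii: "\<i> * \<i> = -1" by simp
  define S where "S = z1 * cnj \<zeta> + z2 * cnj \<zeta> ^ 2"
  have "w - W = of_real (2 * (2 * Re S)) * \<i>"
    unfolding Z using complex_diff_cnj[of w] w by (simp only: S_def)
  also have "of_real (2 * (2 * Re S)) = 2 * (S + cnj S)" by (simp only: complex_add_cnj) simp
  also have "S + cnj S = z1 * Z3 + Z1 * \<zeta> + z2 * Z3 ^ 2 + Z2 * \<zeta> ^ 2" by (simp add: S_def Z)
  finally have W: "w - W = 2 * \<i> * (z1 * Z3 + Z1 * \<zeta> + z2 * Z3 ^ 2 + Z2 * \<zeta> ^ 2)" by simp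
  define N' M' m' a' b' c' where P: "N' = cnj N" "M' = cnj M" "m' = cnj m" "a' = cnj a" "b' = cnj b" "c' = cnj c"
  define k' l' n' d' where R: "k' = complex_of_real k" "l' = complex_of_real l" "n' = complex_of_real n" "d' = complex_of_real d"
  have x: "x1 = a - 2 * c' * z2 + \<i> * k' * \<zeta> + M * z1 + m * \<zeta> ^ 2 + 2 * \<i> * N' * z1 * \<zeta> + N * w"
    "x2 = b + (2 * M - 3 * l') * z2 - m' * \<zeta> + 2 * \<i> * N' * z2 * \<zeta> - \<i> * N * z1 + \<i> * n' * \<zeta> ^ 2"
    "x3 = c + (3 * l' - M') * \<zeta> + \<i> * N' * \<zeta> ^ 2"
    "x4 = d' + 2 * \<i> * a' * \<zeta> + 2 * \<i> * c' * z1 + 2 * \<i> * b' * \<zeta> ^ 2 + 3 * l' * w + 2 * \<i> * N' * \<zeta> * w"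
    using X unfolding model_field_def P R by auto
  have cx: "cnj x1 = a' - 2 * c * Z2 - \<i> * k' * Z3 + M' * Z1 + m' * Z3 ^ 2 - 2 * \<i> * N * Z1 * Z3 + N' * W"
    "cnj x2 = b' + (2 * M' - 3 * l') * Z2 - m * Z3 - 2 * \<i> * N * Z2 * Z3 + \<i> * N' * Z1 - \<i> * n' * Z3 ^ 2"
    "cnj x3 = c' + (3 * l' - M) * Z3 - \<i> * N * Z3 ^ 2"
    "cnj x4 = d' - 2 * \<i> * a * Z3 - 2 * \<i> * c * Z1 - 2 * \<i> * b * Z3 ^ 2 + 3 * l' * W - 2 * \<i> * N * Z3 * W"
    unfolding x P R Z by simp_all
  define T where "T = x1 * cnj \<zeta> + z1 * cnj x3 + x2 * cnj \<zeta> ^ 2 + 2 * z2 * cnj \<zeta> * cnj x3"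
  have "x4 - cnj x4 = 2 * \<i> * (x1 * Z3 + z1 * cnj x3 + x2 * Z3 ^ 2 + 2 * z2 * Z3 * cnj x3
     + (cnj x1 * \<zeta> + Z1 * x3 + cnj x2 * \<zeta> ^ 2 + 2 * Z2 * \<zeta> * x3))"
    unfolding cx unfolding x using W ii by algebra
  also have "\<dots> = 2 * \<i> * (T + cnj T)" by (simp add: T_def Z)
  finally have "of_real (2 * Im x4) * \<i> = 2 * \<i> * of_real (2 * Re T)"
    by (simp only: complex_diff_cnj complex_add_cnj)
  from arg_cong[OF this, of Im] show ?thesis by (simp add: T_def)
qed

lemma model_field_aut: "model_field k M m l N n a b c d \<in> aut_hyp Qmodel"
  unfolding aut_hyp_def
proof (intro CollectI exI[of _ 1] conjI ballI impI allI)
  show "holo4_on (ball 0 1) (model_field k M m l N n a b c d)" by (rule model_field_holo4)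
  fix p D assume p: "hyp_rho Qmodel p = 0" and D: "(hyp_rho Qmodel has_derivative D) (at p)"
  obtain z1 z2 \<zeta> w where pe: "p = (z1, z2, \<zeta>, w)" by (cases p)
  have "((\<lambda>q. Qmodel q - Qmodel q) has_derivative (\<lambda>_. 0)) (at (z1, z2, \<zeta>, Re w))" by simp
  note D' = has_derivative_unique[OF D[unfolded pe] hyp_rho_has_derivative[OF this]]
  obtain x1 x2 x3 x4 where X: "model_field k M m l N n a b c d (z1, z2, \<zeta>, w) = (x1, x2, x3, x4)"
    by (cases "model_field k M m l N n a b c d (z1, z2, \<zeta>, w)")
  have "Im w = 2 * Re (z1 * cnj \<zeta> + z2 * cnj \<zeta> ^ 2)" using p by (simp add: pe hyp_rho_def Qmodel_def)
  from model_field_tangent[OF this X] show "D (model_field k M m l N n a b c d p) = 0"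
    unfolding D' pe X by simp
qed simp

lemma model_field_zeroD:
  assumes "germ_eq (model_field k M m l N n a b c d) (\<lambda>_. 0)"
  shows "k = 0 \<and> M = 0 \<and> m = 0 \<and> l = 0 \<and> N = 0 \<and> n = 0 \<and> a = 0 \<and> b = 0 \<and> c = 0 \<and> d = 0"
proof -
  obtain r where r: "r > 0" "\<And>p. p \<in> ball 0 r \<Longrightarrow> model_field k M m l N n a b c d p = 0"
    using assms unfolding germ_eq_def by blast
  define \<epsilon> where "\<epsilon> = complex_of_real (r / 2)"
  have \<epsilon>: "norm \<epsilon> < r" "\<epsilon> \<noteq> 0" using r(1) by (auto simp: \<epsilon>_def)
  have ax: "(\<epsilon>, 0, 0, 0) \<in> ball (0 :: c4) r" "(0, 0, \<epsilon>, 0) \<in> ball (0 :: c4) r"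
    "(0, 0, - \<epsilon>, 0) \<in> ball (0 :: c4) r" "(0, 0, 0, \<epsilon>) \<in> ball (0 :: c4) r"
    unfolding mem_ball_0
    using norm_c4_le[of \<epsilon> 0 0 0] norm_c4_le[of 0 0 \<epsilon> 0] norm_c4_le[of 0 0 "- \<epsilon>" 0] norm_c4_le[of 0 0 0 \<epsilon>] \<epsilon>(1)
    by auto
  have 0: "a = 0" "b = 0" "c = 0" "d = 0"
    using r(2)[of 0] r(1) by (auto simp: model_field_def zero_prod_def)
  have 1: "M = 0" using r(2)[OF ax(1)] \<epsilon> by (simp add: model_field_def zero_prod_def 0)
  have 2: "N = 0" "l = 0" using r(2)[OF ax(4)] \<epsilon> by (auto simp: model_field_def zero_prod_def 0)
  \<comment> \<open>The points \<open>\<epsilon>\<close> and \<open>- \<epsilon>\<close> on the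
    \<zeta>-axis separate the linear term \<open>k\<close> from the quadratic term
    \<open>m\<close>.\<close>
  have e: "\<i> * of_real k * \<epsilon> + m * \<epsilon> ^ 2 = 0" "- \<i> * of_real k * \<epsilon> + m * \<epsilon> ^ 2 = 0"
    and e': "- cnj m * \<epsilon> + \<i> * of_real n * \<epsilon> ^ 2 = 0"
    using r(2)[OF ax(2)] r(2)[OF ax(3)] by (auto simp: model_field_def zero_prod_def 0 1 2)
  have "2 * m * \<epsilon> ^ 2 = 0" using e by algebra
  then have m: "m = 0" using \<epsilon> by simp
  then show ?thesis using e e' \<epsilon> by (auto simp: 0 1 2)
qed


text \<open>The order of the entries is that of \<open>params\<close>: 0 to 8 describe the
  stabilizer, 9 to 15 the value at 0.\<close>

definition model :: "(nat \<Rightarrow> real) \<Rightarrow> vf" where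
  "model \<theta> = model_field (\<theta> 0) (Complex (\<theta> 1) (\<theta> 2)) (Complex (\<theta> 3) (\<theta> 4)) (\<theta> 5) (Complex (\<theta> 6) (\<theta> 7)) (\<theta> 8)
     (Complex (\<theta> 9) (\<theta> 10)) (Complex (\<theta> 11) (\<theta> 12)) (Complex (\<theta> 13) (\<theta> 14)) (\<theta> 15)"

lemma model_aut: "model \<theta> \<in> aut_hyp Qmodel"
  unfolding model_def by (rule model_field_aut)

lemma model_zeroD: "germ_eq (model \<theta>) (\<lambda>_. 0) \<Longrightarrow> j < 16 \<Longrightarrow> \<theta> j = 0"
  unfolding model_def by (drule model_field_zeroD, erule less_16_cases) (auto simp: complex_eq_iff)

text \<open>So \<open>params\<close> inverts \<open>model\<close>; the sign and the division by 3 in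
  \<open>params\<close> undo \<open>- cnj m\<close> and \<open>3 * l\<close> in
  \<open>model_coef\<close>.\<close>

lemma model_power_series: "\<exists>a. (\<forall>\<rho>. power_series_on \<rho> a (model \<theta>)) \<and> (\<forall>j<16. params a j = \<theta> j)"
proof (intro exI conjI allI impI)
  show "power_series_on \<rho> (model_coef (\<theta> 0) (Complex (\<theta> 1) (\<theta> 2)) (Complex (\<theta> 3) (\<theta> 4)) (\<theta> 5) (Complex (\<theta> 6) (\<theta> 7)) (\<theta> 8)
     (Complex (\<theta> 9) (\<theta> 10)) (Complex (\<theta> 11) (\<theta> 12)) (Complex (\<theta> 13) (\<theta> 14)) (\<theta> 15)) (model \<theta>)" for \<rho>
    unfolding model_def by (rule model_field_power_series)
  show "params (model_coef (\<theta> 0) (Complex (\<theta> 1) (\<theta> 2)) (Complex (\<theta> 3) (\<theta> 4)) (\<theta> 5) (Complex (\<theta> 6) (\<theta> 7)) (\<theta> 8)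
     (Complex (\<theta> 9) (\<theta> 10)) (Complex (\<theta> 11) (\<theta> 12)) (Complex (\<theta> 13) (\<theta> 14)) (\<theta> 15)) j = \<theta> j" if "j < 16" for j
    using that by (cases rule: less_16_cases) (simp_all add: params_def model_coef_def)
qed

lemma model_add: "model (\<lambda>j. c * \<theta> j + \<theta>' j) p = c *\<^sub>R model \<theta> p + model \<theta>' p"
  by (cases p) (simp add: model_def model_field_def complex_eq_iff algebra_simps)

lemma model_0: "model (\<lambda>_. 0) p = 0"
  by (cases p) (simp add: model_def model_field_def zero_prod_def complex_eq_iff)

lemma model_sum:
  assumes "finite A"
  shows "model (\<lambda>j. \<Sum>i\<in>A. c i * \<theta> i j) p = (\<Sum>i\<in>A. c i *\<^sub>R model (\<theta> i) p)"
  using assms by (induction A) (simp_all add: model_0 model_add)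

definition model_basis :: "nat \<Rightarrow> vf list" where
  "model_basis n = map (\<lambda>i. model (\<lambda>j. if j = i then 1 else 0)) [0..<n]"

lemma lincomb_model_basis: "lincomb cs (model_basis n) = model (\<lambda>j. if j < n then cs ! j else 0)"
proof
  fix p
  have "lincomb cs (model_basis n) p = (\<Sum>i<n. (cs ! i) *\<^sub>R model (\<lambda>j. if j = i then 1 else 0) p)"
    by (simp add: lincomb_def model_basis_def)
  also have "\<dots> = model (\<lambda>j. \<Sum>i<n. cs ! i * (if j = i then 1 else 0)) p"
    by (simp add: model_sum)
  also have "(\<lambda>j. \<Sum>i<n. cs ! i * (if j = i then 1 else 0)) = (\<lambda>j. if j < n then cs ! j else 0)"
    by (auto simp: if_distrib[of "(*) _"] sum.delta cong: if_cong)
  finally show "lincomb cs (model_basis n) p = model (\<lambda>j. if j < n then cs ! j else 0) p" .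
qed

lemma germ_indep_model_basis:
  assumes "n \<le> 16"
  shows "germ_indep (model_basis n)"
  unfolding germ_indep_def
proof (intro allI impI)
  fix cs i assume "length cs = length (model_basis n)" and z: "germ_eq (lincomb cs (model_basis n)) (\<lambda>_. 0)" and "i < length cs"
  then have "i < n" by (simp add: model_basis_def)
  then show "cs ! i = 0" using model_zeroD[OF z[unfolded lincomb_model_basis], of i] assms by simp
qed

lemma germ_dim_aut_Qmodel: "germ_dim (aut_hyp Qmodel) 16"
  unfolding germ_dim_def
proof (intro conjI germ_dim_le_aut_hyp Gamma0_form_Qmodel exI[of _ "model_basis 16"])
  show "set (model_basis 16) \<subseteq> aut_hyp Qmodel" by (auto simp: model_basis_def model_aut)
  show "germ_indep (model_basis 16)" by (rule germ_indep_model_basis) simp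
qed (simp add: model_basis_def)

lemma germ_dim_aut0_Qmodel: "germ_dim (aut0_hyp Qmodel) 9"
  unfolding germ_dim_def
proof (intro conjI germ_dim_le_aut0_hyp Gamma0_form_Qmodel exI[of _ "model_basis 9"])
  have "model (\<lambda>j. if j = i then 1 else 0) 0 = 0" if "i < 9" for i
    using that by (simp add: model_def model_field_def zero_prod_def complex_eq_iff)
  then show "set (model_basis 9) \<subseteq> aut0_hyp Qmodel"
    by (auto simp: model_basis_def aut0_hyp_def model_aut)
  show "germ_indep (model_basis 9)" by (rule germ_indep_model_basis) simp
qed (simp add: model_basis_def)

text \<open>The difference of \<open>X\<close> and the model field with the same parameters is
  tangent to \<open>Q\<close> and has zero parameters.\<close>

lemma aut_Qmodel_eq_model:
  assumes X: "X \<in> aut_hyp Qmodel" and a: "power_series_on \<rho> a X" and \<rho>: "\<rho> > 0"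
  shows "germ_eq X (model (params a))"
proof -
  obtain a' where a': "power_series_on \<rho> a' (model (params a))" "\<And>j. j < 16 \<Longrightarrow> params a' j = params a j"
    using model_power_series by blast
  \<comment> \<open>The difference is written as a sum over \<open>bool\<close>, so that
    \<open>aut_hyp_sum\<close>, \<open>power_series_on_sum\<close> and \<open>params_sum\<close>
    apply to it.\<close>
  define c where "c b = (if b then 1 else - 1 :: real)" for b
  define Y where "Y b = (if b then X else model (params a))" for b
  define A where "A b = (if b then a else a')" for b
  have "germ_eq (\<lambda>p. \<Sum>b\<in>UNIV. c b *\<^sub>R Y b p) (\<lambda>_. 0)"
  proof (rule germ_zero_if_params_zero[OF Gamma0_form_Qmodel _ \<rho>])
    show "(\<lambda>p. \<Sum>b\<in>UNIV. c b *\<^sub>R Y b p) \<in> aut_hyp Qmodel"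
      by (rule aut_hyp_sum) (auto simp: Y_def X model_aut)
    show "power_series_on \<rho> (\<lambda>\<alpha>. \<Sum>b\<in>UNIV. c b *\<^sub>R A b \<alpha>) (\<lambda>p. \<Sum>b\<in>UNIV. c b *\<^sub>R Y b p)"
      by (rule power_series_on_sum) (auto simp: Y_def A_def a a')
    show "params (\<lambda>\<alpha>. \<Sum>b\<in>UNIV. c b *\<^sub>R A b \<alpha>) j = 0" if "j < 16" for j
      unfolding params_sum[OF that] by (simp add: UNIV_bool c_def A_def a'(2)[OF that])
  qed
  then show ?thesis by (simp add: germ_eq_def UNIV_bool c_def Y_def)
qed

lemma aut_hyp_germ_eq:
  assumes "germ_eq X Y" "Y \<in> aut_hyp F"
  shows "X \<in> aut_hyp F"
proof -
  obtain r where r: "r > 0" "\<And>p. p \<in> ball 0 r \<Longrightarrow> X p = Y p" using assms(1) unfolding germ_eq_def by blast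
  obtain s where s: "s > 0" "holo4_on (ball 0 s) Y" "\<And>p D. \<lbrakk>p \<in> ball 0 s; hyp_rho F p = 0; (hyp_rho F has_derivative D) (at p)\<rbrakk> \<Longrightarrow> D (Y p) = 0"
    using assms(2) unfolding aut_hyp_def by blast
  show ?thesis unfolding aut_hyp_def
  proof (intro CollectI exI[of _ "min r s"] conjI ballI impI allI)
    show "holo4_on (ball 0 (min r s)) X" unfolding holo4_on_def
    proof
      fix p :: c4 assume p: "p \<in> ball 0 (min r s)"
      then have "p \<in> ball 0 s" by simp
      then obtain D where D: "(Y has_derivative D) (at p)" "\<forall>c v. D (cmul4 c v) = cmul4 c (D v)"
        using s(2) unfolding holo4_on_def by blast
      have "(X has_derivative D) (at p)"
        by (rule has_derivative_transform_within_open[OF D(1), of "ball 0 r"]) (use p r(2) in auto)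
      then show "\<exists>D. (X has_derivative D) (at p) \<and> (\<forall>c v. D (cmul4 c v) = cmul4 c (D v))" using D(2) by blast
    qed
    fix p D assume p: "p \<in> ball 0 (min r s)" "hyp_rho F p = 0" "(hyp_rho F has_derivative D) (at p)"
    then show "D (X p) = 0" using r(2)[of p] s(3)[of p D] by simp
  qed (use r s in auto)
qed

section \<open>Direct sum decompositions\<close>

lemma sum_lessThan_5: "(\<Sum>i<5. f i) = f 0 + f 1 + f 2 + f 3 + f (4::nat)"
  by (simp add: eval_nat_numeral)

lemma sum_lessThan_3: "(\<Sum>i<3. f i) = f 0 + f 1 + f (2::nat)"
  by (simp add: eval_nat_numeral)

lemma all_less_5: "(\<forall>i<5. P i) \<longleftrightarrow> P 0 \<and> P 1 \<and> P 2 \<and> P 3 \<and> P (4::nat)"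
  by (auto simp: less_Suc_eq eval_nat_numeral)

lemma all_less_3: "(\<forall>i<3. P i) \<longleftrightarrow> P 0 \<and> P 1 \<and> P (2::nat)"
  by (auto simp: less_Suc_eq eval_nat_numeral)

lemma model_field_split:
  "model_field k M m l N n a b c d p =
     (\<lambda>(z1, z2, \<zeta>, w). (0, 0, 0, complex_of_real d)) p
     + (\<lambda>(z1, z2, \<zeta>, w). (a, 0, 0, 2 * \<i> * cnj a * \<zeta>)) p
     + (\<lambda>(z1, z2, \<zeta>, w). (- 2 * cnj c * z2 + \<i> * complex_of_real k * \<zeta>, b, c,
              2 * \<i> * cnj c * z1 + 2 * \<i> * cnj b * \<zeta> ^ 2)) p
     + (\<lambda>(z1, z2, \<zeta>, w). (M * z1 + m * \<zeta> ^ 2, (2 * M - 3 * complex_of_real l) * z2 - cnj m * \<zeta>,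
              (3 * complex_of_real l - cnj M) * \<zeta>, 3 * complex_of_real l * w)) p
     + (\<lambda>(z1, z2, \<zeta>, w). (2 * \<i> * cnj N * z1 * \<zeta> + N * w,
              2 * \<i> * cnj N * z2 * \<zeta> - \<i> * N * z1 + \<i> * complex_of_real n * \<zeta> ^ 2,
              \<i> * cnj N * \<zeta> ^ 2, 2 * \<i> * cnj N * \<zeta> * w)) p"
  by (cases p) (simp add: model_field_def)

lemma model_field_split0:
  "model_field k M m l N n 0 0 0 0 p =
     (\<lambda>(z1, z2, \<zeta>, w). (\<i> * complex_of_real k * \<zeta>, 0, 0, 0)) p
     + (\<lambda>(z1, z2, \<zeta>, w). (M * z1 + m * \<zeta> ^ 2, (2 * M - 3 * complex_of_real l) * z2 - cnj m * \<zeta>,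
              (3 * complex_of_real l - cnj M) * \<zeta>, 3 * complex_of_real l * w)) p
     + (\<lambda>(z1, z2, \<zeta>, w). (2 * \<i> * cnj N * z1 * \<zeta> + N * w,
              2 * \<i> * cnj N * z2 * \<zeta> - \<i> * N * z1 + \<i> * complex_of_real n * \<zeta> ^ 2,
              \<i> * cnj N * \<zeta> ^ 2, 2 * \<i> * cnj N * \<zeta> * w)) p"
  by (cases p) (simp add: model_field_def)

lemma list_of_length_5: "length Ys = 5 \<longleftrightarrow> (\<exists>y0 y1 y2 y3 y4. Ys = [y0, y1, y2, y3, y4])"
  by (auto simp: eval_nat_numeral length_Suc_conv)

lemma list_of_length_3: "length Ys = 3 \<longleftrightarrow> (\<exists>y0 y1 y2. Ys = [y0, y1, y2])"
  by (auto simp: eval_nat_numeral length_Suc_conv)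

lemma germ_direct_sum_5:
  "germ_direct_sum S [A0, A1, A2, A3, A4] \<longleftrightarrow>
     (\<forall>X. X \<in> S \<longleftrightarrow> (\<exists>y0\<in>A0. \<exists>y1\<in>A1. \<exists>y2\<in>A2. \<exists>y3\<in>A3. \<exists>y4\<in>A4. germ_eq X (\<lambda>p. y0 p + y1 p + y2 p + y3 p + y4 p))) \<and>
     (\<forall>y0\<in>A0. \<forall>y1\<in>A1. \<forall>y2\<in>A2. \<forall>y3\<in>A3. \<forall>y4\<in>A4. germ_eq (\<lambda>p. y0 p + y1 p + y2 p + y3 p + y4 p) (\<lambda>_. 0) \<longrightarrow>
        germ_eq y0 (\<lambda>_. 0) \<and> germ_eq y1 (\<lambda>_. 0) \<and> germ_eq y2 (\<lambda>_. 0) \<and> germ_eq y3 (\<lambda>_. 0) \<and> germ_eq y4 (\<lambda>_. 0))"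
proof -
  have l: "length [A0, A1, A2, A3, A4] = 5" by simp
  have ex: "(\<exists>Ys. length Ys = 5 \<and> P Ys) \<longleftrightarrow> (\<exists>y0 y1 y2 y3 y4. P [y0, y1, y2, y3, y4])"
    and all: "(\<forall>Ys. length Ys = 5 \<longrightarrow> P Ys) \<longleftrightarrow> (\<forall>y0 y1 y2 y3 y4. P [y0, y1, y2, y3, y4])" for P :: "vf list \<Rightarrow> bool"
    unfolding list_of_length_5 by blast+
  have l2: "length [y0, y1, y2, y3, y4] = 5" for y0 y1 y2 y3 y4 :: vf by simp
  show ?thesis unfolding germ_direct_sum_def l ex all l2 all_less_5 sum_lessThan_5
    by (simp add: Bex_def Ball_def) (intro conj_cong refl; blast)
qed

lemma germ_direct_sum_3:
  "germ_direct_sum S [A0, A1, A2] \<longleftrightarrow>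
     (\<forall>X. X \<in> S \<longleftrightarrow> (\<exists>y0\<in>A0. \<exists>y1\<in>A1. \<exists>y2\<in>A2. germ_eq X (\<lambda>p. y0 p + y1 p + y2 p))) \<and>
     (\<forall>y0\<in>A0. \<forall>y1\<in>A1. \<forall>y2\<in>A2. germ_eq (\<lambda>p. y0 p + y1 p + y2 p) (\<lambda>_. 0) \<longrightarrow>
        germ_eq y0 (\<lambda>_. 0) \<and> germ_eq y1 (\<lambda>_. 0) \<and> germ_eq y2 (\<lambda>_. 0))"
proof -
  have l: "length [A0, A1, A2] = 3" by simp
  have ex: "(\<exists>Ys. length Ys = 3 \<and> P Ys) \<longleftrightarrow> (\<exists>y0 y1 y2. P [y0, y1, y2])"
    and all: "(\<forall>Ys. length Ys = 3 \<longrightarrow> P Ys) \<longleftrightarrow> (\<forall>y0 y1 y2. P [y0, y1, y2])" for P :: "vf list \<Rightarrow> bool"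
    unfolding list_of_length_3 by blast+
  have l2: "length [y0, y1, y2] = 3" for y0 y1 y2 :: vf by simp
  show ?thesis unfolding germ_direct_sum_def l ex all l2 all_less_3 sum_lessThan_3
    by (simp add: Bex_def Ball_def) (intro conj_cong refl; blast)
qed

lemma germ_eq_refl: "germ_eq X X"
  unfolding germ_eq_def by (intro exI[of _ 1]) simp

text \<open>Sums of elements of the five spaces are exactly the fields \<open>model_field\<close>;
  directness holds because a vanishing one has all ten parameters 0 by
  \<open>model_field_zeroD\<close>.\<close>

lemma direct_sum_aut_Qmodel: "germ_direct_sum (aut_hyp Qmodel) [g_m3, g_m2, g_m1, g_0, g_1]"
  unfolding germ_direct_sum_5
proof (intro conjI allI iffI ballI impI)
  fix X assume X: "X \<in> aut_hyp Qmodel"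
  obtain \<rho> a where "\<rho> > 0" "power_series_on \<rho> a X" using aut_hyp_power_series[OF X] .
  from aut_Qmodel_eq_model[OF X this(2,1)] obtain k M m l N n a b c d where
    "germ_eq X (model_field k M m l N n a b c d)" unfolding model_def by blast
  then have "germ_eq X (\<lambda>p. model_field k M m l N n a b c d p)" by simp
  then show "\<exists>y0\<in>g_m3. \<exists>y1\<in>g_m2. \<exists>y2\<in>g_m1. \<exists>y3\<in>g_0. \<exists>y4\<in>g_1. germ_eq X (\<lambda>p. y0 p + y1 p + y2 p + y3 p + y4 p)"
    unfolding model_field_split g_m3_def g_m2_def g_m1_def g_0_def g_1_def by blast
next
  fix X assume "\<exists>y0\<in>g_m3. \<exists>y1\<in>g_m2. \<exists>y2\<in>g_m1. \<exists>y3\<in>g_0. \<exists>y4\<in>g_1. germ_eq X (\<lambda>p. y0 p + y1 p + y2 p + y3 p + y4 p)"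
  then obtain k M m l N n a b c d where "germ_eq X (model_field k M m l N n a b c d)"
    unfolding g_m3_def g_m2_def g_m1_def g_0_def g_1_def
    by (elim bexE CollectE exE conjE) (simp only: model_field_split[symmetric])
  then show "X \<in> aut_hyp Qmodel" using aut_hyp_germ_eq model_field_aut by blast
next
  fix y0 y1 y2 y3 y4
  assume y: "y0 \<in> g_m3" "y1 \<in> g_m2" "y2 \<in> g_m1" "y3 \<in> g_0" "y4 \<in> g_1"
    and z: "germ_eq (\<lambda>p. y0 p + y1 p + y2 p + y3 p + y4 p) (\<lambda>_. 0)"
  from y obtain k M m l N n a b c d where e:
    "y0 = (\<lambda>(z1, z2, \<zeta>, w). (0, 0, 0, complex_of_real d))"
    "y1 = (\<lambda>(z1, z2, \<zeta>, w). (a, 0, 0, 2 * \<i> * cnj a * \<zeta>))"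
    "y2 = (\<lambda>(z1, z2, \<zeta>, w). (- 2 * cnj c * z2 + \<i> * complex_of_real k * \<zeta>, b, c,
              2 * \<i> * cnj c * z1 + 2 * \<i> * cnj b * \<zeta> ^ 2))"
    "y3 = (\<lambda>(z1, z2, \<zeta>, w). (M * z1 + m * \<zeta> ^ 2, (2 * M - 3 * complex_of_real l) * z2 - cnj m * \<zeta>,
              (3 * complex_of_real l - cnj M) * \<zeta>, 3 * complex_of_real l * w))"
    "y4 = (\<lambda>(z1, z2, \<zeta>, w). (2 * \<i> * cnj N * z1 * \<zeta> + N * w,
              2 * \<i> * cnj N * z2 * \<zeta> - \<i> * N * z1 + \<i> * complex_of_real n * \<zeta> ^ 2,
              \<i> * cnj N * \<zeta> ^ 2, 2 * \<i> * cnj N * \<zeta> * w))"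
    unfolding g_m3_def g_m2_def g_m1_def g_0_def g_1_def by blast
  have "germ_eq (model_field k M m l N n a b c d) (\<lambda>_. 0)"
    using z unfolding e model_field_split[symmetric] by simp
  from model_field_zeroD[OF this]
  have "y0 = (\<lambda>_. 0)" "y1 = (\<lambda>_. 0)" "y2 = (\<lambda>_. 0)" "y3 = (\<lambda>_. 0)" "y4 = (\<lambda>_. 0)"
    unfolding e by (auto simp: zero_prod_def)
  then show "germ_eq y0 (\<lambda>_. 0)" "germ_eq y1 (\<lambda>_. 0)" "germ_eq y2 (\<lambda>_. 0)" "germ_eq y3 (\<lambda>_. 0)" "germ_eq y4 (\<lambda>_. 0)"
    by (simp_all add: germ_eq_refl)
qed

text \<open>Vanishing at 0 forces \<open>a = b = c = d = 0\<close>, which removes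
  \<open>g_m3\<close> and \<open>g_m2\<close> and cuts \<open>g_m1\<close> down to
  \<open>g_m1''\<close>.\<close>

lemma direct_sum_aut0_Qmodel: "germ_direct_sum (aut0_hyp Qmodel) [g_m1'', g_0, g_1]"
  unfolding germ_direct_sum_3
proof (intro conjI allI iffI ballI impI)
  fix X assume "X \<in> aut0_hyp Qmodel"
  then have X: "X \<in> aut_hyp Qmodel" "X 0 = 0" by (auto simp: aut0_hyp_def)
  obtain \<rho> a where a: "\<rho> > 0" "power_series_on \<rho> a X" using aut_hyp_power_series[OF X(1)] .
  have "model (params a) = model_field (params a 0) (Complex (params a 1) (params a 2)) (Complex (params a 3) (params a 4))
      (params a 5) (Complex (params a 6) (params a 7)) (params a 8) 0 0 0 0"
    using params_stabilizer[OF X(2) a] by (simp add: model_def flip: complex_of_real_def zero_complex.code)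
  with aut_Qmodel_eq_model[OF X(1) a(2,1)] obtain k M m l N n where
    "germ_eq X (model_field k M m l N n 0 0 0 0)" by metis
  then have "germ_eq X (\<lambda>p. model_field k M m l N n 0 0 0 0 p)" by simp
  then show "\<exists>y0\<in>g_m1''. \<exists>y1\<in>g_0. \<exists>y2\<in>g_1. germ_eq X (\<lambda>p. y0 p + y1 p + y2 p)"
    unfolding model_field_split0 g_m1''_def g_0_def g_1_def by blast
next
  fix X assume "\<exists>y0\<in>g_m1''. \<exists>y1\<in>g_0. \<exists>y2\<in>g_1. germ_eq X (\<lambda>p. y0 p + y1 p + y2 p)"
  then obtain k M m l N n where X: "germ_eq X (model_field k M m l N n 0 0 0 0)"
    unfolding g_m1''_def g_0_def g_1_def
    by (elim bexE CollectE exE conjE) (simp only: model_field_split0[symmetric])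
  then have "X 0 = model_field k M m l N n 0 0 0 0 0" unfolding germ_eq_def by fastforce
  then have "X 0 = 0" by (simp add: model_field_def zero_prod_def)
  then show "X \<in> aut0_hyp Qmodel" using X aut_hyp_germ_eq model_field_aut unfolding aut0_hyp_def by blast
next
  fix y0 y1 y2
  assume y: "y0 \<in> g_m1''" "y1 \<in> g_0" "y2 \<in> g_1"
    and z: "germ_eq (\<lambda>p. y0 p + y1 p + y2 p) (\<lambda>_. 0)"
  from y obtain k M m l N n where e:
    "y0 = (\<lambda>(z1, z2, \<zeta>, w). (\<i> * complex_of_real k * \<zeta>, 0, 0, 0))"
    "y1 = (\<lambda>(z1, z2, \<zeta>, w). (M * z1 + m * \<zeta> ^ 2, (2 * M - 3 * complex_of_real l) * z2 - cnj m * \<zeta>,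
              (3 * complex_of_real l - cnj M) * \<zeta>, 3 * complex_of_real l * w))"
    "y2 = (\<lambda>(z1, z2, \<zeta>, w). (2 * \<i> * cnj N * z1 * \<zeta> + N * w,
              2 * \<i> * cnj N * z2 * \<zeta> - \<i> * N * z1 + \<i> * complex_of_real n * \<zeta> ^ 2,
              \<i> * cnj N * \<zeta> ^ 2, 2 * \<i> * cnj N * \<zeta> * w))"
    unfolding g_m1''_def g_0_def g_1_def by blast
  have "germ_eq (model_field k M m l N n 0 0 0 0) (\<lambda>_. 0)"
    using z unfolding e model_field_split0[symmetric] by simp
  from model_field_zeroD[OF this]
  have "y0 = (\<lambda>_. 0)" "y1 = (\<lambda>_. 0)" "y2 = (\<lambda>_. 0)"
    unfolding e by (auto simp: zero_prod_def)
  then show "germ_eq y0 (\<lambda>_. 0)" "germ_eq y1 (\<lambda>_. 0)" "germ_eq y2 (\<lambda>_. 0)"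
    by (simp_all add: germ_eq_refl)
qed

theorem theorem15:
  shows "germ_direct_sum (aut_hyp Qmodel) [g_m3, g_m2, g_m1, g_0, g_1]
       \<and> germ_dim (aut_hyp Qmodel) 16
       \<and> germ_direct_sum (aut0_hyp Qmodel) [g_m1'', g_0, g_1]
       \<and> germ_dim (aut0_hyp Qmodel) 9
       \<and> (\<forall>F. Gamma0_form F \<longrightarrow> germ_dim_le (aut_hyp F) 16 \<and> germ_dim_le (aut0_hyp F) 9)"
  using direct_sum_aut_Qmodel germ_dim_aut_Qmodel direct_sum_aut0_Qmodel germ_dim_aut0_Qmodel
    germ_dim_le_aut_hyp germ_dim_le_aut0_hyp by blast

end
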